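(* Let $v:\mathbb{R}^2\to\mathbb{R}^2$ be a vector field of class $C^2(\mathbb{R}^2)$ solving, with some pressure $p\in C^1(\mathbb{R}^2,\mathbb{R})$, the stationary incompressible Euler equations $v\cdot\nabla v+\nabla p=0$ and $\operatorname{div} v=0$ in $\mathbb{R}^2$. Assume that $v\in L^\infty(\mathbb{R}^2)$ and that $\inf_{\mathbb{R}^2}|v|>0$. Then $v$ is a shear flow. Namely, there are a unit vector $e=(e_1,e_2)\in\mathbb{S}^1$ and a function $V:\mathbb{R}\to\mathbb{R}$ such that $v(x)=V(x\cdot e^{\perp})\,e$ for all $x\in\mathbb{R}^2$, where $e^\perp=(-e_2,e_1)$, and the function $V$ has a constant strict sign (either $V>0$ on $\mathbb{R}$ or $V<0$ on $\mathbb{R}$).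
   Context: $|\cdot|$ is the Euclidean norm on $\mathbb{R}^2$ and $\mathbb{S}^1$ is the unit circle in $\mathbb{R}^2$. Solutions of the Euler equations are understood in the classical sense: $v$ and $p$ are at least of class $C^1(\mathbb{R}^2)$ and satisfy the equations pointwise. A flow $v$ is called a shear flow if there is a unit vector $e\in\mathbb{S}^1$ such that $v(x)$ is parallel to $e$ for all $x$; for a divergence-free flow this means that $v(x)=V(x\cdot e^\perp)\,e$ for some function $V:\mathbb{R}\to\mathbb{R}$. *)

theory Defs
  imports "HOL-Analysis.Analysis"
begin

definition class_C1 :: "('a::real_normed_vector \<Rightarrow> 'b::real_normed_vector) \<Rightarrow> bool" where
  "class_C1 f \<longleftrightarrow>
     (\<exists>f' :: 'a \<Rightarrow> 'a \<Rightarrow>\<^sub>L 'b.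
        (\<forall>x. (f has_derivative blinfun_apply (f' x)) (at x)) \<and> continuous_on UNIV f')"

definition class_C2 :: "('a::real_normed_vector \<Rightarrow> 'b::real_normed_vector) \<Rightarrow> bool" where
  "class_C2 f \<longleftrightarrow>
     (\<exists>f' :: 'a \<Rightarrow> 'a \<Rightarrow>\<^sub>L 'b.
        (\<forall>x. (f has_derivative blinfun_apply (f' x)) (at x)) \<and> class_C1 f')"

(* The space L^infinity with respect to Lebesgue measure: f is essentially bounded. *)
definition in_Linfty :: "('a::euclidean_space \<Rightarrow> 'b::euclidean_space) \<Rightarrow> bool" where
  "in_Linfty f \<longleftrightarrow>
     f \<in> borel_measurable lebesgue \<and> (\<exists>M. AE x in lebesgue. norm (f x) \<le> M)"

(* As deriv is a total function, the operators below are meaningful only for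
   differentiable arguments. *)
definition partial_deriv :: "'n::finite \<Rightarrow> (real ^ 'n \<Rightarrow> real) \<Rightarrow> real ^ 'n \<Rightarrow> real" where
  "partial_deriv j f x = deriv (\<lambda>t. f (x + t *\<^sub>R axis j 1)) 0"

definition gradient :: "(real ^ 'n \<Rightarrow> real) \<Rightarrow> real ^ 'n \<Rightarrow> real ^ 'n::finite" where
  "gradient f x = (\<chi> i. partial_deriv i f x)"

definition divergence :: "(real ^ 'n \<Rightarrow> real ^ 'n) \<Rightarrow> real ^ 'n::finite \<Rightarrow> real" where
  "divergence v x = (\<Sum>j\<in>UNIV. partial_deriv j (\<lambda>y. v y $ j) x)"

(* The term v . nabla v, whose i-th component is the sum over j of v_j d_j v_i. *)
definition convective :: "(real ^ 'n \<Rightarrow> real ^ 'n) \<Rightarrow> real ^ 'n \<Rightarrow> real ^ 'n::finite" where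
  "convective v x = (\<chi> i. \<Sum>j\<in>UNIV. v x $ j * partial_deriv j (\<lambda>y. v y $ i) x)"

definition stationary_euler ::
    "(real ^ 'n \<Rightarrow> real ^ 'n) \<Rightarrow> (real ^ 'n::finite \<Rightarrow> real) \<Rightarrow> bool" where
  "stationary_euler v p \<longleftrightarrow>
     (\<forall>x. convective v x + gradient p x = 0) \<and> (\<forall>x. divergence v x = 0)"

definition shear_flow :: "(real ^ 2 \<Rightarrow> real ^ 2) \<Rightarrow> bool" where
  "shear_flow v \<longleftrightarrow> (\<exists>e. norm e = 1 \<and> (\<forall>x. \<exists>c. v x = c *\<^sub>R e))"

definition perp :: "real ^ 2 \<Rightarrow> real ^ 2" where
  "perp e = vector [- (e $ 2), e $ 1]"

end

theory Submission
  imports Defs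
begin

text \<open>
Write \<open>v\<close> for the velocity, \<open>a = |v|^2\<close>, \<open>\<phi>\<close> for a continuous angle of the stream function's
gradient, \<open>u\<close> for the stream function, so that \<open>v\<close> is \<open>\<i> * gu\<close> in complex notation. The
Euler equations say exactly that \<open>grad p = - \<i> a grad \<phi>\<close>: up to the bounded weight \<open>a\<close>,
pressure and angle are conjugate functions. Hence \<open>div (a grad \<phi>) = 0\<close> and
\<open>div (grad p / a) = 0\<close>, with weights between two positive constants. It suffices to show
that \<open>p\<close> is bounded: a bounded solution of such an equation on the whole plane is constant
(\<open>weak_liouville\<close>), then \<open>\<phi>\<close> is constant, the direction of \<open>v\<close> does not change, and
\<open>div v = 0\<close> makes \<open>|v|\<close> constant along that direction.

Boundedness of \<open>p\<close> is proved by contradiction. By Bernoulli's law \<open>p + a/2\<close> is a function of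
\<open>u\<close> alone, because each level set of \<open>u\<close> is a single streamline (\<open>level_orbit\<close>); so \<open>p\<close>
varies by a bounded amount on a level set and is bounded on every strip between two level
sets. If \<open>p\<close> is unbounded, there is a strip on one side of which \<open>p\<close> lies below some value
\<open>c\<close> while on the other side it lies above \<open>c + 1\<close>. Let \<open>P\<close> be the pressure truncated to
values between 0 and 1 in the strip and extended by 0 and 1. Two bounds for the Dirichlet
integral of \<open>P\<close> over a square of side \<open>R\<close> contradict each other.

Lower bound, linear in \<open>R\<close>: the streamline bounding the strip is unbounded, and near each of
its points \<open>P\<close> has to climb from 0 to 1 at a uniform rate, since Caccioppoli's inequality
and the Courant--Lebesgue lemma give uniform moduli of continuity for \<open>p\<close> and \<open>\<phi>\<close> along the
strip (\<open>strip_uniform\<close>, \<open>strip_energy_lower\<close>, \<open>energy_linear\<close>).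

Upper bound, of the order of \<open>(log R)^2\<close>: integrating by parts twice moves the derivatives
so that only the oscillation of \<open>\<phi>\<close> inside the strip enters (\<open>strip_energy_bound\<close>), and this
oscillation grows at most like \<open>log R\<close> (\<open>strip_angle_growth\<close>). The last fact is topological.
A trajectory of the gradient of \<open>u\<close> satisfies a chord-arc inequality, because \<open>|grad u|\<close>
lies between two positive constants; so the angle of a chord of the trajectory changes by a
bounded amount when the length of the chord is multiplied by a constant. For two points of
the strip at distance \<open>R\<close> the chords of length about \<open>R\<close> are then compared by rotating one
of them about its foot until it meets the trajectory through the foot
(\<open>rotation_hits_line\<close>).
\<close>

section \<open>Gradients and closed forms on the plane\<close>

text \<open>The gradient of a real function is stored as a complex number. For gradients \<open>g\<close> and \<open>h\<close> the
real part of \<open>cnj g * h\<close> is their inner product and its imaginary part is the wedge product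
of the two differentials.\<close>

definition C1_grad :: "(complex \<Rightarrow> real) \<Rightarrow> (complex \<Rightarrow> complex) \<Rightarrow> bool" where
  "C1_grad f g \<longleftrightarrow> continuous_on UNIV g \<and> (\<forall>z. (f has_derivative (\<lambda>h. g z \<bullet> h)) (at z))"

lemma C1_gradD:
  assumes "C1_grad f g"
  shows "continuous_on UNIV g" "(f has_derivative (\<lambda>h. g z \<bullet> h)) (at z)" "continuous_on UNIV f"
proof -
  show "continuous_on UNIV g" and d: "(f has_derivative (\<lambda>h. g z \<bullet> h)) (at z)" for z
    using assms by (simp_all add: C1_grad_def)
  then show "continuous_on UNIV f"
    by (meson continuous_at_imp_continuous_on has_derivative_continuous)
qed

lemma C1_grad_along:
  assumes "C1_grad f g" "(c has_vector_derivative c') (at t within T)"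
  shows "((\<lambda>t. f (c t)) has_real_derivative (g (c t) \<bullet> c')) (at t within T)"
proof -
  have "((\<lambda>t. f (c t)) has_derivative (\<lambda>s. g (c t) \<bullet> (s *\<^sub>R c'))) (at t within T)"
    using has_derivative_compose[of c "\<lambda>s. s *\<^sub>R c'" t T f "\<lambda>h. g (c t) \<bullet> h"] assms
    unfolding C1_grad_def has_vector_derivative_def by auto
  then show ?thesis by (simp add: has_field_derivative_def mult_commute_abs)
qed

lemma Complex_cont [continuous_intros]:
  assumes "continuous_on S f" "continuous_on S g"
  shows "continuous_on S (\<lambda>x. Complex (f x) (g x))"
  unfolding Complex_eq by (intro continuous_intros assms)

lemma Complex_vd1: "((\<lambda>x. Complex x y) has_vector_derivative 1) (at x within T)"
  unfolding Complex_eq by (auto intro!: derivative_eq_intros simp: has_vector_derivative_def scaleR_conv_of_real)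

lemma Complex_vd2: "((\<lambda>y. Complex x y) has_vector_derivative \<i>) (at y within T)"
  unfolding Complex_eq by (auto intro!: derivative_eq_intros simp: has_vector_derivative_def scaleR_conv_of_real)

lemma C1_grad_fst:
  assumes "C1_grad f g"
  shows "((\<lambda>x. f (Complex x y)) has_real_derivative Re (g (Complex x y))) (at x within T)"
  using C1_grad_along[OF assms Complex_vd1] by (simp add: inner_complex_def)

lemma C1_grad_snd:
  assumes "C1_grad f g"
  shows "((\<lambda>y. f (Complex x y)) has_real_derivative Im (g (Complex x y))) (at y within T)"
  using C1_grad_along[OF assms Complex_vd2] by (simp add: inner_complex_def)

lemma C1_grad_cong: "C1_grad f g \<Longrightarrow> (\<And>z. f z = f' z) \<Longrightarrow> (\<And>z. g z = g' z) \<Longrightarrow> C1_grad f' g'"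
  by (metis ext)

lemma C1_grad_const: "C1_grad (\<lambda>z. c) (\<lambda>z. 0)"
  by (auto simp: C1_grad_def)

lemma C1_grad_add:
  assumes f: "C1_grad f g" and f': "C1_grad f' g'" shows "C1_grad (\<lambda>z. f z + f' z) (\<lambda>z. g z + g' z)"
  unfolding C1_grad_def
proof (intro conjI allI)
  show "continuous_on UNIV (\<lambda>z. g z + g' z)"
    by (intro continuous_on_add C1_gradD(1)[OF f] C1_gradD(1)[OF f'])
  show "((\<lambda>z. f z + f' z) has_derivative (\<lambda>h. (g z + g' z) \<bullet> h)) (at z)" for z
    unfolding inner_add_left
    by (rule has_derivative_add[OF C1_gradD(2)[OF f, of z] C1_gradD(2)[OF f', of z]])
qed

lemma C1_grad_mult:
  assumes f: "C1_grad f g" and f': "C1_grad f' g'"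
  shows "C1_grad (\<lambda>z. f z * f' z) (\<lambda>z. f z *\<^sub>R g' z + f' z *\<^sub>R g z)"
  unfolding C1_grad_def
proof (intro conjI allI)
  show "continuous_on UNIV (\<lambda>z. f z *\<^sub>R g' z + f' z *\<^sub>R g z)"
    by (intro continuous_on_add continuous_on_scaleR C1_gradD(1,3)[OF f] C1_gradD(1,3)[OF f'])
  show "((\<lambda>z. f z * f' z) has_derivative (\<lambda>h. (f z *\<^sub>R g' z + f' z *\<^sub>R g z) \<bullet> h)) (at z)" for z
  proof -
    have e: "(\<lambda>h. (f z *\<^sub>R g' z + f' z *\<^sub>R g z) \<bullet> h) = (\<lambda>h. f z * (g' z \<bullet> h) + (g z \<bullet> h) * f' z)"
      by (rule ext) (simp add: inner_add_left)
    show ?thesis unfolding e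
      by (rule has_derivative_mult[OF C1_gradD(2)[OF f, of z] C1_gradD(2)[OF f', of z]])
  qed
qed

lemma C1_grad_cmult:
  assumes "C1_grad f g" shows "C1_grad (\<lambda>z. c * f z) (\<lambda>z. c *\<^sub>R g z)"
  by (rule C1_grad_cong[OF C1_grad_mult[OF C1_grad_const[of c] assms]]) simp_all

lemma C1_grad_diff_const:
  assumes "C1_grad f g" shows "C1_grad (\<lambda>z. f z - c) g"
  by (rule C1_grad_cong[OF C1_grad_add[OF assms C1_grad_const[of "-c"]]]) simp_all

lemma C1_grad_chain:
  assumes "C1_grad f g" "\<And>t. (q has_real_derivative q' t) (at t)" "continuous_on UNIV q'"
  shows "C1_grad (\<lambda>z. q (f z)) (\<lambda>z. q' (f z) *\<^sub>R g z)"
  unfolding C1_grad_def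
proof (intro conjI allI)
  show "continuous_on UNIV (\<lambda>z. q' (f z) *\<^sub>R g z)"
    by (intro continuous_intros continuous_on_compose2[OF assms(3)] C1_gradD[OF assms(1)]) auto
  fix z
  show "((\<lambda>z. q (f z)) has_derivative (\<lambda>h. q' (f z) *\<^sub>R g z \<bullet> h)) (at z)"
    using has_derivative_compose[OF C1_gradD(2)[OF assms(1), of z] assms(2)[unfolded has_field_derivative_def, of "f z"]]
    by simp
qed

text \<open>Integration is over squares (centre \<open>z\<close>, half side \<open>r\<close>), so that Fubini's theorem is the
only tool needed to reduce it to one variable.\<close>

definition bint :: "complex \<Rightarrow> real \<Rightarrow> (complex \<Rightarrow> real) \<Rightarrow> real" where
  "bint z r f = integral (cbox (Re z - r, Im z - r) (Re z + r, Im z + r)) (\<lambda>q. f (Complex (fst q) (snd q)))"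

lemma cont_pair:
  assumes "continuous_on UNIV (f :: complex \<Rightarrow> 'a::real_normed_vector)"
  shows "continuous_on S (\<lambda>q::real\<times>real. f (Complex (fst q) (snd q)))"
  by (rule continuous_on_compose2[OF assms]) (auto intro!: continuous_intros)

lemma bint_iter1:
  fixes f :: "complex \<Rightarrow> real"
  assumes "continuous_on UNIV f"
  shows "bint z r f = integral {Re z - r..Re z + r} (\<lambda>x. integral {Im z - r..Im z + r} (\<lambda>y. f (Complex x y)))"
  unfolding bint_def using integral_prod_continuous[OF cont_pair[OF assms]] by simp

lemma bint_iter2:
  fixes f :: "complex \<Rightarrow> real"
  assumes "continuous_on UNIV f"
  shows "bint z r f = integral {Im z - r..Im z + r} (\<lambda>y. integral {Re z - r..Re z + r} (\<lambda>x. f (Complex x y)))"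
  unfolding bint_iter1[OF assms]
  using integral_swap_continuous[of "Re z - r" "Im z - r" "Re z + r" "Im z + r" "\<lambda>x y. f (Complex x y)"] cont_pair[OF assms]
  by (simp add: case_prod_unfold)

lemma bint_integrable:
  fixes f :: "complex \<Rightarrow> real"
  assumes "continuous_on UNIV f"
  shows "(\<lambda>q::real\<times>real. f (Complex (fst q) (snd q))) integrable_on cbox a b"
  by (intro integrable_continuous cont_pair assms)

lemma bint_add:
  fixes f g :: "complex \<Rightarrow> real"
  assumes "continuous_on UNIV f" "continuous_on UNIV g"
  shows "bint z r (\<lambda>x. f x + g x) = bint z r f + bint z r g"
  unfolding bint_def by (intro integral_add bint_integrable assms)

lemma bint_cmult: "bint z r (\<lambda>x. c * f x) = c * bint z r f"
  unfolding bint_def by simp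

lemma bint_mono:
  fixes f g :: "complex \<Rightarrow> real"
  assumes "continuous_on UNIV f" "continuous_on UNIV g" "\<And>x. f x \<le> g x"
  shows "bint z r f \<le> bint z r g"
  unfolding bint_def by (intro integral_le bint_integrable assms)

lemma bint_const: "r \<ge> 0 \<Longrightarrow> bint z r (\<lambda>_. c) = 4 * r\<^sup>2 * c"
  unfolding bint_def by (simp add: content_Pair power2_eq_square)

lemma bint_nonneg:
  fixes f :: "complex \<Rightarrow> real"
  assumes "continuous_on UNIV f" "\<And>x. 0 \<le> f x"
  shows "0 \<le> bint z r f"
  unfolding bint_def by (intro integral_nonneg bint_integrable assms)

lemma bint_dx:
  assumes "C1_grad f g" "\<And>y. f (Complex (Re z - r) y) = 0" "\<And>y. f (Complex (Re z + r) y) = 0" "r \<ge> 0"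
  shows "bint z r (\<lambda>w. Re (g w)) = 0"
proof -
  have "integral {Re z - r..Re z + r} (\<lambda>x. Re (g (Complex x y))) = 0" for y
  proof -
    have "((\<lambda>x. Re (g (Complex x y))) has_integral f (Complex (Re z + r) y) - f (Complex (Re z - r) y)) {Re z - r..Re z + r}"
      by (rule fundamental_theorem_of_calculus)
        (use assms(4) C1_grad_fst[OF assms(1)] in \<open>auto simp: has_real_derivative_iff_has_vector_derivative[symmetric]\<close>)
    then show ?thesis using assms by (auto dest: integral_unique)
  qed
  then show ?thesis
    by (subst bint_iter2) (auto intro!: continuous_intros C1_gradD[OF assms(1)])
qed

lemma bint_dy:
  assumes "C1_grad f g" "\<And>x. f (Complex x (Im z - r)) = 0" "\<And>x. f (Complex x (Im z + r)) = 0" "r \<ge> 0"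
  shows "bint z r (\<lambda>w. Im (g w)) = 0"
proof -
  have "integral {Im z - r..Im z + r} (\<lambda>y. Im (g (Complex x y))) = 0" for x
  proof -
    have "((\<lambda>y. Im (g (Complex x y))) has_integral f (Complex x (Im z + r)) - f (Complex x (Im z - r))) {Im z - r..Im z + r}"
      by (rule fundamental_theorem_of_calculus)
        (use assms(4) C1_grad_snd[OF assms(1)] in \<open>auto simp: has_real_derivative_iff_has_vector_derivative[symmetric]\<close>)
    then show ?thesis using assms by (auto dest: integral_unique)
  qed
  then show ?thesis
    by (subst bint_iter1) (auto intro!: continuous_intros C1_gradD[OF assms(1)])
qed

definition closed_form :: "(complex \<Rightarrow> complex) \<Rightarrow> bool" where
  "closed_form G \<longleftrightarrow> (\<exists>A B. C1_grad (\<lambda>z. Re (G z)) A \<and> C1_grad (\<lambda>z. Im (G z)) B \<and> (\<forall>z. Im (A z) = Re (B z)))"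

definition obox :: "complex \<Rightarrow> real \<Rightarrow> complex set" where
  "obox z r = {y. \<bar>Re y - Re z\<bar> < r \<and> \<bar>Im y - Im z\<bar> < r}"

text \<open>Since \<open>G\<close> is closed, the integrand is the exterior derivative of \<open>\<psi> G\<close>, whose flux through
the boundary of the square vanishes. This is the only integration by parts used below; \<open>\<psi>\<close>
or \<open>G\<close> may carry the compact support.\<close>

lemma green:
  assumes \<psi>: "C1_grad \<psi> g" and G: "closed_form G" and supp: "\<And>y. y \<notin> obox z r \<Longrightarrow> \<psi> y = 0 \<or> G y = 0" and "r \<ge> 0"
  shows "bint z r (\<lambda>y. Im (cnj (g y) * G y)) = 0"
proof -
  obtain A B where A: "C1_grad (\<lambda>z. Re (G z)) A" and B: "C1_grad (\<lambda>z. Im (G z)) B" and cl: "\<And>z. Im (A z) = Re (B z)"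
    using G unfolding closed_form_def by blast
  note c = C1_gradD(1)[OF \<psi>] C1_gradD(1)[OF A] C1_gradD(1)[OF B] C1_gradD(3)[OF \<psi>] C1_gradD(3)[OF A] C1_gradD(3)[OF B]
  have s: "\<psi> (Complex a b) = 0 \<or> G (Complex a b) = 0" if "\<not> (\<bar>a - Re z\<bar> < r \<and> \<bar>b - Im z\<bar> < r)" for a b
    using supp[of "Complex a b"] that by (auto simp: obox_def)
  have 1: "bint z r (\<lambda>w. Re (\<psi> w *\<^sub>R B w + Im (G w) *\<^sub>R g w)) = 0"
    by (rule bint_dx[OF C1_grad_mult[OF \<psi> B]]) (use s[of "Re z - r"] s[of "Re z + r"] \<open>r\<ge>0\<close> in force)+
  have 2: "bint z r (\<lambda>w. Im (\<psi> w *\<^sub>R A w + Re (G w) *\<^sub>R g w)) = 0"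
    by (rule bint_dy[OF C1_grad_mult[OF \<psi> A]]) (use s[of _ "Im z - r"] s[of _ "Im z + r"] \<open>r\<ge>0\<close> in force)+
  have "bint z r (\<lambda>y. Im (cnj (g y) * G y)) = bint z r (\<lambda>y. Re (\<psi> y *\<^sub>R B y + Im (G y) *\<^sub>R g y) + (-1) * Im (\<psi> y *\<^sub>R A y + Re (G y) *\<^sub>R g y))"
    by (rule arg_cong[of _ _ "bint z r"], rule ext) (simp add: cl algebra_simps)
  also have "\<dots> = 0"
    by (subst bint_add, (intro continuous_intros c)+) (simp only: bint_cmult 1 2)
  finally show ?thesis .
qed

text \<open>Symmetry of second derivatives. The difference of \<open>f\<close> at two heights is an integral of
\<open>Im g\<close>; differentiating it under the integral sign in the other variable and then in the
upper limit gives both mixed derivatives.\<close>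

lemma closed_form_gradient:
  assumes f: "C1_grad f g" and A: "C1_grad (\<lambda>z. Re (g z)) A" and B: "C1_grad (\<lambda>z. Im (g z)) B"
  shows "Im (A z) = Re (B z)"
proof -
  (* Any height below that of \<open>z\<close> serves as the lower limit of integration. *)
  define c where "c = Im z - 1"
  note ct = C1_gradD(1)[OF f] C1_gradD(1)[OF A] C1_gradD(1)[OF B] C1_gradD(3)[OF f] C1_gradD(3)[OF A] C1_gradD(3)[OF B]
  have cont1: "continuous_on S (\<lambda>t. h (Complex x t))" if "continuous_on UNIV h" for h :: "complex \<Rightarrow> complex" and x S
    by (rule continuous_on_compose2[OF that]) (auto intro!: continuous_intros)
  have eq: "integral {c..y} (\<lambda>t. Re (B (Complex (Re z) t))) = Re (g (Complex (Re z) y)) - Re (g (Complex (Re z) c))"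
    if "y \<ge> c" for y
  proof -
    have F: "integral {c..y} (\<lambda>t. Im (g (Complex x t))) = f (Complex x y) - f (Complex x c)" for x
      by (intro integral_unique fundamental_theorem_of_calculus that)
        (use C1_grad_snd[OF f] in \<open>auto simp: has_real_derivative_iff_has_vector_derivative[symmetric]\<close>)
    have "((\<lambda>x. integral (cbox c y) (\<lambda>t. Im (g (Complex x t)))) has_field_derivative
        integral (cbox c y) (\<lambda>t. Re (B (Complex (Re z) t)))) (at (Re z) within UNIV)"
    proof (rule leibniz_rule_field_derivative)
      show "((\<lambda>x. Im (g (Complex x t))) has_real_derivative Re (B (Complex x t))) (at x within UNIV)" for x t
        by (rule C1_grad_fst[OF B])
      show "(\<lambda>t. Im (g (Complex x t))) integrable_on cbox c y" for x
        by (intro integrable_continuous continuous_intros cont1 ct)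
      show "continuous_on (UNIV \<times> cbox c y) (\<lambda>(x, t). Re (B (Complex x t)))"
        using cont_pair[OF ct(3)] by (auto simp: case_prod_unfold intro!: continuous_intros)
    qed auto
    moreover have "((\<lambda>x. integral (cbox c y) (\<lambda>t. Im (g (Complex x t)))) has_field_derivative
        (Re (g (Complex (Re z) y)) - Re (g (Complex (Re z) c)))) (at (Re z))"
      unfolding cbox_interval F by (intro derivative_intros C1_grad_fst[OF f])
    ultimately show ?thesis using DERIV_unique by (metis cbox_interval)
  qed
  have d1: "((\<lambda>y. integral {c..y} (\<lambda>t. Re (B (Complex (Re z) t)))) has_vector_derivative Re (B (Complex (Re z) (Im z)))) (at (Im z) within {c..Im z+1})"
    by (rule integral_has_vector_derivative) (auto simp: c_def intro!: continuous_intros cont1 ct)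
  have d1': "((\<lambda>y. integral {c..y} (\<lambda>t. Re (B (Complex (Re z) t)))) has_real_derivative Re (B z)) (at (Im z))"
    using d1 by (simp add: has_real_derivative_iff_has_vector_derivative at_within_Icc_at c_def)
  have "((\<lambda>y. Re (g (Complex (Re z) y)) - Re (g (Complex (Re z) c))) has_real_derivative Im (A (Complex (Re z) (Im z)))) (at (Im z))"
    by (rule DERIV_diff[OF C1_grad_snd[OF A] DERIV_const, simplified])
  then have "((\<lambda>y. integral {c..y} (\<lambda>t. Re (B (Complex (Re z) t)))) has_real_derivative Im (A z)) (at (Im z))"
    apply (simp)
    apply (erule DERIV_cong_ev[THEN iffD1, rotated 3])
    using eventually_gt_at_top[of c]
    apply (auto intro!: eventually_mono[OF eventually_nhds_in_open[of "{c<..}"]] simp: eq[unfolded c_def] c_def)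
    done
  then show ?thesis using d1' DERIV_unique by blast
qed

text \<open>The Poincare lemma: the potential is the integral of \<open>G\<close> along the segment from the origin,
and closedness turns its derivative into the integral of the \<open>t\<close>-derivative of \<open>t G(t z)\<close>.\<close>

lemma potential_exists:
  assumes "closed_form G"
  shows "\<exists>f. C1_grad f G"
proof -
  obtain A B where A: "C1_grad (\<lambda>z. Re (G z)) A" and B: "C1_grad (\<lambda>z. Im (G z)) B" and cl: "\<And>z. Im (A z) = Re (B z)"
    using assms unfolding closed_form_def by blast
  have cA: "continuous_on UNIV (\<lambda>z. Re (G z))" and cB: "continuous_on UNIV (\<lambda>z. Im (G z))"
    using C1_gradD(3)[OF A] C1_gradD(3)[OF B] by auto
  have cG: "continuous_on UNIV G"
    using Complex_cont[OF cA cB] by simp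
  note ct = cG C1_gradD(1)[OF A] C1_gradD(1)[OF B]
  have cc: "continuous_on S (\<lambda>q. h (q1 q * q2 q))" if "continuous_on UNIV h" "continuous_on S q1" "continuous_on S q2"
    for h :: "complex \<Rightarrow> complex" and S :: "'a::topological_space set" and q1 q2
    by (rule continuous_on_compose2[OF that(1)]) (auto intro!: continuous_intros that)
  define K where "K z t = G (of_real t * z) + t *\<^sub>R (Re z *\<^sub>R A (of_real t * z) + Im z *\<^sub>R B (of_real t * z))" for z and t::real
  define f where "f z = integral (cbox 0 1) (\<lambda>t. G (of_real t * z) \<bullet> z)" for z
  have Kc: "continuous_on S (\<lambda>(x,t). K x t)" for S
    unfolding K_def case_prod_unfold by (intro continuous_intros cc ct)
  have der: "(f has_derivative blinfun_apply (integral (cbox 0 1) (\<lambda>t. blinfun_inner_left (K z t)))) (at z within UNIV)" for z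
    unfolding f_def
  proof (rule leibniz_rule)
    fix x t
    have GR: "((\<lambda>x. Re (G (of_real t * x))) has_derivative (\<lambda>h. A (of_real t * x) \<bullet> (of_real t * h))) (at x)"
      by (rule has_derivative_compose[of "\<lambda>x. of_real t * x" _ _ _ "\<lambda>z. Re (G z)", OF _ C1_gradD(2)[OF A]])
        (auto intro!: derivative_eq_intros)
    have GI: "((\<lambda>x. Im (G (of_real t * x))) has_derivative (\<lambda>h. B (of_real t * x) \<bullet> (of_real t * h))) (at x)"
      by (rule has_derivative_compose[of "\<lambda>x. of_real t * x" _ _ _ "\<lambda>z. Im (G z)", OF _ C1_gradD(2)[OF B]])
        (auto intro!: derivative_eq_intros)
    show "((\<lambda>x. G (of_real t * x) \<bullet> x) has_derivative blinfun_apply (blinfun_inner_left (K x t))) (at x within UNIV)"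
      unfolding inner_complex_def
      by (rule has_derivative_eq_rhs, (rule derivative_intros GR GI has_derivative_ident)+)
        (auto simp: K_def inner_complex_def algebra_simps)
  next
    fix x :: complex
    show "(\<lambda>t. G (of_real t * x) \<bullet> x) integrable_on cbox 0 1"
      by (intro integrable_continuous continuous_intros cc ct)
  next
    show "continuous_on (UNIV \<times> cbox 0 1) (\<lambda>(x, t). blinfun_inner_left (K x t))"
      unfolding case_prod_unfold by (rule bounded_linear.continuous_on[OF bounded_linear_blinfun_inner_left])
        (use Kc in \<open>auto simp: case_prod_unfold\<close>)
  qed auto
  have K: "integral {0..1} (K z) = G z" for z
  proof -
    have "(K z has_integral (1 *\<^sub>R G (of_real 1 * z) - 0 *\<^sub>R G (of_real 0 * z))) {0..1}"
    proof (rule fundamental_theorem_of_calculus)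
      fix t :: real assume "t \<in> {0..1}"
      have m: "((\<lambda>t. of_real t * z) has_vector_derivative z) (at t within {0..1})"
        by (auto intro!: derivative_eq_intros simp: has_vector_derivative_def scaleR_conv_of_real)
      have "((\<lambda>t. Re (G (of_real t * z))) has_real_derivative A (of_real t * z) \<bullet> z) (at t within {0..1})"
        by (rule C1_grad_along[OF A m])
      moreover have "((\<lambda>t. Im (G (of_real t * z))) has_real_derivative B (of_real t * z) \<bullet> z) (at t within {0..1})"
        by (rule C1_grad_along[OF B m])
      ultimately have "((\<lambda>t. of_real (Re (G (of_real t * z))) + \<i> * of_real (Im (G (of_real t * z)))) has_vector_derivative
          (of_real (A (of_real t * z) \<bullet> z) + \<i> * of_real (B (of_real t * z) \<bullet> z))) (at t within {0..1})"
        by (intro has_vector_derivative_add has_vector_derivative_mult_right has_vector_derivative_of_real)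
      then have "((\<lambda>t. G (of_real t * z)) has_vector_derivative Complex (A (of_real t * z) \<bullet> z) (B (of_real t * z) \<bullet> z)) (at t within {0..1})"
        by (simp add: complex_eq[symmetric] Complex_eq)
      then have "((\<lambda>t. t *\<^sub>R G (of_real t * z)) has_vector_derivative t *\<^sub>R Complex (A (of_real t * z) \<bullet> z) (B (of_real t * z) \<bullet> z)
         + 1 *\<^sub>R G (of_real t * z)) (at t within {0..1})"
        by (intro has_vector_derivative_scaleR) (auto intro!: derivative_eq_intros)
      moreover have "t *\<^sub>R Complex (A (of_real t * z) \<bullet> z) (B (of_real t * z) \<bullet> z) + 1 *\<^sub>R G (of_real t * z) = K z t"
        by (simp add: K_def complex_eq_iff inner_complex_def cl algebra_simps)
      ultimately show "((\<lambda>t. t *\<^sub>R G (of_real t * z)) has_vector_derivative K z t) (at t within {0..1})" by simp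
    qed auto
    then show ?thesis by (auto dest: integral_unique)
  qed
  have "C1_grad f G"
    unfolding C1_grad_def
  proof (intro conjI allI cG)
    fix z
    have Ki: "K z integrable_on cbox 0 1"
      by (rule integrable_continuous) (auto simp: K_def intro!: continuous_intros cc ct)
    have "blinfun_apply (integral (cbox 0 1) (\<lambda>t. blinfun_inner_left (K z t))) = (\<lambda>h. G z \<bullet> h)"
      using integral_linear[OF Ki bounded_linear_blinfun_inner_left] K[of z]
      by (simp add: o_def fun_eq_iff inner_commute)
    then show "(f has_derivative (\<lambda>h. G z \<bullet> h)) (at z)" using der[of z] by simp
  qed
  then show ?thesis by blast
qed

section \<open>Weak solutions and the maximum principle\<close>

text \<open>Continuous differentiability is local; this is used to glue truncated functions.\<close>

lemma C1_grad_local: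
  assumes "\<And>z. \<exists>U F G. open U \<and> z \<in> U \<and> C1_grad F G \<and> (\<forall>y\<in>U. f y = F y \<and> g y = G y)"
  shows "C1_grad f g"
  unfolding C1_grad_def
proof (intro conjI allI)
  show "continuous_on UNIV g"
  proof (intro continuous_at_imp_continuous_on ballI)
    fix z
    obtain U F G where U: "open U" "z \<in> U" "C1_grad F G" "\<forall>y\<in>U. f y = F y \<and> g y = G y" using assms by blast
    have "continuous_on U g"
      by (rule continuous_on_eq[OF continuous_on_subset[OF C1_gradD(1)[OF U(3)]], of U]) (use U(4) in auto)
    then show "isCont g z" using U(1,2) by (simp add: continuous_on_eq_continuous_at)
  qed
  fix z
  obtain U F G where U: "open U" "z \<in> U" "C1_grad F G" "\<forall>y\<in>U. f y = F y \<and> g y = G y" using assms by blast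
  have "(F has_derivative (\<lambda>h. g z \<bullet> h)) (at z)" using C1_gradD(2)[OF U(3), of z] U by simp
  then show "(f has_derivative (\<lambda>h. g z \<bullet> h)) (at z)"
    by (rule has_derivative_transform_within_open[OF _ U(1,2)]) (use U(4) in auto)
qed

definition cbx :: "complex \<Rightarrow> real \<Rightarrow> complex set" where
  "cbx z r = {y. \<bar>Re y - Re z\<bar> \<le> r \<and> \<bar>Im y - Im z\<bar> \<le> r}"

lemma cbx_eq: "cbx z r = cbox (z - Complex r r) (z + Complex r r)"
  by (auto simp: cbx_def in_cbox_complex_iff)

lemma compact_cbx: "compact (cbx z r)" and closed_cbx: "closed (cbx z r)"
  by (auto simp: cbx_eq closed_cbox)

lemma open_obox: "open (obox z r)"
  unfolding obox_def by (intro open_Collect_conj open_Collect_less continuous_intros)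

lemma obox_subset_cbx: "obox z r \<subseteq> cbx z r" by (auto simp: obox_def cbx_def)

lemma cbx_mono: "r \<le> s \<Longrightarrow> cbx z r \<subseteq> cbx z s" by (auto simp: cbx_def)

lemma bint_mono_cbx:
  fixes f g :: "complex \<Rightarrow> real"
  assumes "continuous_on UNIV f" "continuous_on UNIV g" "\<And>x. x \<in> cbx z r \<Longrightarrow> f x \<le> g x"
  shows "bint z r f \<le> bint z r g"
  unfolding bint_def using assms(3)
  by (intro integral_le bint_integrable assms) (auto simp: cbx_def abs_le_iff algebra_simps)

lemma bint_subset:
  fixes f :: "complex \<Rightarrow> real"
  assumes "continuous_on UNIV f" "\<And>x. 0 \<le> f x" "r \<le> s"
  shows "bint z r f \<le> bint z s f"
  unfolding bint_def using assms(3)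
  by (intro integral_subset_le bint_integrable assms) (auto simp: assms(2))

lemma bint_eq_0D:
  fixes f :: "complex \<Rightarrow> real"
  assumes "continuous_on UNIV f" "\<And>x. 0 \<le> f x" "bint z r f = 0" "x \<in> cbx z r" "r > 0"
  shows "f x = 0"
proof -
  let ?B = "cbox (Re z - r, Im z - r) (Re z + r, Im z + r)"
  have "((\<lambda>q. f (Complex (fst q) (snd q))) has_integral 0) ?B"
    using assms(3) bint_integrable[OF assms(1)] unfolding bint_def by (metis integrable_integral)
  moreover have "box (Re z - r, Im z - r) (Re z + r, Im z + r) \<noteq> {}"
    using \<open>r > 0\<close> by (simp add: box_ne_empty Basis_prod_def)
  moreover have "(Re x, Im x) \<in> ?B" using assms(4) by (auto simp: cbx_def abs_le_iff)
  ultimately have "f (Complex (fst (Re x, Im x)) (snd (Re x, Im x))) = 0"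
    by (rule has_integral_0_cbox_imp_0[OF cont_pair[OF assms(1)] assms(2)])
  then show ?thesis by simp
qed

lemma pos_power_deriv:
  "((\<lambda>t::real. (max 0 t) ^ (Suc (Suc n))) has_real_derivative (real (n+2) * (max 0 t) ^ (Suc n))) (at t)"
proof -
  consider "t > 0" | "t < 0" | "t = 0" by linarith
  then show ?thesis
  proof cases
    case 1
    have "((\<lambda>t::real. t ^ (Suc (Suc n))) has_real_derivative (real (n+2) * t ^ (Suc n))) (at t)"
      using DERIV_pow[of "Suc (Suc n)" t] by simp
    then have "((\<lambda>t::real. (max 0 t) ^ (Suc (Suc n))) has_real_derivative (real (n+2) * t ^ (Suc n))) (at t)"
      by (rule has_field_derivative_transform_within_open[where S="{0<..}"]) (use 1 in auto)
    then show ?thesis using 1 by simp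
  next
    case 2
    have "((\<lambda>t::real. 0) has_real_derivative 0) (at t)" by simp
    then have "((\<lambda>t::real. (max 0 t) ^ (Suc (Suc n))) has_real_derivative 0) (at t)"
      by (rule has_field_derivative_transform_within_open[where S="{..<0}"]) (use 2 in auto)
    then show ?thesis using 2 by simp
  next
    case 3
    have "((\<lambda>h::real. (max 0 h) ^ Suc n * (max 0 h / h)) \<longlongrightarrow> 0) (at 0)"
    proof (rule Lim_null_comparison)
      show "\<forall>\<^sub>F h in at 0. norm ((max 0 h) ^ Suc n * (max 0 h / h)) \<le> (max 0 h) ^ Suc n" for h :: real
        by (intro always_eventually allI) (auto simp: max_def)
      have "((\<lambda>h::real. (max 0 h) ^ Suc n) \<longlongrightarrow> (max 0 0) ^ Suc n) (at 0)"
        by (intro tendsto_intros)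
      then show "((\<lambda>h::real. (max 0 h) ^ Suc n) \<longlongrightarrow> 0) (at 0)" by simp
    qed
    then show ?thesis using 3 by (simp add: DERIV_def mult_ac)
  qed
qed

text \<open>The weak form of \<open>div (w grad f) = 0\<close>, tested against continuously differentiable functions
supported in a square.\<close>

definition weak_sol :: "(complex \<Rightarrow> real) \<Rightarrow> (complex \<Rightarrow> real) \<Rightarrow> (complex \<Rightarrow> complex) \<Rightarrow> bool" where
  "weak_sol w f g \<longleftrightarrow> continuous_on UNIV w \<and> C1_grad f g \<and>
     (\<forall>z r q gq. r > 0 \<longrightarrow> C1_grad q gq \<longrightarrow> (\<forall>y. y \<notin> obox z r \<longrightarrow> q y = 0)
        \<longrightarrow> bint z r (\<lambda>y. w y * (gq y \<bullet> g y)) = 0)"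

lemma weak_sol_uminus:
  assumes "weak_sol w f g" shows "weak_sol w (\<lambda>y. - f y) (\<lambda>y. - g y)"
proof -
  have "C1_grad (\<lambda>y. - f y) (\<lambda>y. - g y)"
    using C1_grad_cmult[of f g "-1"] assms by (simp add: weak_sol_def)
  moreover have "bint z r (\<lambda>y. w y * (gq y \<bullet> - g y)) = - bint z r (\<lambda>y. w y * (gq y \<bullet> g y))" for z r gq
    using bint_cmult[of z r "-1"] by simp
  ultimately show ?thesis using assms by (simp add: weak_sol_def)
qed

text \<open>The squared positive part of \<open>f - k\<close> inside the square, extended by zero, is an admissible
test function, because \<open>f < k\<close> near the boundary. Testing with it shows that its gradient
vanishes.\<close>

lemma weak_max:
  assumes ws: "weak_sol w f g" and w: "\<And>y. w y > 0" and r: "r > 0"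
    and bd: "\<And>y. y \<in> cbx z r - obox z r \<Longrightarrow> f y < k" and y: "y \<in> obox z r"
  shows "f y \<le> k"
proof -
  have f: "C1_grad f g" and cw: "continuous_on UNIV w" using ws by (auto simp: weak_sol_def)
  define F where "F y = (max 0 (f y - k))^2" for y
  define G where "G y = (2 * max 0 (f y - k)) *\<^sub>R g y" for y
  have FG: "C1_grad F G"
    unfolding F_def G_def
    by (rule C1_grad_chain[OF C1_grad_diff_const[OF f], of "\<lambda>t. (max 0 t)^2" "\<lambda>t. 2 * max 0 t"])
      (use pos_power_deriv[of 0] in \<open>auto simp: power2_eq_square intro!: continuous_intros\<close>)
  define q where "q y = (if y \<in> obox z r then F y else 0)" for y
  define gq where "gq y = (if y \<in> obox z r then G y else 0)" for y
  have q: "C1_grad q gq"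
  proof (rule C1_grad_local)
    fix y
    define K where "K = {y \<in> cbx z r. k \<le> f y}"
    have "closed K" unfolding K_def
      using closed_cbx by (intro closed_Collect_conj closed_Collect_le continuous_intros C1_gradD(3)[OF f])  (auto simp: cbx_eq)
    then have oK: "open (- K)" by (simp add: open_Compl)
    show "\<exists>U F G. open U \<and> y \<in> U \<and> C1_grad F G \<and> (\<forall>y\<in>U. q y = F y \<and> gq y = G y)"
    proof (cases "y \<in> obox z r")
      case True
      then show ?thesis using open_obox FG by (intro exI[of _ "obox z r"] exI[of _ F] exI[of _ G]) (auto simp: q_def gq_def)
    next
      case False
      have "y \<in> -K" using False bd[of y] by (auto simp: K_def)
      moreover have "q u = 0 \<and> gq u = 0" if "u \<in> -K" for u
        using that obox_subset_cbx[of z r] by (auto simp: q_def gq_def K_def F_def G_def max_def)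
      ultimately show ?thesis using oK C1_grad_const[of 0]
        by (intro exI[of _ "-K"] exI[of _ "\<lambda>_. 0"]) auto
    qed
  qed
  have "bint z r (\<lambda>y. w y * (gq y \<bullet> g y)) = 0"
    using ws r q unfolding weak_sol_def by (auto simp: q_def)
  moreover have nn: "0 \<le> w y * (gq y \<bullet> g y)" for y
    using w[of y] by (auto simp: gq_def G_def intro!: mult_nonneg_nonneg)
  moreover have "continuous_on UNIV (\<lambda>y. w y * (gq y \<bullet> g y))"
    by (intro continuous_intros cw C1_gradD(1)[OF q] C1_gradD(1)[OF f])
  ultimately have z0: "w y * (gq y \<bullet> g y) = 0" if "y \<in> cbx z r" for y
    using bint_eq_0D[of _ z r y] that r by blast
  have gq0: "gq y = 0" for y
  proof (cases "y \<in> obox z r")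
    case True
    then have "gq y \<bullet> g y = 0" using z0[of y] w[of y] obox_subset_cbx[of z r] by auto
    then show ?thesis using True by (auto simp: gq_def G_def)
  qed (simp add: gq_def)
  have "\<exists>c. \<forall>y\<in>UNIV. q y = c"
    by (rule has_derivative_zero_constant) (use C1_gradD(2)[OF q] gq0 in auto)
  then obtain c where c: "\<And>y. q y = c" by auto
  have "q (z + Complex r 0) = 0" by (auto simp: q_def obox_def)
  then have "q y = 0" using c by metis
  then show ?thesis using y by (auto simp: q_def F_def max_def split: if_splits)
qed

lemma weak_osc:
  assumes ws: "weak_sol w f g" and w: "\<And>y. w y > 0" and r: "r > 0"
    and bd: "\<And>y u. y \<in> cbx z r - obox z r \<Longrightarrow> u \<in> cbx z r - obox z r \<Longrightarrow> \<bar>f y - f u\<bar> \<le> d"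
    and y: "y \<in> cbx z r" and u: "u \<in> cbx z r"
  shows "\<bar>f y - f u\<bar> \<le> d"
proof -
  let ?B = "cbx z r - obox z r"
  have f: "C1_grad f g" using ws by (auto simp: weak_sol_def)
  have comp: "compact ?B" using compact_cbx open_obox by (rule compact_diff)
  have "z + Complex r 0 \<in> ?B" using r by (simp add: cbx_def obox_def)
  then have ne: "?B \<noteq> {}" by blast
  have cf: "continuous_on ?B f" using C1_gradD(3)[OF f] continuous_on_subset by blast
  obtain b where b: "b \<in> ?B" "\<And>v. v \<in> ?B \<Longrightarrow> f v \<le> f b"
    using continuous_attains_sup[OF comp ne cf] by blast
  obtain a where a: "a \<in> ?B" "\<And>v. v \<in> ?B \<Longrightarrow> f a \<le> f v"
    using continuous_attains_inf[OF comp ne cf] by blast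
  have up: "f v \<le> f b" if "v \<in> cbx z r" for v
  proof (cases "v \<in> obox z r")
    case True
    show ?thesis
    proof (rule field_le_epsilon)
      fix e :: real assume "e > 0"
      then show "f v \<le> f b + e"
        by (intro weak_max[OF ws w r _ True]) (use b in force)+
    qed
  qed (use that b in auto)
  have lo: "f a \<le> f v" if "v \<in> cbx z r" for v
  proof (cases "v \<in> obox z r")
    case True
    have "- f v \<le> - f a"
    proof (rule field_le_epsilon)
      fix e :: real assume "e > 0"
      then show "- f v \<le> - f a + e"
        by (intro weak_max[OF weak_sol_uminus[OF ws] w r _ True]) (use a in force)+
    qed
    then show ?thesis by simp
  qed (use that a in auto)
  have "f b - f a \<le> d" using bd[OF b(1) a(1)] by simp
  then show ?thesis using up[OF y] up[OF u] lo[OF y] lo[OF u] by linarith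
qed

lemma C1_grad_prod:
  assumes "\<And>t. (a has_real_derivative a' t) (at t)" "continuous_on UNIV a'"
    "\<And>t. (b has_real_derivative b' t) (at t)" "continuous_on UNIV b'"
  shows "C1_grad (\<lambda>z. a (Re z) * b (Im z)) (\<lambda>z. Complex (a' (Re z) * b (Im z)) (a (Re z) * b' (Im z)))"
proof -
  have R: "C1_grad Re (\<lambda>_. 1)" and I: "C1_grad Im (\<lambda>_. \<i>)"
    by (auto simp: C1_grad_def inner_complex_def bounded_linear_imp_has_derivative bounded_linear_Re bounded_linear_Im)
  show ?thesis
    by (rule C1_grad_cong[OF C1_grad_mult[OF C1_grad_chain[OF R assms(1,2)] C1_grad_chain[OF I assms(3,4)]]])
      (auto simp: complex_eq_iff)
qed

text \<open>Cutoff functions are products of powers of the positive part of \<open>1 - t^2\<close>. They have no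
plateau, but on the half square they are at least \<open>(9/16)^n\<close>, and the fourth power is the
square of the second one, which is what absorbing arguments need.\<close>

definition bump :: "nat \<Rightarrow> real \<Rightarrow> real" where
  "bump n t = (max 0 (1 - t\<^sup>2)) ^ n"

lemma bump_deriv: "(bump (Suc (Suc n)) has_real_derivative (- 2 * real (n+2) * t * bump (Suc n) t)) (at t)"
proof -
  have "((\<lambda>t. 1 - t\<^sup>2) has_real_derivative (- 2 * t)) (at t)"
    by (auto intro!: derivative_eq_intros)
  from DERIV_chain2[OF pos_power_deriv this, of n]
  show ?thesis unfolding bump_def by (rule DERIV_cong) (simp add: algebra_simps)
qed

lemma bump_cont [continuous_intros]: "continuous_on S f \<Longrightarrow> continuous_on S (\<lambda>x. bump n (f x))"
  unfolding bump_def by (intro continuous_intros)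

lemma bump_nonneg: "bump n t \<ge> 0" and bump_le_1: "bump n t \<le> 1"
  by (auto simp: bump_def intro!: power_le_one)

lemma bump_zero:
  assumes "\<bar>t\<bar> \<ge> 1" "n > 0" shows "bump n t = 0"
proof -
  have "1 \<le> t\<^sup>2" using assms(1) abs_le_square_iff[of 1 t] by simp
  then show ?thesis using assms(2) by (simp add: bump_def max_def)
qed

lemma bump_half: "\<bar>t\<bar> \<le> 1/2 \<Longrightarrow> bump n t \<ge> (3/4)^n"
  unfolding bump_def
  by (intro power_mono) (auto simp: max_def abs_le_square_iff[of t "1/2", simplified] power2_eq_square)

lemma bump_deriv_bound: "\<bar>t * bump (Suc n) t\<bar> \<le> 1"
proof (cases "\<bar>t\<bar> \<ge> 1")
  case False
  then have "\<bar>t\<bar> * bump (Suc n) t \<le> 1 * 1" by (intro mult_mono) (auto simp: bump_nonneg bump_le_1)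
  then show ?thesis by (simp add: abs_mult bump_nonneg)
qed (simp add: bump_zero)

definition cutf :: "nat \<Rightarrow> complex \<Rightarrow> real \<Rightarrow> complex \<Rightarrow> real" where
  "cutf n z r y = bump n ((Re y - Re z) / r) * bump n ((Im y - Im z) / r)"

text \<open>The gradient of \<open>cutf\<close>.\<close>

definition cutg :: "nat \<Rightarrow> complex \<Rightarrow> real \<Rightarrow> complex \<Rightarrow> complex" where
  "cutg n z r y = (let s = (Re y - Re z) / r; t = (Im y - Im z) / r in
     (- 2 * real n / r) *\<^sub>R Complex (s * bump (n - 1) s * bump n t) (t * bump (n - 1) t * bump n s))"

lemma bump_scaled_deriv:
  assumes "r \<noteq> 0"
  shows "((\<lambda>t. bump (Suc (Suc n)) ((t - c) / r)) has_real_derivative (- 2 * real (n+2) / r * ((t - c) / r * bump (Suc n) ((t-c)/r)))) (at t)"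
proof -
  have "((\<lambda>t. (t - c) / r) has_real_derivative 1 / r) (at t)"
    using assms by (auto intro!: derivative_eq_intros)
  from DERIV_chain2[OF bump_deriv this, of n]
  have "((\<lambda>t. bump (Suc (Suc n)) ((t - c) / r)) has_real_derivative
     - 2 * real (n + 2) * ((t - c) / r) * bump (Suc n) ((t - c) / r) * (1 / r)) (at t)" .
  moreover have "- 2 * real (n+2) * s * b * (1 / r) = - 2 * real (n+2) / r * (s * b)" for s b by simp
  ultimately show ?thesis by (metis (no_types))
qed

lemma cutf_C1:
  assumes "r > 0" shows "C1_grad (cutf (Suc (Suc n)) z r) (cutg (Suc (Suc n)) z r)"
proof -
  have r: "r \<noteq> 0" using assms by simp
  have c: "continuous_on UNIV (\<lambda>t. - 2 * real (n+2) / r * ((t - c) / r * bump (Suc n) ((t-c)/r)))" for c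
    using r by (intro continuous_intros) auto
  show ?thesis unfolding cutf_def
    by (rule C1_grad_cong[OF C1_grad_prod[OF bump_scaled_deriv[OF r, where n=n and c="Re z"] c
        bump_scaled_deriv[OF r, where n=n and c="Im z"] c]])
      (auto simp: cutg_def Let_def cutf_def complex_eq_iff mult_ac)
qed

lemma cutf_zero: "y \<notin> obox z r \<Longrightarrow> r > 0 \<Longrightarrow> n > 0 \<Longrightarrow> cutf n z r y = 0"
  by (auto simp: cutf_def obox_def bump_zero not_less)

lemma cutg_zero: "y \<notin> obox z r \<Longrightarrow> r > 0 \<Longrightarrow> n > 1 \<Longrightarrow> cutg n z r y = 0"
  by (auto simp: cutg_def obox_def bump_zero not_less Let_def complex_eq_iff)

lemma cutf_nonneg: "cutf n z r y \<ge> 0" by (simp add: cutf_def bump_nonneg)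

lemma cutf_half: "y \<in> cbx z (r/2) \<Longrightarrow> r > 0 \<Longrightarrow> cutf n z r y \<ge> (9/16)^n"
proof -
  assume a: "y \<in> cbx z (r/2)" "r > 0"
  have "(3/4)^n * (3/4)^n \<le> cutf n z r y"
    unfolding cutf_def using a
    by (intro mult_mono bump_half) (auto simp: cbx_def bump_nonneg field_simps)
  then show ?thesis by (simp add: power_mult_distrib[symmetric])
qed

lemma cutg_bound:
  assumes r: "r > 0"
  shows "cmod (cutg (Suc (Suc n)) z r y) \<le> 4 * real (n + 2) / r"
proof -
  have b: "\<bar>s * bump (Suc n) s * bump (Suc (Suc n)) t\<bar> \<le> 1" for s t
  proof -
    have "\<bar>s * bump (Suc n) s\<bar> * \<bar>bump (Suc (Suc n)) t\<bar> \<le> 1 * 1"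
      using bump_deriv_bound[of s n] by (intro mult_mono) (auto simp: bump_nonneg bump_le_1)
    then show ?thesis by (simp add: abs_mult)
  qed
  define s where "s = (Re y - Re z) / r"
  define t where "t = (Im y - Im z) / r"
  define C where "C = Complex (s * bump (Suc n) s * bump (Suc (Suc n)) t) (t * bump (Suc n) t * bump (Suc (Suc n)) s)"
  have "cmod C \<le> 2"
    using b[of s t] b[of t s] unfolding C_def
    by (intro order.trans[OF cmod_le]) auto
  then have "(2 * real (n+2) / r) * cmod C \<le> (2 * real (n+2) / r) * 2"
    using r by (intro mult_left_mono) auto
  moreover have "cutg (Suc (Suc n)) z r y = (- 2 * real (Suc (Suc n)) / r) *\<^sub>R C"
    by (simp add: cutg_def Let_def s_def t_def C_def)
  then have "cmod (cutg (Suc (Suc n)) z r y) = (2 * real (n+2) / r) * cmod C"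
    using r abs_divide[of "- 2 * real (Suc (Suc n))" r] abs_of_nonneg[of "4 + 2 * real n"] abs_minus_cancel[of "4 + 2 * real n"]
    by (simp only: norm_scaleR) simp
  ultimately show ?thesis by simp
qed

section \<open>Energy estimates for weak solutions\<close>

abbreviation energy :: "(complex \<Rightarrow> complex) \<Rightarrow> complex \<Rightarrow> real \<Rightarrow> real" where
  "energy g z r \<equiv> bint z r (\<lambda>y. (cmod (g y))\<^sup>2)"

lemma sq_norm_cont: "continuous_on UNIV g \<Longrightarrow> continuous_on S (\<lambda>y::complex. (cmod (g y :: complex))\<^sup>2)"
  by (intro continuous_intros) (auto intro: continuous_on_subset)

text \<open>Test the equation with \<open>(f - c)\<close> times the square of a cutoff and absorb the mixed term by
Young's inequality.\<close>

lemma caccioppoli: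
  assumes ws: "weak_sol w f g" and w0: "w0 > 0" and w: "\<And>y. w0 \<le> w y" "\<And>y. w y \<le> w1" and r: "r > 0"
    and K: "\<And>y. y \<in> cbx z r \<Longrightarrow> \<bar>f y - c\<bar> \<le> K"
  shows "energy g z (r/2) \<le> 10 ^ 5 * (w1 / w0) * K\<^sup>2"
proof -
  have f: "C1_grad f g" and cw: "continuous_on UNIV w" using ws by (auto simp: weak_sol_def)
  note cf = C1_gradD(3)[OF f] and cg = C1_gradD(1)[OF f]
  have w1: "w1 > 0" using w(1)[of 0] w(2)[of 0] w0 by linarith
  define e where "e = cutf 2 z r"
  define ge where "ge = cutg 2 z r"
  have e: "C1_grad e ge" using cutf_C1[OF r, of 0 z] by (simp add: e_def ge_def numeral_2_eq_2)
  note ce = C1_gradD(3)[OF e] and cge = C1_gradD(1)[OF e]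
  have geb: "cmod (ge y) \<le> 8 / r" for y
    using cutg_bound[OF r, of 0 z y] by (simp add: ge_def numeral_2_eq_2)
  define q where "q y = (e y * e y) * (f y - c)" for y
  define gq where "gq y = (e y * e y) *\<^sub>R g y + (f y - c) *\<^sub>R (e y *\<^sub>R ge y + e y *\<^sub>R ge y)" for y
  have q: "C1_grad q gq" unfolding q_def gq_def
    by (rule C1_grad_mult[OF C1_grad_mult[OF e e] C1_grad_diff_const[OF f]])
  have "q y = 0" if "y \<notin> obox z r" for y
    using cutf_zero[OF that r, of 2] by (simp add: q_def e_def)
  then have 0: "bint z r (\<lambda>y. w y * (gq y \<bullet> g y)) = 0"
    using ws r q unfolding weak_sol_def by blast
  have cgq: "continuous_on UNIV gq" by (rule C1_gradD(1)[OF q])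
  have pt: "(e y)\<^sup>2 * w0 * (cmod (g y))\<^sup>2 \<le> 2 * (w y * (gq y \<bullet> g y)) + 4 * w1 * (8/r)\<^sup>2 * K\<^sup>2"
    if y: "y \<in> cbx z r" for y
  proof -
    define G where "G = cmod (g y)"
    have gg: "g y \<bullet> g y = G\<^sup>2" by (simp add: G_def power2_norm_eq_inner)
    have cs: "\<bar>ge y \<bullet> g y\<bar> \<le> (8/r) * G"
    proof -
      have "\<bar>ge y \<bullet> g y\<bar> \<le> cmod (ge y) * cmod (g y)" by (rule Cauchy_Schwarz_ineq2)
      also have "\<dots> \<le> (8/r) * G" unfolding G_def by (intro mult_right_mono geb) auto
      finally show ?thesis .
    qed
    have eq: "gq y \<bullet> g y = (e y)\<^sup>2 * G\<^sup>2 + 2 * (e y * (f y - c) * (ge y \<bullet> g y))"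
    proof -
      have "(f y - c) *\<^sub>R (e y *\<^sub>R ge y + e y *\<^sub>R ge y) \<bullet> g y = 2 * (e y * (f y - c) * (ge y \<bullet> g y))"
        by (simp only: inner_add_left inner_scaleR_left) algebra
      then show ?thesis by (simp only: gq_def inner_add_left inner_scaleR_left gg power2_eq_square)
    qed
    have en: "e y \<ge> 0" by (simp add: e_def cutf_nonneg)
    have "\<bar>e y * (f y - c) * (ge y \<bullet> g y)\<bar> \<le> e y * K * ((8/r) * G)"
      unfolding abs_mult using K[OF y] cs en by (intro mult_mono) auto
    also have "\<dots> \<le> (e y)\<^sup>2 * G\<^sup>2 / 4 + ((8/r) * K)\<^sup>2"
      using zero_le_power2[of "e y * G / 2 - (8/r) * K"] by (simp add: power2_eq_square algebra_simps)
    finally have "gq y \<bullet> g y \<ge> (e y)\<^sup>2 * G\<^sup>2 / 2 - 2 * ((8/r) * K)\<^sup>2"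
      unfolding eq by linarith
    then have "w y * ((e y)\<^sup>2 * G\<^sup>2 / 2 - 2 * ((8/r) * K)\<^sup>2) \<le> w y * (gq y \<bullet> g y)"
      using w(1)[of y] w0 by (intro mult_left_mono) auto
    then have "w y * ((e y)\<^sup>2 * G\<^sup>2) \<le> 2 * (w y * (gq y \<bullet> g y)) + 4 * (w y * ((8/r) * K)\<^sup>2)"
      by (simp only: right_diff_distrib)
    moreover have "w y * ((8/r) * K)\<^sup>2 \<le> w1 * ((8/r) * K)\<^sup>2"
      by (intro mult_right_mono w) auto
    moreover have "w0 * ((e y)\<^sup>2 * G\<^sup>2) \<le> w y * ((e y)\<^sup>2 * G\<^sup>2)"
      by (intro mult_right_mono w) auto
    ultimately have "w0 * ((e y)\<^sup>2 * G\<^sup>2) \<le> 2 * (w y * (gq y \<bullet> g y)) + 4 * (w1 * ((8/r) * K)\<^sup>2)"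
      by linarith
    then show ?thesis by (simp only: G_def power_mult_distrib mult_ac)
  qed
  have "(9/16)^4 * w0 * energy g z (r/2) = bint z (r/2) (\<lambda>y. ((9/16)^4 * w0) * (cmod (g y))\<^sup>2)"
    by (simp only: bint_cmult)
  also have "\<dots> \<le> bint z (r/2) (\<lambda>y. (e y)\<^sup>2 * w0 * (cmod (g y))\<^sup>2)"
  proof (rule bint_mono_cbx)
    fix y assume "y \<in> cbx z (r/2)"
    then have "((9/16)^2)^2 \<le> (e y)\<^sup>2" unfolding e_def by (intro power_mono cutf_half r) auto
    then show "(9/16)^4 * w0 * (cmod (g y))\<^sup>2 \<le> (e y)\<^sup>2 * w0 * (cmod (g y))\<^sup>2"
      using w0 by (intro mult_right_mono) auto
  qed (intro continuous_intros sq_norm_cont cg ce)+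
  also have "\<dots> \<le> bint z r (\<lambda>y. (e y)\<^sup>2 * w0 * (cmod (g y))\<^sup>2)"
    using w0 r by (intro bint_subset continuous_intros sq_norm_cont cg ce) auto
  also have "\<dots> \<le> bint z r (\<lambda>y. 2 * (w y * (gq y \<bullet> g y)) + 4 * w1 * (8/r)\<^sup>2 * K\<^sup>2)"
    using pt by (intro bint_mono_cbx continuous_intros sq_norm_cont cg ce cw cgq) auto
  also have "\<dots> = 2 * 0 + 4 * r\<^sup>2 * (4 * w1 * (8/r)\<^sup>2 * K\<^sup>2)"
    using r by (subst bint_add, (intro continuous_intros cw cgq cg)+, simp only: bint_cmult 0 bint_const less_imp_le, simp add: mult_ac)
  also have "\<dots> = 1024 * w1 * K\<^sup>2"
    using r by (simp add: power2_eq_square)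
  finally have "(9/16)^4 * (w0 * energy g z (r/2)) \<le> 1024 * (w1 * K\<^sup>2)"
    by (simp only: mult.assoc)
  also have "\<dots> \<le> ((9/16)^4 * 10^5) * (w1 * K\<^sup>2)"
    using w1 by (intro mult_right_mono) (auto simp: power_divide)
  finally have "(9/16)^4 * (w0 * energy g z (r/2)) \<le> (9/16)^4 * (10^5 * (w1 * K\<^sup>2))"
    by (simp only: mult.assoc)
  then have "w0 * energy g z (r/2) \<le> 10^5 * (w1 * K\<^sup>2)"
    by simp
  then show ?thesis using w0 by (simp add: field_simps)
qed

text \<open>The Cauchy--Schwarz inequality on a segment, in the form of Young's inequality with the
weight \<open>e / r\<close> that balances the length \<open>4 r\<close> against the given bound for the integral of
\<open>H\<close>.\<close>

lemma side_bound:
  fixes F :: "real \<Rightarrow> real"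
  assumes F: "\<And>t. (F has_real_derivative F' t) (at t)" and H: "continuous_on UNIV H" "\<And>t. (F' t)\<^sup>2 \<le> H t"
    and ab: "A \<le> a" "a \<le> b" "b \<le> B" "B - A = 4 * r" and r: "r > 0" and e: "e > 0"
    and I: "integral {A..B} H \<le> 2 * e\<^sup>2 / r"
  shows "\<bar>F b - F a\<bar> \<le> 3 * e"
proof -
  have Hn: "H t \<ge> 0" for t using H(2)[of t] zero_le_power2 order_trans by blast
  define h where "h t = e / (2 * r) + (r / (2 * e)) * H t" for t
  have h: "\<bar>F' t\<bar> \<le> h t" for t
  proof -
    have "0 \<le> (e / r - \<bar>F' t\<bar>)\<^sup>2 * (r / (2 * e))" using e r by simp
    also have "\<dots> = e / (2*r) + (r / (2*e)) * (F' t)\<^sup>2 - \<bar>F' t\<bar>"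
      using e r by (simp add: power2_eq_square field_simps)
    also have "\<dots> \<le> h t - \<bar>F' t\<bar>"
      unfolding h_def by (intro diff_mono add_mono mult_left_mono H(2) order_refl) (use e r in auto)
    finally show ?thesis by simp
  qed
  have hn: "0 \<le> h t" for t using h[of t] by (meson abs_ge_zero order_trans)
  have hc: "continuous_on S h" for S unfolding h_def by (intro continuous_intros continuous_on_subset[OF H(1)]) (use e in auto)
  have "(F' has_integral (F b - F a)) {a..b}"
    using ab(2) F by (intro fundamental_theorem_of_calculus)
      (auto simp: has_real_derivative_iff_has_vector_derivative intro: has_vector_derivative_at_within)
  then have F'i: "F' integrable_on {a..b}" and "integral {a..b} F' = F b - F a" by blast+
  then have "norm (F b - F a) \<le> integral {a..b} h"
    using h by (metis F'i Henstock_Kurzweil_Integration.integral_norm_bound_integral hc integrable_continuous_interval real_norm_def)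
  also have "\<dots> \<le> integral {A..B} h"
    using ab by (intro integral_subset_le integrable_continuous_interval hc) (use hn in auto)
  also have "\<dots> = (B - A) * (e / (2*r)) + (r / (2*e)) * integral {A..B} H"
    unfolding h_def using ab e by (subst integral_add)
      (auto intro!: integrable_continuous_interval continuous_intros continuous_on_subset[OF H(1)])
  also have "\<dots> \<le> 2 * e + (r / (2*e)) * (2 * e\<^sup>2 / r)"
    using ab e r I by (intro add_mono mult_left_mono) auto
  also have "\<dots> = 3 * e" using e r by (simp add: power2_eq_square)
  finally show ?thesis by simp
qed

definition vline :: "(complex \<Rightarrow> real) \<Rightarrow> complex \<Rightarrow> real \<Rightarrow> real \<Rightarrow> real" where
  "vline h z R x = integral {Im z - R..Im z + R} (\<lambda>y. h (Complex x y))"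
definition hline :: "(complex \<Rightarrow> real) \<Rightarrow> complex \<Rightarrow> real \<Rightarrow> real \<Rightarrow> real" where
  "hline h z R y = integral {Re z - R..Re z + R} (\<lambda>x. h (Complex x y))"

lemma line_cont:
  assumes "continuous_on UNIV h"
  shows "continuous_on S (vline h z R)" "continuous_on S (hline h z R)"
proof -
  have "continuous_on UNIV (\<lambda>x. integral (cbox (Im z - R) (Im z + R)) (\<lambda>y. h (Complex x y)))"
    using cont_pair[OF assms] by (intro integral_continuous_on_param) (auto simp: case_prod_unfold)
  then show "continuous_on S (vline h z R)" unfolding vline_def[abs_def] cbox_interval by (rule continuous_on_subset) auto
  have "continuous_on UNIV (\<lambda>y. integral (cbox (Re z - R) (Re z + R)) (\<lambda>x. h (Complex x y)))"
    by (intro integral_continuous_on_param)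
      (auto simp: case_prod_unfold intro!: continuous_intros continuous_on_compose2[OF assms])
  then show "continuous_on S (hline h z R)" unfolding hline_def[abs_def] cbox_interval by (rule continuous_on_subset) auto
qed

lemma integral_shift_right: "integral {c + a..c + b} V = integral {a..b} (\<lambda>r. V (c + r))"
  for V :: "real \<Rightarrow> real"
  using integral_shift_Icc_real[of a b V c] by (simp add: o_def add.commute)

lemma integral_shift_left: "integral {c - b..c - a} V = integral {a..b} (\<lambda>r. V (c - r))"
  for V :: "real \<Rightarrow> real"
  using integral_shift_right[of c "-b" "-a" V]
    Henstock_Kurzweil_Integration.integral_reflect_real[of b a "\<lambda>r. V (c - r)"] by simp

lemma annulus_1d:
  fixes V :: "real \<Rightarrow> real"
  assumes V: "continuous_on UNIV V" and W: "continuous_on UNIV W" "\<And>x. W x \<le> V x" and \<rho>: "\<rho> > 0"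
    and a: "integral {c - 2*\<rho>..c + 2*\<rho>} V \<le> e + integral {c - \<rho>..c + \<rho>} W"
  shows "integral {\<rho>..2*\<rho>} (\<lambda>r. V (c + r) + V (c - r)) \<le> e"
proof -
  have i: "V integrable_on {s..t}" "W integrable_on {s..t}" for s t
    using V W by (auto intro!: integrable_continuous_interval intro: continuous_on_subset)
  have ic: "(\<lambda>r. V (c + r)) integrable_on {s..t}" "(\<lambda>r. V (c - r)) integrable_on {s..t}" for s t
    by (auto intro!: integrable_continuous_interval continuous_intros continuous_on_compose2[OF V])
  have "integral {c - 2*\<rho>..c + 2*\<rho>} V = integral {c - 2*\<rho>..c - \<rho>} V + integral {c - \<rho>..c + 2*\<rho>} V"
    using \<rho> by (intro Henstock_Kurzweil_Integration.integral_combine[symmetric] i) auto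
  also have "integral {c - \<rho>..c + 2*\<rho>} V = integral {c - \<rho>..c + \<rho>} V + integral {c + \<rho>..c + 2*\<rho>} V"
    using \<rho> by (intro Henstock_Kurzweil_Integration.integral_combine[symmetric] i) auto
  finally have "integral {c - 2*\<rho>..c - \<rho>} V + integral {c + \<rho>..c + 2*\<rho>} V \<le> e + integral {c - \<rho>..c + \<rho>} W - integral {c - \<rho>..c + \<rho>} V"
    using a by simp
  also have "integral {c - \<rho>..c + \<rho>} W \<le> integral {c - \<rho>..c + \<rho>} V"
    by (intro integral_le i W)
  finally have "integral {c - 2*\<rho>..c - \<rho>} V + integral {c + \<rho>..c + 2*\<rho>} V \<le> e" by simp
  then show ?thesis
    by (subst integral_add) (auto simp: ic integral_shift_left integral_shift_right)
qed

text \<open>Averaging over \<open>r\<close> between \<open>\<rho>\<close> and \<open>2\<rho>\<close>: the lines through the vertical sides of the square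
of half side \<open>r\<close> sweep two strips that avoid the inner square, so they account for at most
the energy \<open>e\<close> of the annulus; likewise the horizontal ones.\<close>

lemma good_square:
  assumes h: "continuous_on UNIV h" "\<And>y. h y \<ge> 0" and \<rho>: "\<rho> > 0"
    and e: "bint z (2*\<rho>) h - bint z \<rho> h \<le> e"
  obtains r where "\<rho> \<le> r" "r \<le> 2 * \<rho>"
    "vline h z (2*\<rho>) (Re z + r) + vline h z (2*\<rho>) (Re z - r) + hline h z (2*\<rho>) (Im z + r) + hline h z (2*\<rho>) (Im z - r) \<le> 2 * e / \<rho>"
proof -
  note lc = line_cont[OF h(1)]
  have sub: "vline h z \<rho> x \<le> vline h z (2*\<rho>) x" "hline h z \<rho> x \<le> hline h z (2*\<rho>) x" for x
    unfolding vline_def hline_def using \<rho> h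
    by (auto intro!: integral_subset_le integrable_continuous_interval continuous_on_compose2[OF h(1)] continuous_intros)
  define V where "V = vline h z (2*\<rho>)"
  define U where "U = hline h z (2*\<rho>)"
  have 1: "integral {\<rho>..2*\<rho>} (\<lambda>r. V (Re z + r) + V (Re z - r)) \<le> e"
    unfolding V_def by (rule annulus_1d[OF lc(1) lc(1)[of _ z \<rho>] sub(1) \<rho>])
      (use e in \<open>simp add: bint_iter1[OF h(1)] vline_def[abs_def]\<close>)
  have 2: "integral {\<rho>..2*\<rho>} (\<lambda>r. U (Im z + r) + U (Im z - r)) \<le> e"
    unfolding U_def by (rule annulus_1d[OF lc(2) lc(2)[of _ z \<rho>] sub(2) \<rho>])
      (use e in \<open>simp add: bint_iter2[OF h(1)] hline_def[abs_def]\<close>)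
  define S where "S r = (V (Re z + r) + V (Re z - r)) + (U (Im z + r) + U (Im z - r))" for r
  have c: "continuous_on T (\<lambda>r. V (k r))" "continuous_on T (\<lambda>r. U (k r))" if "continuous_on T k" for k and T :: "real set"
    unfolding V_def U_def using that by (auto intro!: continuous_on_compose2[OF lc(1)] continuous_on_compose2[OF lc(2)])
  have S: "integral {\<rho>..2*\<rho>} S \<le> 2 * e"
    unfolding S_def by (subst integral_add) (use 1 2 in \<open>auto intro!: integrable_continuous_interval continuous_intros c\<close>)
  have "\<exists>r\<in>{\<rho>..2*\<rho>}. S r \<le> 2 * e / \<rho>"
  proof (rule ccontr)
    assume n: "\<not> ?thesis"
    have Sc: "continuous_on {\<rho>..2*\<rho>} S" unfolding S_def by (intro continuous_intros c)
    obtain m where m: "m \<in> {\<rho>..2*\<rho>}" "\<And>r. r \<in> {\<rho>..2*\<rho>} \<Longrightarrow> S m \<le> S r"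
      using continuous_attains_inf[OF compact_Icc _ Sc] \<rho> by auto
    have "\<rho> * S m = integral {\<rho>..2*\<rho>} (\<lambda>_. S m)" using \<rho> by simp
    also have "\<dots> \<le> integral {\<rho>..2*\<rho>} S"
      by (intro integral_le integrable_continuous_interval Sc m) auto
    finally have "\<rho> * S m \<le> 2 * e" using S by simp
    then have "S m \<le> 2 * e / \<rho>" using \<rho> by (simp add: field_simps)
    then show False using n m by auto
  qed
  then show ?thesis using that unfolding S_def V_def U_def by (auto simp: add.assoc)
qed

text \<open>On a square with small integrals over its sides the oscillation along the boundary is small;
the maximum principle carries the bound to the interior.\<close>

lemma annulus_osc:
  assumes ws: "weak_sol w f g" and w: "\<And>y. w y > 0" and \<rho>: "\<rho> > 0" and e: "e > 0"
    and E: "energy g z (2*\<rho>) - bint z \<rho> (\<lambda>y. (cmod (g y))\<^sup>2) \<le> e\<^sup>2"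
  obtains r where "\<rho> \<le> r" "r \<le> 2 * \<rho>" "\<And>y u. y \<in> cbx z r \<Longrightarrow> u \<in> cbx z r \<Longrightarrow> \<bar>f y - f u\<bar> \<le> 12 * e"
proof -
  have f: "C1_grad f g" using ws by (auto simp: weak_sol_def)
  define h where "h y = (cmod (g y))\<^sup>2" for y
  have hc: "continuous_on UNIV h" unfolding h_def by (intro sq_norm_cont C1_gradD(1)[OF f])
  have hn: "h y \<ge> 0" for y by (simp add: h_def)
  obtain r where r: "\<rho> \<le> r" "r \<le> 2 * \<rho>" and
    S: "vline h z (2*\<rho>) (Re z + r) + vline h z (2*\<rho>) (Re z - r) + hline h z (2*\<rho>) (Im z + r) + hline h z (2*\<rho>) (Im z - r) \<le> 2 * e\<^sup>2 / \<rho>"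
    using good_square[OF hc hn \<rho> E[folded h_def]] by blast
  have ln: "vline h z (2*\<rho>) x \<ge> 0" "hline h z (2*\<rho>) x \<ge> 0" for x
    unfolding vline_def hline_def
    by (auto intro!: integral_nonneg integrable_continuous_interval continuous_on_compose2[OF hc] continuous_intros hn)
  have I4: "vline h z (2*\<rho>) (Re z + r) \<le> 2 * e\<^sup>2 / \<rho>" "vline h z (2*\<rho>) (Re z - r) \<le> 2 * e\<^sup>2 / \<rho>"
     "hline h z (2*\<rho>) (Im z + r) \<le> 2 * e\<^sup>2 / \<rho>" "hline h z (2*\<rho>) (Im z - r) \<le> 2 * e\<^sup>2 / \<rho>"
    using S ln(1)[of "Re z + r"] ln(1)[of "Re z - r"] ln(2)[of "Im z + r"] ln(2)[of "Im z - r"] by linarith+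
  have hl: "(Re (g y))\<^sup>2 \<le> h y" "(Im (g y))\<^sup>2 \<le> h y" for y by (simp_all add: h_def cmod_power2)
  have V0: "\<bar>f (Complex x b) - f (Complex x a)\<bar> \<le> 3 * e"
    if "vline h z (2*\<rho>) x \<le> 2 * e\<^sup>2 / \<rho>" "\<bar>a - Im z\<bar> \<le> r" "\<bar>b - Im z\<bar> \<le> r" "a \<le> b" for x a b
    by (rule side_bound[of "\<lambda>y. f (Complex x y)" "\<lambda>y. Im (g (Complex x y))" "\<lambda>y. h (Complex x y)" "Im z - 2*\<rho>" a b "Im z + 2*\<rho>" \<rho> e])
      (use that r \<rho> e hl in \<open>auto intro!: C1_grad_snd[OF f] continuous_on_compose2[OF hc] continuous_intros simp: vline_def abs_le_iff\<close>)
  have V: "\<bar>f (Complex x b) - f (Complex x a)\<bar> \<le> 3 * e"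
    if "x = Re z + r \<or> x = Re z - r" "\<bar>a - Im z\<bar> \<le> r" "\<bar>b - Im z\<bar> \<le> r" for x a b
    using V0[of x a b] V0[of x b a] that I4 by (cases "a \<le> b") (auto simp: abs_minus_commute)
  have H0: "\<bar>f (Complex b x) - f (Complex a x)\<bar> \<le> 3 * e"
    if "hline h z (2*\<rho>) x \<le> 2 * e\<^sup>2 / \<rho>" "\<bar>a - Re z\<bar> \<le> r" "\<bar>b - Re z\<bar> \<le> r" "a \<le> b" for x a b
    by (rule side_bound[of "\<lambda>y. f (Complex y x)" "\<lambda>y. Re (g (Complex y x))" "\<lambda>y. h (Complex y x)" "Re z - 2*\<rho>" a b "Re z + 2*\<rho>" \<rho> e])
      (use that r \<rho> e hl in \<open>auto intro!: C1_grad_fst[OF f] continuous_on_compose2[OF hc] continuous_intros simp: hline_def abs_le_iff\<close>)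
  have H: "\<bar>f (Complex b x) - f (Complex a x)\<bar> \<le> 3 * e"
    if "x = Im z + r \<or> x = Im z - r" "\<bar>a - Re z\<bar> \<le> r" "\<bar>b - Re z\<bar> \<le> r" for x a b
    using H0[of x a b] H0[of x b a] that I4 by (cases "a \<le> b") (auto simp: abs_minus_commute)
  have r0: "r > 0" using r \<rho> by simp
  let ?c = "Complex (Re z - r) (Im z - r)"
  have corner: "\<bar>f y - f ?c\<bar> \<le> 6 * e" if y: "y \<in> cbx z r - obox z r" for y
  proof -
    have yy: "\<bar>Re y - Re z\<bar> \<le> r" "\<bar>Im y - Im z\<bar> \<le> r" "\<bar>Re y - Re z\<bar> = r \<or> \<bar>Im y - Im z\<bar> = r"
      using y by (auto simp: cbx_def obox_def)
    then consider "Re y = Re z + r" | "Re y = Re z - r" | "Im y = Im z + r" | "Im y = Im z - r" by linarith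
    then show ?thesis
    proof cases
      case 1
      have "\<bar>f (Complex (Re z + r) (Im y)) - f (Complex (Re z + r) (Im z - r))\<bar> \<le> 3 * e"
        using yy r0 by (intro V) auto
      moreover have "\<bar>f (Complex (Re z + r) (Im z - r)) - f ?c\<bar> \<le> 3 * e"
        using yy r0 by (intro H) auto
      moreover have "y = Complex (Re z + r) (Im y)" using 1 by (simp add: complex_eq_iff)
      ultimately show ?thesis by (smt (verit))
    next
      case 2
      have "\<bar>f (Complex (Re z - r) (Im y)) - f ?c\<bar> \<le> 3 * e"
        using yy r0 by (intro V) auto
      moreover have "y = Complex (Re z - r) (Im y)" using 2 by (simp add: complex_eq_iff)
      ultimately show ?thesis using e by (smt (verit))
    next
      case 3
      have "\<bar>f (Complex (Re y) (Im z + r)) - f (Complex (Re z - r) (Im z + r))\<bar> \<le> 3 * e"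
        using yy r0 by (intro H) auto
      moreover have "\<bar>f (Complex (Re z - r) (Im z + r)) - f ?c\<bar> \<le> 3 * e"
        using yy r0 by (intro V) auto
      moreover have "y = Complex (Re y) (Im z + r)" using 3 by (simp add: complex_eq_iff)
      ultimately show ?thesis by (smt (verit))
    next
      case 4
      have "\<bar>f (Complex (Re y) (Im z - r)) - f ?c\<bar> \<le> 3 * e"
        using yy r0 by (intro H) auto
      moreover have "y = Complex (Re y) (Im z - r)" using 4 by (simp add: complex_eq_iff)
      ultimately show ?thesis using e by (smt (verit))
    qed
  qed
  have "\<bar>f y - f u\<bar> \<le> 12 * e" if "y \<in> cbx z r" "u \<in> cbx z r" for y u
  proof (rule weak_osc[OF ws w r0 _ that])
    fix y u assume "y \<in> cbx z r - obox z r" "u \<in> cbx z r - obox z r"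
    then show "\<bar>f y - f u\<bar> \<le> 12 * e" using corner[of y] corner[of u] by linarith
  qed
  then show ?thesis using that r by blast
qed

text \<open>By the pigeonhole principle one of the \<open>N\<close> dyadic annuli between \<open>\<rho>\<close> and \<open>2^N \<rho>\<close> has energy
at most \<open>E/N\<close>.\<close>

lemma courant_lebesgue:
  assumes ws: "weak_sol w f g" and w: "\<And>y. w y > 0" and \<rho>: "\<rho> > 0" and e: "e > 0"
    and E: "energy g z (2^N * \<rho>) \<le> E" "E < real N * e\<^sup>2"
    and y: "y \<in> cbx z \<rho>" and u: "u \<in> cbx z \<rho>"
  shows "\<bar>f y - f u\<bar> \<le> 12 * e"
proof -
  have f: "C1_grad f g" using ws by (auto simp: weak_sol_def)
  define b where "b k = energy g z (2^k * \<rho>)" for k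
  have "\<exists>k<N. b (Suc k) - b k \<le> e\<^sup>2"
  proof (rule ccontr)
    assume "\<not> ?thesis"
    then have "e\<^sup>2 \<le> b (Suc k) - b k" if "k < N" for k using that by force
    then have "(\<Sum>k<N. e\<^sup>2) \<le> (\<Sum>k<N. b (Suc k) - b k)" by (intro sum_mono) auto
    then have "real N * e\<^sup>2 \<le> b N - b 0" by (simp add: sum_lessThan_telescope)
    moreover have "b 0 \<ge> 0" unfolding b_def by (intro bint_nonneg sq_norm_cont C1_gradD(1)[OF f]) auto
    ultimately show False using E by (simp add: b_def)
  qed
  then obtain k where k: "b (Suc k) - b k \<le> e\<^sup>2" by blast
  obtain r where r: "2^k * \<rho> \<le> r" "\<And>y u. y \<in> cbx z r \<Longrightarrow> u \<in> cbx z r \<Longrightarrow> \<bar>f y - f u\<bar> \<le> 12 * e"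
  proof (rule annulus_osc[OF ws w, of "2^k * \<rho>" e z])
    show "energy g z (2 * (2 ^ k * \<rho>)) - energy g z (2 ^ k * \<rho>) \<le> e\<^sup>2"
      using k by (simp add: b_def mult.assoc)
  qed (use \<rho> e in auto)
  have "\<rho> \<le> 2^k * \<rho>" using \<rho> by simp
  then have "cbx z \<rho> \<subseteq> cbx z r" using r(1) by (intro cbx_mono) linarith
  then show ?thesis using r(2) y u by blast
qed

text \<open>Caccioppoli's inequality bounds the energy on all squares by one constant, so
\<open>courant_lebesgue\<close>, applied with arbitrarily many annuli, makes the oscillation on a fixed
square arbitrarily small.\<close>

lemma weak_liouville:
  assumes ws: "weak_sol w f g" and w0: "w0 > 0" and w: "\<And>y. w0 \<le> w y" "\<And>y. w y \<le> w1" and K: "\<And>y. \<bar>f y\<bar> \<le> K"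
  shows "f y = f u"
proof -
  define E where "E = 10 ^ 5 * (w1 / w0) * K\<^sup>2"
  have E: "energy g 0 r \<le> E" if "r > 0" for r
    using caccioppoli[OF ws w0 w, of "2 * r" 0 0 K] that K unfolding E_def by simp
  have wp: "w x > 0" for x using w(1)[of x] w0 by linarith
  define \<rho> where "\<rho> = 1 + cmod y + cmod u"
  have \<rho>: "\<rho> > 0" "y \<in> cbx 0 \<rho>" "u \<in> cbx 0 \<rho>"
    using abs_Re_le_cmod[of y] abs_Im_le_cmod[of y] abs_Re_le_cmod[of u] abs_Im_le_cmod[of u]
    by (auto simp: \<rho>_def cbx_def)
  have "\<bar>f y - f u\<bar> \<le> 0 + d" if d: "d > 0" for d
  proof -
    obtain N where "E / (d/12)\<^sup>2 < real N" using reals_Archimedean2 by blast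
    then have "E < real N * (d/12)\<^sup>2" using d by (simp add: field_simps)
    then have "\<bar>f y - f u\<bar> \<le> 12 * (d / 12)"
      by (intro courant_lebesgue[OF ws wp \<rho>(1) _ E _ \<rho>(2,3)]) (use d \<rho> in auto)
    then show ?thesis by simp
  qed
  then have "\<bar>f y - f u\<bar> \<le> 0" by (rule field_le_epsilon)
  then show ?thesis by simp
qed

section \<open>Flows of bounded vector fields\<close>

lemma forward_integral_deriv:
  fixes g :: "real \<Rightarrow> complex"
  assumes g: "continuous_on UNIV g" and t: "t \<ge> 0"
  shows "((\<lambda>t. integral {0..t} g) has_vector_derivative g t) (at t within {0..})"
proof -
  have "((\<lambda>t. integral {0..t} g) has_vector_derivative g t) (at t within {0..t+1})"
    using t by (intro integral_has_vector_derivative continuous_on_subset[OF g]) auto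
  moreover have "at t within {0..t+1} = at t within {0..}"
    by (rule at_within_nhd[of _ "{..<t+1}"]) auto
  ultimately show ?thesis by simp
qed

text \<open>Picard iteration as a contraction: writing the unknown as \<open>x0 + exp (2 L t) y(t)\<close> with \<open>y\<close>
bounded makes the integral operator a contraction with factor 1/2 on the whole half line at
once.\<close>

lemma ode_forward:
  fixes f :: "complex \<Rightarrow> complex"
  assumes lip: "\<And>x y. norm (f x - f y) \<le> L * norm (x - y)" and L: "L > 0" and B: "\<And>x. norm (f x) \<le> B"
  shows "\<exists>x. x 0 = x0 \<and> (\<forall>t\<ge>0. (x has_vector_derivative f (x t)) (at t within {0..}))"
proof -
  have fc: "continuous_on UNIV f"
  proof (rule continuous_on_iff[THEN iffD2], intro ballI allI impI)
    fix x and e :: real assume "e > 0"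
    then show "\<exists>d>0. \<forall>y\<in>UNIV. dist y x < d \<longrightarrow> dist (f y) (f x) < e"
      using L by (intro exI[of _ "e / L"]) (auto simp: dist_norm field_simps intro: le_less_trans[OF lip])
  qed
  have B0: "B \<ge> 0" using B[of 0] norm_ge_zero order_trans by blast
  define X where "X y t = x0 + exp (2*L*t) *\<^sub>R apply_bcontfun y t" for y :: "real \<Rightarrow>\<^sub>C complex" and t
  have Xc: "continuous_on S (\<lambda>t. f (X y t))" for y S
    unfolding X_def by (intro continuous_on_compose2[OF fc] continuous_intros continuous_on_subset[OF continuous_on_apply_bcontfun]) auto
  define T where "T y t = exp (-2*L*max 0 t) *\<^sub>R integral {0..max 0 t} (\<lambda>s. f (X y s))" for y :: "real \<Rightarrow>\<^sub>C complex" and t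
  have int: "(\<lambda>s. f (X y s)) integrable_on {a..b}" for y a b by (intro integrable_continuous_interval Xc)
  have Ic: "continuous_on {0..} (\<lambda>t. integral {0..t} (\<lambda>s. f (X y s)))" for y
    unfolding continuous_on_eq_continuous_within
    using has_vector_derivative_continuous[OF forward_integral_deriv[OF Xc]] by (metis atLeast_iff)
  have Tc: "continuous_on UNIV (T y)" for y
    unfolding T_def by (intro continuous_intros continuous_on_compose2[OF Ic]) auto
  (* The weight beats the linear growth of the integral of a bounded function. *)
  have et: "exp (-(2*L*t)) * t \<le> 1 / (2*L)" if "t \<ge> 0" for t
  proof -
    have "2*L*t \<le> exp (2*L*t)" using exp_ge_add_one_self[of "2*L*t"] by linarith
    then show ?thesis using L by (simp add: exp_minus field_simps)
  qed
  have Tb: "norm (T y t) \<le> B / (2*L)" for y t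
  proof -
    define u where "u = max 0 t"
    have "norm (integral {0..u} (\<lambda>s. f (X y s))) \<le> integral {0..u} (\<lambda>s. B)"
      by (rule Henstock_Kurzweil_Integration.integral_norm_bound_integral[OF int]) (auto intro: B)
    then have "norm (integral {0..u} (\<lambda>s. f (X y s))) \<le> u * B" by (simp add: u_def)
    then have "norm (T y t) \<le> exp (-(2*L*u)) * (u * B)"
      unfolding T_def u_def[symmetric] by simp
    also have "\<dots> \<le> 1 / (2*L) * B"
      using mult_right_mono[OF et[of u] B0] by (simp add: u_def mult.assoc)
    finally show ?thesis by simp
  qed
  have Tin: "T y \<in> bcontfun" for y :: "real \<Rightarrow>\<^sub>C complex"
    using Tc Tb by (auto simp: bcontfun_def bounded_iff)
  define \<Phi> where "\<Phi> y = Bcontfun (T y)" for y :: "real \<Rightarrow>\<^sub>C complex"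
  have \<Phi>: "apply_bcontfun (\<Phi> y) = T y" for y :: "real \<Rightarrow>\<^sub>C complex" unfolding \<Phi>_def using Tin by (simp add: Bcontfun_inverse)
  have "\<exists>!y. \<Phi> y = y"
  proof (rule banach_fix_type[of "1/2"])
    show "\<forall>y z. dist (\<Phi> y) (\<Phi> z) \<le> 1/2 * dist y z"
    proof (intro allI)
      fix y z :: "real \<Rightarrow>\<^sub>C complex"
      define d where "d = dist y z"
      have "dist (T y t) (T z t) \<le> 1/2 * d" for t
      proof -
        define u where "u = max 0 t"
        have u: "u \<ge> 0" by (simp add: u_def)
        have pt: "norm (f (X y s) - f (X z s)) \<le> L * (exp (2*L * s) * d)" for s
        proof -
          have "norm (f (X y s) - f (X z s)) \<le> L * norm (X y s - X z s)" by (rule lip)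
          also have "X y s - X z s = exp (2*L * s) *\<^sub>R (apply_bcontfun y s - apply_bcontfun z s)"
            by (simp add: X_def scaleR_diff_right)
          also have "norm \<dots> \<le> exp (2*L * s) * d"
            using dist_bounded[of y s z] by (simp add: dist_norm d_def)
          finally show ?thesis using L by simp
        qed
        have "((\<lambda>s. L * (exp (2*L * s) * d)) has_integral (exp (2*L*u) * d / 2 - exp (2*L*0) * d / 2)) {0..u}"
          using u L by (intro fundamental_theorem_of_calculus)
            (auto intro!: derivative_eq_intros simp: has_real_derivative_iff_has_vector_derivative[symmetric])
        then have e: "integral {0..u} (\<lambda>s. L * (exp (2*L * s) * d)) = exp (2*L*u) * d / 2 - d / 2" and i: "(\<lambda>s. L * (exp (2*L * s) * d)) integrable_on {0..u}"
          by (auto dest: integral_unique)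
        have "norm (integral {0..u} (\<lambda>s. f (X y s) - f (X z s))) \<le> exp (2*L*u) * d / 2 - d / 2"
          unfolding e[symmetric]
          by (rule Henstock_Kurzweil_Integration.integral_norm_bound_integral[OF integrable_diff[OF int int] i]) (rule pt)
        then have "norm (integral {0..u} (\<lambda>s. f (X y s)) - integral {0..u} (\<lambda>s. f (X z s))) \<le> exp (2*L*u) * d / 2"
          using zero_le_dist[of y z] unfolding d_def[symmetric] integral_diff[OF int int] by linarith
        then have "exp (-(2*L*u)) * norm (integral {0..u} (\<lambda>s. f (X y s)) - integral {0..u} (\<lambda>s. f (X z s))) \<le> exp (-(2*L*u)) * (exp (2*L*u) * d / 2)"
          by (intro mult_left_mono) auto
        moreover have "exp (-(2*L*u)) * (exp (2*L*u) * d / 2) = d / 2" by (simp add: exp_minus)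
        moreover have "dist (T y t) (T z t) = exp (-(2*L*u)) * norm (integral {0..u} (\<lambda>s. f (X y s)) - integral {0..u} (\<lambda>s. f (X z s)))"
          unfolding T_def u_def[symmetric] dist_norm scaleR_diff_right[symmetric] by simp
        ultimately show ?thesis by linarith
      qed
      then show "dist (\<Phi> y) (\<Phi> z) \<le> 1/2 * dist y z"
        unfolding d_def by (intro dist_bound) (simp add: \<Phi>)
    qed
  qed auto
  then obtain y where y: "\<Phi> y = y" by blast
  have yt: "apply_bcontfun y t = T y t" for t using \<Phi>[of y] y by simp
  have Xt: "X y t = x0 + integral {0..t} (\<lambda>s. f (X y s))" if "t \<ge> 0" for t
    using that by (subst X_def, subst yt) (simp add: T_def exp_minus)
  define x where "x t = x0 + integral {0..t} (\<lambda>s. f (X y s))" for t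
  have "(x has_vector_derivative f (x t)) (at t within {0..})" if "t \<ge> 0" for t
    using forward_integral_deriv[OF Xc that, of y] Xt[OF that] unfolding x_def
    by (auto intro!: derivative_eq_intros)
  moreover have "x 0 = x0" by (simp add: x_def)
  ultimately show ?thesis by blast
qed

text \<open>The solution for negative times is the forward solution of the reversed field.\<close>

lemma ode_lipschitz:
  fixes f :: "complex \<Rightarrow> complex"
  assumes lip: "\<And>x y. norm (f x - f y) \<le> L * norm (x - y)" and L: "L > 0" and B: "\<And>x. norm (f x) \<le> B"
  shows "\<exists>x. x 0 = x0 \<and> (\<forall>t. (x has_vector_derivative f (x t)) (at t))"
proof -
  obtain a where a: "a 0 = x0" "\<And>t. t \<ge> 0 \<Longrightarrow> (a has_vector_derivative f (a t)) (at t within {0..})"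
    using ode_forward[OF lip L B] by blast
  obtain b where b: "b 0 = x0" "\<And>t. t \<ge> 0 \<Longrightarrow> (b has_vector_derivative - f (b t)) (at t within {0..})"
    using ode_forward[of "\<lambda>x. - f x" L B x0] lip L B by (auto simp: norm_minus_commute)
  define x where "x t = (if t \<ge> 0 then a t else b (-t))" for t
  have R: "(x has_vector_derivative f (x t)) (at t within {0..})" if "t \<ge> 0" for t
    by (rule has_vector_derivative_transform[OF _ _ a(2)[OF that, THEN has_vector_derivative_eq_rhs]])
      (use that in \<open>auto simp: x_def\<close>)
  have Lf: "(x has_vector_derivative f (x t)) (at t within {..0})" if "t \<le> 0" for t
  proof -
    have "((b \<circ> uminus) has_vector_derivative ((-1) *\<^sub>R (- f (b (-t))))) (at t within {..0})"
    proof (rule vector_diff_chain_within)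
      show "(uminus has_vector_derivative -1) (at t within {..0})"
        by (auto intro!: derivative_eq_intros)
      show "(b has_vector_derivative - f (b (- t))) (at (- t) within uminus ` {..0})"
        by (rule has_vector_derivative_within_subset[OF b(2)[of "-t"]]) (use that in auto)
    qed
    then have *: "((b \<circ> uminus) has_vector_derivative f (b (-t))) (at t within {..0})" by simp
    have xe: "x s = b (- s)" if "s \<le> 0" for s using that a(1) b(1) by (auto simp: x_def)
    show ?thesis
      by (rule has_vector_derivative_transform[OF _ _ *[THEN has_vector_derivative_eq_rhs]])
        (use that xe in auto)
  qed
  have "(x has_vector_derivative f (x t)) (at t)" for t
  proof -
    consider "t > 0" | "t < 0" | "t = 0" by linarith
    then show ?thesis
    proof cases
      case 1
      have "at t within {0..} = at t" using 1 by (intro at_within_interior) auto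
      then show ?thesis using R[of t] 1 by simp
    next
      case 2
      have "at t within {..0} = at t" using 2 by (intro at_within_interior) auto
      then show ?thesis using Lf[of t] 2 by simp
    next
      case 3
      have "{0..} \<union> {..0} = (UNIV :: real set)" by auto
      moreover have "(x has_vector_derivative f (x t)) (at t within ({0..} \<union> {..0}))"
        using R[of t] Lf[of t] 3 unfolding has_vector_derivative_def has_derivative_within
        by (auto intro: Lim_Un)
      ultimately show ?thesis by simp
    qed
  qed
  moreover have "x 0 = x0" using a by (simp add: x_def)
  ultimately show ?thesis by blast
qed

text \<open>The squared distance \<open>d\<close> of two solutions satisfies \<open>|d'| \<le> 2 L d\<close>, which controls it in
both directions of time.\<close>

lemma ode_gronwall:
  fixes f :: "complex \<Rightarrow> complex"
  assumes x: "\<And>t. t \<in> {a..b} \<Longrightarrow> (x has_vector_derivative f (x t)) (at t)"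
    and y: "\<And>t. t \<in> {a..b} \<Longrightarrow> (y has_vector_derivative f (y t)) (at t)"
    and D: "\<And>t. t \<in> {a..b} \<Longrightarrow> x t \<in> D \<and> y t \<in> D"
    and lip: "\<And>u v. u \<in> D \<Longrightarrow> v \<in> D \<Longrightarrow> norm (f u - f v) \<le> L * norm (u - v)" and ab: "a \<le> b"
  shows "norm (x b - y b) \<le> exp (L * (b - a)) * norm (x a - y a)"
    "norm (x a - y a) \<le> exp (L * (b - a)) * norm (x b - y b)"
proof -
  define d where "d t = (x t - y t) \<bullet> (x t - y t)" for t
  define d' where "d' t = 2 * ((x t - y t) \<bullet> (f (x t) - f (y t)))" for t
  have d: "(d has_real_derivative d' t) (at t)" if "t \<in> {a..b}" for t
  proof -
    have "((\<lambda>t. x t - y t) has_vector_derivative (f (x t) - f (y t))) (at t)"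
      by (intro has_vector_derivative_diff x y that)
    then have z: "((\<lambda>t. x t - y t) has_derivative (\<lambda>h. h *\<^sub>R (f (x t) - f (y t)))) (at t)"
      by (simp add: has_vector_derivative_def)
    show ?thesis unfolding d_def[abs_def] has_field_derivative_def
      by (rule has_derivative_eq_rhs[OF has_derivative_inner[OF z z]])
        (auto simp: d'_def inner_commute algebra_simps)
  qed
  have d'b: "\<bar>d' t\<bar> \<le> 2 * L * d t" if "t \<in> {a..b}" for t
  proof -
    have "\<bar>(x t - y t) \<bullet> (f (x t) - f (y t))\<bar> \<le> norm (x t - y t) * norm (f (x t) - f (y t))"
      by (rule Cauchy_Schwarz_ineq2)
    also have "\<dots> \<le> norm (x t - y t) * (L * norm (x t - y t))"
      using D[OF that] by (intro mult_left_mono lip) auto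
    also have "\<dots> = L * d t" by (simp add: d_def power2_norm_eq_inner[symmetric] power2_eq_square)
    finally show ?thesis by (simp add: d'_def)
  qed
  have "exp (- (2 * L * b)) * d b \<le> exp (- (2 * L * a)) * d a"
  proof (rule DERIV_nonpos_imp_nonincreasing[OF ab])
    fix t assume t: "a \<le> t" "t \<le> b"
    have "((\<lambda>t. exp (- (2 * L * t)) * d t) has_real_derivative (exp (- (2 * L * t)) * (d' t - 2 * L * d t))) (at t)"
      using d[of t] t by (auto intro!: derivative_eq_intros simp: algebra_simps)
    moreover have "exp (- (2 * L * t)) * (d' t - 2 * L * d t) \<le> 0"
      using d'b[of t] t by (intro mult_nonneg_nonpos) auto
    ultimately show "\<exists>y. ((\<lambda>t. exp (- (2 * L * t)) * d t) has_real_derivative y) (at t) \<and> y \<le> 0" by blast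
  qed
  then have "exp (2*L*b) * (exp (- (2 * L * b)) * d b) \<le> exp (2*L*b) * (exp (- (2 * L * a)) * d a)"
    by (intro mult_left_mono) auto
  moreover have "exp (2 * L * (b - a)) = exp (2*L*b) * exp (- (2*L*a))"
    by (simp add: mult_exp_exp right_diff_distrib)
  moreover have "exp (2*L*b) * (exp (- (2*L*b)) * d b) = d b" by (simp add: exp_minus)
  ultimately have 1: "d b \<le> exp (2 * L * (b - a)) * d a" by (simp only: mult.assoc)
  have "exp (2 * L * a) * d a \<le> exp (2 * L * b) * d b"
  proof (rule DERIV_nonneg_imp_nondecreasing[OF ab])
    fix t assume t: "a \<le> t" "t \<le> b"
    have "((\<lambda>t. exp (2 * L * t) * d t) has_real_derivative (exp (2 * L * t) * (d' t + 2 * L * d t))) (at t)"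
      using d[of t] t by (auto intro!: derivative_eq_intros simp: algebra_simps)
    moreover have "exp (2 * L * t) * (d' t + 2 * L * d t) \<ge> 0"
      using d'b[of t] t by (intro mult_nonneg_nonneg) auto
    ultimately show "\<exists>y. ((\<lambda>t. exp (2 * L * t) * d t) has_real_derivative y) (at t) \<and> y \<ge> 0" by blast
  qed
  then have "exp (-(2*L*a)) * (exp (2 * L * a) * d a) \<le> exp (-(2*L*a)) * (exp (2 * L * b) * d b)"
    by (intro mult_left_mono) auto
  moreover have "exp (2 * L * (b - a)) = exp (- (2*L*a)) * exp (2*L*b)"
    by (simp add: mult_exp_exp right_diff_distrib)
  moreover have "exp (- (2*L*a)) * (exp (2*L*a) * d a) = d a" by (simp add: exp_minus)
  ultimately have 2: "d a \<le> exp (2 * L * (b - a)) * d b" by (simp only: mult.assoc)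
  have ee: "exp (2 * L * (b - a)) = (exp (L * (b - a)))\<^sup>2" by (simp add: power2_eq_square exp_add[symmetric] algebra_simps)
  have dd: "d t = (norm (x t - y t))\<^sup>2" for t by (simp add: d_def power2_norm_eq_inner)
  show "norm (x b - y b) \<le> exp (L * (b - a)) * norm (x a - y a)"
    by (rule power2_le_imp_le) (use 1 in \<open>auto simp: dd ee power_mult_distrib\<close>)
  show "norm (x a - y a) \<le> exp (L * (b - a)) * norm (x b - y b)"
    by (rule power2_le_imp_le) (use 2 in \<open>auto simp: dd ee power_mult_distrib\<close>)
qed

lemma ode_speed:
  assumes x: "\<And>t. (x has_vector_derivative x' t) (at t)" and B: "\<And>t. norm (x' t) \<le> B"
  shows "norm (x t - x s) \<le> B * \<bar>t - s\<bar>"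
proof -
  have on: "onorm (\<lambda>h. h *\<^sub>R x' t) \<le> B" for t
  proof (rule onorm_le)
    fix h :: real
    have "\<bar>h\<bar> * norm (x' t) \<le> \<bar>h\<bar> * B" using B by (intro mult_left_mono) auto
    then show "norm (h *\<^sub>R x' t) \<le> B * norm h" by (simp add: mult.commute)
  qed
  have "norm (x t - x s) \<le> B * norm (t - s)"
    by (rule differentiable_bound[OF convex_UNIV _ on]) (use x in \<open>auto simp: has_vector_derivative_def\<close>)
  then show ?thesis by simp
qed

definition loc_lip :: "(complex \<Rightarrow> complex) \<Rightarrow> bool" where
  "loc_lip f \<longleftrightarrow> (\<forall>R. \<exists>L>0. \<forall>x\<in>cball 0 R. \<forall>y\<in>cball 0 R. norm (f x - f y) \<le> L * norm (x - y))"

lemma ode_unique_sym: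
  fixes f :: "complex \<Rightarrow> complex"
  assumes ll: "loc_lip f" and T: "T \<ge> 0"
    and x: "\<And>t. \<bar>t\<bar> \<le> T \<Longrightarrow> (x has_vector_derivative f (x t)) (at t)"
    and y: "\<And>t. \<bar>t\<bar> \<le> T \<Longrightarrow> (y has_vector_derivative f (y t)) (at t)"
    and bd: "\<And>t. \<bar>t\<bar> \<le> T \<Longrightarrow> norm (x t) \<le> R \<and> norm (y t) \<le> R"
    and eq: "x 0 = y 0" and t: "\<bar>t\<bar> \<le> T"
  shows "x t = y t"
proof -
  obtain L where L: "\<And>u v. u \<in> cball 0 R \<Longrightarrow> v \<in> cball 0 R \<Longrightarrow> norm (f u - f v) \<le> L * norm (u - v)"
    using ll unfolding loc_lip_def by blast
  show ?thesis
  proof (cases "t \<ge> 0")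
    case True
    have "norm (x t - y t) \<le> exp (L * (t - 0)) * norm (x 0 - y 0)"
      by (rule ode_gronwall(1)[of 0 t x f y "cball 0 R"]) (use x y bd t True L in auto)
    then show ?thesis using eq by simp
  next
    case False
    have "norm (x t - y t) \<le> exp (L * (0 - t)) * norm (x 0 - y 0)"
      by (rule ode_gronwall(2)[of t 0 x f y "cball 0 R"]) (use x y bd t False L in auto)
    then show ?thesis using eq by simp
  qed
qed

text \<open>A bounded field moves a point at bounded speed, so up to a given time only the values of \<open>f\<close>
on a ball matter. There \<open>f\<close> may be replaced by its composition with the nearest-point
projection onto the ball, which is globally Lipschitz.\<close>

lemma ode_global:
  fixes f :: "complex \<Rightarrow> complex"
  assumes ll: "loc_lip f" and B: "\<And>x. norm (f x) \<le> B"
  shows "\<exists>x. x 0 = x0 \<and> (\<forall>t. (x has_vector_derivative f (x t)) (at t))"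
proof -
  have B0: "B \<ge> 0" using B[of 0] norm_ge_zero order_trans by blast
  define cp where "cp n = closest_point (cball (0::complex) (real n))" for n
  have cp1: "cp n x \<in> cball 0 (real n)" for n x unfolding cp_def by (rule closest_point_in_set) auto
  have cp2: "cp n x = x" if "norm x \<le> real n" for n x unfolding cp_def using that by (simp add: closest_point_self)
  have cp3: "norm (cp n x - cp n y) \<le> norm (x - y)" for n x y
    unfolding cp_def dist_norm[symmetric] by (rule closest_point_lipschitz) auto
  have "\<exists>x. x 0 = x0 \<and> (\<forall>t. (x has_vector_derivative f (cp n (x t))) (at t))" for n
  proof -
    obtain L where L: "L > 0" "\<And>u v. u \<in> cball 0 (real n) \<Longrightarrow> v \<in> cball 0 (real n) \<Longrightarrow> norm (f u - f v) \<le> L * norm (u - v)"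
      using ll unfolding loc_lip_def by blast
    show ?thesis
    proof (rule ode_lipschitz[of "\<lambda>x. f (cp n x)" L B])
      fix x y
      have "norm (f (cp n x) - f (cp n y)) \<le> L * norm (cp n x - cp n y)" by (intro L cp1)
      also have "\<dots> \<le> L * norm (x - y)" using L(1) by (intro mult_left_mono cp3) auto
      finally show "norm (f (cp n x) - f (cp n y)) \<le> L * norm (x - y)" .
    qed (use L B in auto)
  qed
  then have "\<forall>n. \<exists>x. x 0 = x0 \<and> (\<forall>t. (x has_vector_derivative f (cp n (x t))) (at t))" by blast
  from choice[OF this] obtain X where X0: "\<And>n. X n 0 = x0" and X: "\<And>n t. (X n has_vector_derivative f (cp n (X n t))) (at t)"
    by blast
  have Xb: "norm (X n t) \<le> norm x0 + B * \<bar>t\<bar>" for n t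
  proof -
    have "norm (X n t - X n 0) \<le> B * \<bar>t - 0\<bar>" by (rule ode_speed[OF X B])
    then show ?thesis using X0[of n] norm_triangle_sub[of "X n t" x0] by simp
  qed
  have agree: "X n t = X m t" if "norm x0 + B * T \<le> real n" "norm x0 + B * T \<le> real m" "\<bar>t\<bar> \<le> T" for n m t T
  proof (rule ode_unique_sym[OF ll, of T _ _ "norm x0 + B * T"])
    have b: "norm (X k s) \<le> norm x0 + B * T" if "\<bar>s\<bar> \<le> T" for k s
      using Xb[of k s] mult_left_mono[OF that B0] by linarith
    show "(X n has_vector_derivative f (X n s)) (at s)" if "\<bar>s\<bar> \<le> T" for s
      using X[of n s] cp2[of "X n s" n] b[OF that, of n] \<open>norm x0 + B * T \<le> real n\<close> by simp
    show "(X m has_vector_derivative f (X m s)) (at s)" if "\<bar>s\<bar> \<le> T" for s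
      using X[of m s] cp2[of "X m s" m] b[OF that, of m] \<open>norm x0 + B * T \<le> real m\<close> by simp
    show "norm (X n s) \<le> norm x0 + B * T \<and> norm (X m s) \<le> norm x0 + B * T" if "\<bar>s\<bar> \<le> T" for s
      using b[OF that] by blast
  qed (use that X0 in auto)
  define N where "N T = nat \<lceil>norm x0 + B * T\<rceil>" for T
  have N: "norm x0 + B * T \<le> real (N T)" for T unfolding N_def by (rule real_nat_ceiling_ge)
  define x where "x t = X (N \<bar>t\<bar>) t" for t
  have xe: "x s = X (N T) s" if "\<bar>s\<bar> \<le> T" for s T
    unfolding x_def
  proof (rule agree[of "\<bar>s\<bar>"])
    show "norm x0 + B * \<bar>s\<bar> \<le> real (N T)" using N[of T] mult_left_mono[OF that B0] by linarith
  qed (use N in auto)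
  have "(x has_vector_derivative f (x t)) (at t)" for t
  proof -
    define T where "T = \<bar>t\<bar> + 1"
    have "norm (X (N T) t) \<le> real (N T)"
      using Xb[of "N T" t] N[of T] mult_left_mono[of "\<bar>t\<bar>" T, OF _ B0] by (simp add: T_def)
    then have "(X (N T) has_vector_derivative f (x t)) (at t)"
      using X[of "N T" t] cp2 xe[of t T] by (simp add: T_def)
    then show ?thesis
      by (rule has_vector_derivative_transform_within_open[of _ _ _ "{-T<..<T}"]) (auto simp: T_def intro!: xe[symmetric])
  qed
  moreover have "x 0 = x0" by (simp add: x_def X0)
  ultimately show ?thesis by blast
qed

definition is_flow :: "(complex \<Rightarrow> complex) \<Rightarrow> (real \<Rightarrow> complex \<Rightarrow> complex) \<Rightarrow> bool" where
  "is_flow f F \<longleftrightarrow> (\<forall>x. F 0 x = x) \<and> (\<forall>t x. ((\<lambda>t. F t x) has_vector_derivative f (F t x)) (at t)) \<and>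
     (\<forall>s t x. F (s + t) x = F s (F t x)) \<and> continuous_on UNIV (\<lambda>(t, x). F t x)"

text \<open>The group law is uniqueness of solutions; joint continuity combines Gronwall's estimate in
the initial value with the bounded speed in time.\<close>

theorem flow_exists:
  fixes f :: "complex \<Rightarrow> complex"
  assumes ll: "loc_lip f" and B: "\<And>x. norm (f x) \<le> B"
  shows "\<exists>F. is_flow f F"
proof -
  have B0: "B \<ge> 0" using B[of 0] norm_ge_zero order_trans by blast
  have "\<forall>x0. \<exists>x. x 0 = x0 \<and> (\<forall>t. (x has_vector_derivative f (x t)) (at t))"
    using ode_global[OF ll B] by blast
  from choice[OF this] obtain F' where F': "\<And>x. F' x 0 = x" "\<And>x t. (F' x has_vector_derivative f (F' x t)) (at t)" by blast
  define F where "F t x = F' x t" for t x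
  have F0: "F 0 x = x" for x using F'(1) by (simp add: F_def)
  have F: "((\<lambda>t. F t x) has_vector_derivative f (F t x)) (at t)" for t x
    unfolding F_def using F'(2)[of x t] .
  have speed: "norm (F t x - F s x) \<le> B * \<bar>t - s\<bar>" for t s x by (rule ode_speed[OF F B])
  have bd: "norm (F t x) \<le> norm x + B * \<bar>t\<bar>" for t x
    using speed[of t x 0] F0[of x] norm_triangle_sub[of "F t x" x] by simp
  have group: "F (s + t) x = F s (F t x)" for s t x
  proof (rule ode_unique_sym[OF ll, of "\<bar>s\<bar>" "\<lambda>s. F (s + t) x" "\<lambda>s. F s (F t x)" "norm x + B * (\<bar>s\<bar> + \<bar>t\<bar>) + (norm (F t x) + B * \<bar>s\<bar>)" s])
    show "((\<lambda>s. F (s + t) x) has_vector_derivative f (F (r + t) x)) (at r)" for r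
    proof -
      have "(((\<lambda>s. F s x) \<circ> (\<lambda>s. s + t)) has_vector_derivative (1 *\<^sub>R f (F (r + t) x))) (at r)"
        by (rule vector_diff_chain_at) (auto intro!: derivative_eq_intros F)
      then show ?thesis by (simp add: o_def)
    qed
    fix r assume r: "\<bar>r\<bar> \<le> \<bar>s\<bar>"
    have "norm (F (r + t) x) \<le> norm x + B * (\<bar>s\<bar> + \<bar>t\<bar>)"
      using bd[of "r+t" x] mult_left_mono[of "\<bar>r+t\<bar>" "\<bar>s\<bar> + \<bar>t\<bar>", OF _ B0] r by linarith
    moreover have "norm (F r (F t x)) \<le> norm (F t x) + B * \<bar>s\<bar>"
      using bd[of r "F t x"] mult_left_mono[OF r B0] by linarith
    moreover have "0 \<le> norm x + B * (\<bar>s\<bar> + \<bar>t\<bar>)" "0 \<le> norm (F t x) + B * \<bar>s\<bar>" using B0 by auto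
    ultimately show "norm (F (r + t) x) \<le> norm x + B * (\<bar>s\<bar> + \<bar>t\<bar>) + (norm (F t x) + B * \<bar>s\<bar>) \<and>
       norm (F r (F t x)) \<le> norm x + B * (\<bar>s\<bar> + \<bar>t\<bar>) + (norm (F t x) + B * \<bar>s\<bar>)" by linarith
  qed (auto simp: F0 F)
  have "continuous_on UNIV (\<lambda>(t, x). F t x)"
  proof (intro continuous_at_imp_continuous_on ballI)
    fix p :: "real \<times> complex"
    obtain t0 x0 where p: "p = (t0, x0)" by force
    define T where "T = \<bar>t0\<bar> + 1"
    define R where "R = norm x0 + 1 + B * T"
    have RT: "B * T \<ge> 0" using B0 by (simp add: T_def)
    obtain L where L: "L > 0" "\<And>u v. u \<in> cball 0 R \<Longrightarrow> v \<in> cball 0 R \<Longrightarrow> norm (f u - f v) \<le> L * norm (u - v)"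
      using ll unfolding loc_lip_def by blast
    have inD: "F s x \<in> cball 0 R" if "\<bar>s\<bar> \<le> T" "norm x \<le> norm x0 + 1" for s x
      using bd[of s x] mult_left_mono[OF that(1) B0] that(2) by (simp add: R_def)
    have close: "norm (F t x - F t x0) \<le> exp (L * T) * norm (x - x0)" if "\<bar>t\<bar> \<le> T" "norm x \<le> norm x0 + 1" for t x
    proof -
      have "norm (F t x - F t x0) \<le> exp (L * \<bar>t\<bar>) * norm (x - x0)"
      proof (cases "t \<ge> 0")
        case True
        then show ?thesis
          using ode_gronwall(1)[of 0 t "\<lambda>t. F t x" f "\<lambda>t. F t x0" "cball 0 R" L] F inD L(2) that F0 by auto
      next
        case False
        then show ?thesis
          using ode_gronwall(2)[of t 0 "\<lambda>t. F t x" f "\<lambda>t. F t x0" "cball 0 R" L] F inD L(2) that F0 by auto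
      qed
      also have "\<dots> \<le> exp (L * T) * norm (x - x0)"
        using L(1) that by (intro mult_right_mono) auto
      finally show ?thesis .
    qed
    have "((\<lambda>q. exp (L * T) * norm (snd q - x0) + B * \<bar>fst q - t0\<bar>) \<longlongrightarrow> exp (L * T) * norm (snd p - x0) + B * \<bar>fst p - t0\<bar>) (at p)"
      by (intro tendsto_intros)
    then have lim: "((\<lambda>q. exp (L * T) * norm (snd q - x0) + B * \<bar>fst q - t0\<bar>) \<longlongrightarrow> 0) (at p)" by (simp add: p)
    have "eventually (\<lambda>q. dist q p < 1) (at p)" by (auto simp: eventually_at intro!: exI[of _ 1])
    then have "\<forall>\<^sub>F q in at p. norm (F (fst q) (snd q) - F t0 x0) \<le> exp (L * T) * norm (snd q - x0) + B * \<bar>fst q - t0\<bar>"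
    proof eventually_elim
      case (elim q)
      have 1: "\<bar>fst q - t0\<bar> < 1" "norm (snd q - x0) < 1"
        using elim dist_fst_le[of q p] dist_snd_le[of q p] by (auto simp: p dist_norm)
      have "norm (snd q) \<le> norm x0 + 1" using 1(2) norm_triangle_sub[of "snd q" x0] by linarith
      then have "norm (F (fst q) (snd q) - F (fst q) x0) \<le> exp (L * T) * norm (snd q - x0)"
        using 1 by (intro close) (auto simp: T_def)
      moreover have "norm (F (fst q) x0 - F t0 x0) \<le> B * \<bar>fst q - t0\<bar>" by (rule speed)
      ultimately show ?case
        using norm_triangle_ineq[of "F (fst q) (snd q) - F (fst q) x0" "F (fst q) x0 - F t0 x0"] by simp
    qed
    then have "((\<lambda>q. F (fst q) (snd q) - F t0 x0) \<longlongrightarrow> 0) (at p)"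
      by (rule Lim_null_comparison) (rule lim)
    then show "isCont (\<lambda>(t, x). F t x) p"
      by (simp add: isCont_def case_prod_unfold LIM_zero_iff p)
  qed
  then show ?thesis unfolding is_flow_def using F0 F group by blast
qed

section \<open>Angles of chords in a foliated plane\<close>

text \<open>A continuous choice \<open>\<theta>\<close> of the angle of the nowhere vanishing function \<open>F\<close> on \<open>S\<close>.\<close>

definition angle_lift :: "'a::real_normed_vector set \<Rightarrow> ('a \<Rightarrow> complex) \<Rightarrow> ('a \<Rightarrow> real) \<Rightarrow> bool" where
  "angle_lift S F \<theta> \<longleftrightarrow> continuous_on S F \<and> continuous_on S \<theta> \<and> (\<forall>s\<in>S. F s \<noteq> 0 \<and> F s = of_real (cmod (F s)) * cis (\<theta> s))"

lemma angle_lift_exists: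
  assumes "continuous_on S F" "contractible S" "\<And>z. z \<in> S \<Longrightarrow> F z \<noteq> 0"
  shows "\<exists>\<theta>. angle_lift S F \<theta>"
proof -
  obtain g where g: "continuous_on S g" "\<And>x. x \<in> S \<Longrightarrow> F x = exp (g x)"
    using continuous_logarithm_on_contractible[OF assms] by blast
  have "F s = of_real (cmod (F s)) * cis (Im (g s))" if "s \<in> S" for s
    using g(2)[OF that] by (simp add: exp_eq_polar norm_mult)
  then have "angle_lift S F (\<lambda>s. Im (g s))"
    unfolding angle_lift_def by (intro conjI ballI assms continuous_on_Im g(1))
  then show ?thesis by blast
qed

lemma angle_lift_compose:
  assumes "angle_lift S F \<theta>" "continuous_on T c" "c ` T \<subseteq> S"
  shows "angle_lift T (\<lambda>t. F (c t)) (\<lambda>t. \<theta> (c t))"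
  using assms unfolding angle_lift_def by (auto intro: continuous_on_compose2)

text \<open>Every interval of length \<open>\<pi>\<close> contains a zero of the cosine. This is how congruences modulo
\<open>2\<pi>\<close> between angles are turned into bounds: two lifts of related angles differ by less than
\<open>\<pi>\<close> from a constant.\<close>

lemma cos_nonzero_osc:
  fixes f :: "'a::topological_space \<Rightarrow> real"
  assumes S: "connected S" and f: "continuous_on S f" and c: "\<And>x. x \<in> S \<Longrightarrow> cos (f x) \<noteq> 0"
    and x: "x \<in> S" and y: "y \<in> S"
  shows "\<bar>f x - f y\<bar> < pi"
proof -
  have *: "f y - f x < pi" if "x \<in> S" "y \<in> S" for x y
  proof (rule ccontr)
    assume "\<not> ?thesis"
    then have le: "f x + pi \<le> f y" by simp
    have "connected (f ` S)" using f S by (rule connected_continuous_image)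
    then have sub: "{f x..f y} \<subseteq> f ` S" using that by (intro connected_contains_Icc) auto
    have cc: "continuous_on {f x..f x + pi} cos" by (intro continuous_intros)
    have "\<exists>t. f x \<le> t \<and> t \<le> f x + pi \<and> cos t = 0"
    proof (cases "cos (f x) \<le> 0")
      case True
      then show ?thesis using IVT'[of cos "f x" 0 "f x + pi"] cc by auto
    next
      case False
      then show ?thesis using IVT2'[of cos "f x + pi" 0 "f x"] cc by auto
    qed
    then obtain t where "f x \<le> t" "t \<le> f x + pi" and "cos t = 0" by blast
    then have "t \<in> f ` S" using sub le by auto
    then show False using c \<open>cos t = 0\<close> by auto
  qed
  show ?thesis using *[OF x y] *[OF y x] by linarith
qed

text \<open>A function with values in an open half plane has an angle of oscillation less than \<open>\<pi>\<close>.\<close>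

lemma half_plane_lift:
  assumes S: "connected S" and F: "angle_lift S F \<theta>" and p: "\<And>s. s \<in> S \<Longrightarrow> Re (F s * cnj w) > 0"
    and x: "x \<in> S" and y: "y \<in> S"
  shows "\<bar>\<theta> x - \<theta> y\<bar> < pi"
proof -
  define a where "a = Arg w"
  have w: "w = of_real (cmod w) * cis a" using rcis_cmod_Arg[of w] by (simp add: a_def rcis_def)
  have "cos (\<theta> s - a) \<noteq> 0" if "s \<in> S" for s
  proof
    assume c: "cos (\<theta> s - a) = 0"
    have Fs: "F s = of_real (cmod (F s)) * cis (\<theta> s)" using F that by (auto simp: angle_lift_def)
    have "F s * cnj w = of_real (cmod (F s)) * cis (\<theta> s) * (of_real (cmod w) * cis (- a))"
      by (subst Fs, subst w) (simp add: cis_cnj)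
    also have "\<dots> = of_real (cmod (F s) * cmod w) * cis (\<theta> s - a)"
      using cis_mult[of "\<theta> s" "- a"] by (simp add: mult_ac)
    finally have "Re (F s * cnj w) = cmod (F s) * cmod w * cos (\<theta> s - a)" by simp
    then show False using p[OF that] c by simp
  qed
  then have "\<bar>(\<theta> x - a) - (\<theta> y - a)\<bar> < pi"
    using F by (intro cos_nonzero_osc[OF S _ _ x y]) (auto simp: angle_lift_def intro!: continuous_intros)
  then show ?thesis by simp
qed

lemma near_Re_pos:
  assumes "cmod (u - w) < cmod w" shows "Re (u * cnj w) > 0"
proof -
  have "Re (u * cnj w) = (cmod w)\<^sup>2 + Re ((u - w) * cnj w)"
    unfolding cmod_power2 by (simp add: power2_eq_square algebra_simps)
  moreover have "\<bar>Re ((u - w) * cnj w)\<bar> \<le> cmod (u - w) * cmod w"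
    using abs_Re_le_cmod[of "(u - w) * cnj w"] by (simp add: norm_mult)
  moreover have "cmod (u - w) * cmod w < cmod w * cmod w"
    using assms norm_ge_zero[of "u - w"] by (intro mult_strict_right_mono) linarith+
  ultimately show ?thesis by (simp add: power2_eq_square)
qed

text \<open>Pairs of points, in coordinates whose vertical lines are the gradient trajectories and whose
heights are the values of the stream function. On each of these sets of pairs the chord
joining the two points does not vanish, and each set is contractible, so the angle of the
chord has a continuous lift there.\<close>

definition upper_pairs :: "(complex \<times> complex) set" where
  "upper_pairs = {p. Im (fst p) < Im (snd p)}"

definition right_pairs :: "(complex \<times> complex) set" where
  "right_pairs = {p. Re (fst p) \<le> Re (snd p) \<and> fst p \<noteq> snd p}"

lemma convex_pair_halfspace:
  fixes l :: "complex \<times> complex \<Rightarrow> real"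
  assumes "linear l"
  shows "convex {p. 0 < l p}" "convex {p. 0 \<le> l p}"
  using convex_linear_vimage[OF assms convex_real_interval(3), of 0] convex_linear_vimage[OF assms convex_real_interval(1), of 0]
  by (auto simp: vimage_def greaterThan_def atLeast_def)

lemma linear_pairs:
  "linear (\<lambda>p::complex \<times> complex. Im (snd p) - Im (fst p))" "linear (\<lambda>p::complex \<times> complex. Re (snd p) - Re (fst p))"
  "linear (\<lambda>p::complex \<times> complex. Im (fst p) - Im (snd p))"
  by (auto intro!: linearI simp: algebra_simps)

lemma convex_upper_pairs: "convex upper_pairs"
  using convex_pair_halfspace(1)[OF linear_pairs(1)] by (simp add: upper_pairs_def)

lemma convex_upper_right: "convex (upper_pairs \<inter> right_pairs)"
proof -
  have eq: "upper_pairs \<inter> right_pairs = {p. 0 < Im (snd p) - Im (fst p)} \<inter> {p. 0 \<le> Re (snd p) - Re (fst p)}"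
    by (auto simp: upper_pairs_def right_pairs_def)
  show ?thesis unfolding eq
    by (intro convex_Int convex_pair_halfspace linear_pairs)
qed

definition lower_right_pairs :: "(complex \<times> complex) set" where
  "lower_right_pairs = {p. Re (fst p) \<le> Re (snd p) \<and> Im (snd p) < Im (fst p)}"

lemma convex_lower_right: "convex lower_right_pairs"
proof -
  have eq: "lower_right_pairs = {p. 0 < Im (fst p) - Im (snd p)} \<inter> {p. 0 \<le> Re (snd p) - Re (fst p)}"
    by (auto simp: lower_right_pairs_def)
  show ?thesis unfolding eq
    by (intro convex_Int convex_pair_halfspace linear_pairs)
qed

text \<open>The set is starlike about the pair \<open>(0, 1)\<close>: moving towards it makes the second point lie
strictly to the right of the first.\<close>

lemma contractible_right_pairs: "contractible right_pairs"
proof (rule starlike_imp_contractible, unfold starlike_def, intro bexI ballI)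
  show "(0, 1) \<in> right_pairs" by (simp add: right_pairs_def)
  fix p assume p: "p \<in> right_pairs"
  show "closed_segment (0, 1) p \<subseteq> right_pairs"
  proof
    fix q assume "q \<in> closed_segment (0, 1) p"
    then obtain u where u: "0 \<le> u" "u \<le> 1" "q = (1 - u) *\<^sub>R (0, 1) + u *\<^sub>R p"
      by (auto simp: closed_segment_def)
    show "q \<in> right_pairs"
    proof (cases "u = 1")
      case True then show ?thesis using u p by (simp add: zero_prod_def[symmetric])
    next
      case False
      have "Re (snd q) - Re (fst q) = (1 - u) + u * (Re (snd p) - Re (fst p))"
        by (simp add: u(3) algebra_simps)
      moreover have "u * (Re (snd p) - Re (fst p)) \<ge> 0" using u p by (auto simp: right_pairs_def)
      ultimately have "Re (fst q) < Re (snd q)" using False u(2) by linarith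
      then show ?thesis by (auto simp: right_pairs_def)
    qed
  qed
qed

text \<open>Global coordinates \<open>H\<close> with inverse \<open>G\<close> of a foliated plane. The height is \<open>M\<close>-Lipschitz and
the vertical lines are \<open>1/m\<close>-Lipschitz in the height, so every vertical line satisfies a
chord-arc inequality.\<close>

locale foliation =
  fixes H G :: "complex \<Rightarrow> complex" and M m :: real
  assumes H_cont: "continuous_on UNIV H" and G_cont: "continuous_on UNIV G"
    and GH [simp]: "G (H z) = z" and HG [simp]: "H (G z) = z"
    and M: "M > 0" and m: "m > 0"
    and level_lip: "\<bar>Im (G z) - Im (G w)\<bar> \<le> M * cmod (z - w)"
    and vert_lip: "Re a = Re b \<Longrightarrow> cmod (H a - H b) \<le> \<bar>Im a - Im b\<bar> / m"
begin

lemma H_inj: "H a = H b \<longleftrightarrow> a = b" by (metis GH)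

lemma H_lower: "\<bar>Im a - Im b\<bar> / M \<le> cmod (H a - H b)"
  using level_lip[of "H a" "H b"] M by (simp add: field_simps)

definition chord :: "complex \<times> complex \<Rightarrow> complex" where "chord p = H (snd p) - H (fst p)"

lemma chord_cont: "continuous_on S chord"
  unfolding chord_def by (intro continuous_intros continuous_on_compose2[OF H_cont]) auto

lemma chord_nz: "fst p \<noteq> snd p \<Longrightarrow> chord p \<noteq> 0" by (simp add: chord_def H_inj)

text \<open>When \<open>t\<close> grows by the factor \<open>1 + m / (2 M)\<close>, the chord moves by less than its length and
its angle changes by less than \<open>\<pi>\<close>. The curve \<open>c\<close> covers both chords that start and chords
that end at a fixed point.\<close>

lemma vertical_growth:
  assumes \<Theta>: "angle_lift upper_pairs chord \<Theta>"
    and c: "continuous_on {0<..} c" "\<And>t. t > 0 \<Longrightarrow> c t \<in> upper_pairs"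
    and lip: "\<And>t s. t > 0 \<Longrightarrow> s > 0 \<Longrightarrow> cmod (chord (c t) - chord (c s)) \<le> \<bar>t - s\<bar> / m"
    and low: "\<And>t. t > 0 \<Longrightarrow> t / M \<le> cmod (chord (c t))"
    and t0: "t0 > 0"
  shows "t0 \<le> t \<Longrightarrow> t \<le> (1 + m / (2 * M)) ^ n * t0 \<Longrightarrow> \<bar>\<Theta> (c t) - \<Theta> (c t0)\<bar> \<le> real n * pi"
proof (induction n arbitrary: t)
  case 0
  then show ?case by simp
next
  case (Suc n)
  define k where "k = 1 + m / (2 * M)"
  have k: "k > 1" using M m by (simp add: k_def)
  have step: "\<bar>\<Theta> (c t) - \<Theta> (c s)\<bar> < pi" if s: "s > 0" "s \<le> t" "t \<le> k * s" for s t
  proof (rule half_plane_lift[of "{s..t}" "\<lambda>t. chord (c t)" "\<lambda>t. \<Theta> (c t)" "chord (c s)" t s])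
    show "angle_lift {s..t} (\<lambda>t. chord (c t)) (\<lambda>t. \<Theta> (c t))"
      by (rule angle_lift_compose[OF \<Theta>]) (use s c in \<open>auto intro: continuous_on_subset\<close>)
    fix r assume r: "r \<in> {s..t}"
    have "cmod (chord (c r) - chord (c s)) \<le> (r - s) / m" using lip[of r s] r s by simp
    also have "r - s \<le> m / (2 * M) * s" using r s by (simp add: k_def algebra_simps)
    also have "m / (2 * M) * s / m < s / M" using m M s by (simp add: field_simps)
    also have "\<dots> \<le> cmod (chord (c s))" using low s by simp
    finally show "Re (chord (c r) * cnj (chord (c s))) > 0"
      using m by (intro near_Re_pos) (simp add: divide_right_mono)
  qed (use s in auto)
  show ?case
  proof (cases "t \<le> k ^ n * t0")
    case True
    then have "\<bar>\<Theta> (c t) - \<Theta> (c t0)\<bar> \<le> real n * pi" using Suc unfolding k_def by blast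
    then show ?thesis by (simp add: algebra_simps) (use pi_gt_zero in linarith)
  next
    case False
    define s where "s = k ^ n * t0"
    have s: "t0 \<le> s" "s > 0" using k t0 by (auto simp: s_def one_le_power)
    have "\<bar>\<Theta> (c s) - \<Theta> (c t0)\<bar> \<le> real n * pi" using Suc.IH[of s] s unfolding k_def s_def by simp
    moreover have "\<bar>\<Theta> (c t) - \<Theta> (c s)\<bar> < pi"
      using Suc.prems(2) False s by (intro step) (auto simp: s_def k_def mult.assoc)
    ultimately show ?thesis by (simp add: algebra_simps)
  qed
qed

text \<open>The circle about \<open>H a\<close> through \<open>H w\<close> meets the vertical line through \<open>a\<close>, since this line
runs from \<open>H a\<close> to infinity. Up to the first meeting point the rotating point stays on the
right of the line, where \<open>L\<close> is defined, and \<open>L\<close> changes exactly by the angle of rotation.\<close>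

lemma rotation_hits_line:
  assumes L: "angle_lift right_pairs chord L" and ab: "Re a \<le> Re w" "a \<noteq> w"
  obtains q where "Re q = Re a" "cmod (H q - H a) = cmod (H w - H a)" "\<bar>L (a, q) - L (a, w)\<bar> \<le> 3 * pi"
proof -
  define z where "z = H w - H a"
  define r where "r = cmod z"
  have z: "z \<noteq> 0" using ab by (simp add: z_def H_inj)
  have r: "r > 0" using z by (simp add: r_def)
  define W where "W \<beta> = H a + z * cis \<beta>" for \<beta>
  have Wc: "continuous_on S W" for S unfolding W_def by (intro continuous_intros)
  define h where "h \<beta> = Re (G (W \<beta>)) - Re a" for \<beta>
  have hc: "continuous_on S h" for S
    unfolding h_def by (intro continuous_intros continuous_on_compose2[OF G_cont Wc]) auto
  have h0: "h 0 \<ge> 0" using ab by (simp add: h_def W_def z_def)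
  define J where "J = {\<beta> \<in> {0..2*pi}. h \<beta> \<le> 0}"
  have Jc: "compact J"
  proof -
    have "closed ({0..2*pi} \<inter> h -` {..0})"
      by (rule continuous_closed_preimage[OF hc]) auto
    moreover have "{0..2*pi} \<inter> h -` {..0} = J" by (auto simp: J_def)
    ultimately have "closed J" by simp
    moreover have "bounded J" by (rule bounded_subset[of "{0..2*pi}"]) (auto simp: J_def)
    ultimately show ?thesis by (simp add: compact_eq_bounded_closed)
  qed
  have "J \<noteq> {}"
  proof -
    define g where "g t = cmod (H (a + \<i> * of_real t) - H a)" for t
    have "continuous_on {0..M*r} g"
      unfolding g_def by (intro continuous_intros continuous_on_compose2[OF H_cont]) auto
    moreover have "g 0 \<le> r" using r by (simp add: g_def)
    moreover have "r \<le> g (M * r)" using H_lower[of "a + \<i> * of_real (M*r)" a] M r by (simp add: g_def)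
    moreover have "0 \<le> M * r" using M r by simp
    ultimately obtain t where t: "g t = r" using IVT'[of g 0 r "M*r"] by auto
    define q where "q = a + \<i> * of_real t"
    define \<beta> where "\<beta> = Arg2pi ((H q - H a) / z)"
    have "cmod ((H q - H a) / z) = 1" using t r by (simp add: norm_divide g_def q_def r_def)
    then have "(H q - H a) / z = cis \<beta>"
      using Arg2pi_eq[of "(H q - H a) / z"] by (simp add: \<beta>_def cis_conv_exp)
    then have "W \<beta> = H q" using z by (simp add: W_def field_simps)
    then have "h \<beta> = 0" by (simp add: h_def q_def)
    moreover have "\<beta> \<in> {0..2*pi}" using Arg2pi_ge_0 Arg2pi_lt_2pi by (auto simp: \<beta>_def less_imp_le)
    ultimately show ?thesis by (auto simp: J_def)
  qed
  then obtain \<beta> where \<beta>: "\<beta> \<in> J" "\<And>x. x \<in> J \<Longrightarrow> \<beta> \<le> x"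
    using compact_attains_inf[OF Jc] by blast
  have b: "0 \<le> \<beta>" "\<beta> \<le> 2 * pi" "h \<beta> \<le> 0" using \<beta>(1) by (auto simp: J_def)
  have h_pos: "h x > 0" if "0 \<le> x" "x < \<beta>" for x
    using \<beta>(2)[of x] that b by (force simp: J_def)
  have hb: "h \<beta> = 0"
  proof -
    obtain x where "0 \<le> x" "x \<le> \<beta>" "h x = 0" using IVT2'[of h \<beta> 0 0] h0 b hc by auto
    then show ?thesis using h_pos[of x] by (cases "x = \<beta>") auto
  qed
  have h_nn: "h x \<ge> 0" if "x \<in> {0..\<beta>}" for x using h_pos[of x] hb that by (cases "x = \<beta>") auto
  have Wne: "W x \<noteq> H a" for x using z by (simp add: W_def)
  have Wr: "(a, G (W x)) \<in> right_pairs" if "x \<in> {0..\<beta>}" for x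
    using h_nn[OF that] Wne[of x] by (auto simp: right_pairs_def h_def dest: arg_cong[of _ _ H])
  have lift: "angle_lift {0..\<beta>} (\<lambda>x. chord (a, G (W x))) (\<lambda>x. L (a, G (W x)))"
    by (rule angle_lift_compose[OF L]) (use Wr in \<open>auto intro!: continuous_intros continuous_on_compose2[OF G_cont Wc]\<close>)
  have Lx: "cos (L (a, G (W x)) - x - L (a, w)) = 1" if x: "x \<in> {0..\<beta>}" for x
  proof -
    have 1: "z * cis x = of_real r * cis (L (a, G (W x)))"
      using lift x by (auto simp: angle_lift_def chord_def W_def r_def norm_mult)
    have "(a, w) \<in> right_pairs" using ab by (simp add: right_pairs_def)
    then have 2: "z = of_real r * cis (L (a, w))"
      using L by (force simp: angle_lift_def chord_def z_def r_def)
    have "of_real r * (cis (L (a, w)) * cis x) = of_real r * cis (L (a, G (W x)))" using 1 2 by (metis mult.assoc)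
    then have "cis (L (a, w) + x) = cis (L (a, G (W x)))" using r by (simp add: cis_mult)
    then have "cis (L (a, G (W x)) - x - L (a, w)) = cis 0"
      by (metis cis_divide cis_zero cis_neq_zero diff_diff_eq add.commute divide_self)
    then show ?thesis by (metis cis.simps(1) cos_zero)
  qed
  have "\<bar>(L (a, G (W \<beta>)) - \<beta> - L (a, w)) - (L (a, G (W 0)) - 0 - L (a, w))\<bar> < pi"
  proof (rule cos_nonzero_osc[of "{0..\<beta>}" "\<lambda>x. L (a, G (W x)) - x - L (a, w)"])
    show "continuous_on {0..\<beta>} (\<lambda>x. L (a, G (W x)) - x - L (a, w))"
      using lift unfolding angle_lift_def by (intro continuous_intros) auto
  qed (use b Lx in auto)
  moreover have "G (W 0) = w" by (simp add: W_def z_def)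
  ultimately have "\<bar>L (a, G (W \<beta>)) - L (a, w)\<bar> \<le> 3 * pi" using b by auto
  moreover have "Re (G (W \<beta>)) = Re a" using hb by (simp add: h_def)
  moreover have "cmod (H (G (W \<beta>)) - H a) = cmod (H w - H a)" by (simp add: W_def norm_mult z_def)
  ultimately show ?thesis using that by blast
qed

text \<open>Here \<open>\<phi>\<close> is, up to a bounded error, the angle of the vertical chords of height \<open>t0\<close> above
and below the points of \<open>S\<close>. Going up from \<open>b\<close> by a height comparable to the distance \<open>d\<close>,
replacing the foot \<open>b\<close> of the chord by \<open>a\<close> along a segment, rotating the chord about \<open>a\<close>
until it is vertical, and shrinking it again, changes the angle by at most \<open>2 \<pi> n\<close> plus a
constant, where \<open>n\<close> is logarithmic in \<open>d\<close>.\<close>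

theorem angle_growth:
  fixes \<phi> :: "complex \<Rightarrow> real"
  assumes \<phi>: "continuous_on UNIV \<phi>" and t0: "t0 > 0"
    and up: "\<And>z. z \<in> S \<Longrightarrow> Re ((H (z + \<i> * of_real t0) - H z) * cis (- \<phi> (H z))) > 0"
    and dn: "\<And>z. z \<in> S \<Longrightarrow> Re ((H z - H (z - \<i> * of_real t0)) * cis (- \<phi> (H z))) > 0"
    and S: "connected S"
  shows "\<exists>C K. K > 0 \<and> (\<forall>a\<in>S. \<forall>b\<in>S. \<forall>n d. cmod (H a - H b) \<le> d \<longrightarrow> K * (d + 1) \<le> (1 + m / (2 * M)) ^ n
     \<longrightarrow> \<bar>\<phi> (H a) - \<phi> (H b)\<bar> \<le> C + 2 * pi * real n)"
proof (cases "S = {}")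
  case True
  then show ?thesis by (intro exI[of _ 0] exI[of _ 1]) auto
next
  case False
  then obtain z0 where z0: "z0 \<in> S" by blast
  have "\<exists>\<Theta>. angle_lift upper_pairs chord \<Theta>"
    by (rule angle_lift_exists[OF chord_cont convex_imp_contractible[OF convex_upper_pairs]], rule chord_nz)
      (auto simp: upper_pairs_def)
  then obtain \<Theta> where \<Theta>: "angle_lift upper_pairs chord \<Theta>" ..
  have "\<exists>L. angle_lift right_pairs chord L"
    by (rule angle_lift_exists[OF chord_cont contractible_right_pairs], rule chord_nz)
      (auto simp: right_pairs_def)
  then obtain L where L: "angle_lift right_pairs chord L" ..
  (* On pairs that are both upper and right the two lifts differ by a multiple of \<open>2\<pi>\<close>; on
     lower right pairs the chord is traversed backwards and they differ by an odd multiple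
     of \<open>\<pi>\<close>. Both differences are continuous on a convex set. *)
  define K2 where "K2 = \<bar>\<Theta> (0, Complex 1 1) - L (0, Complex 1 1)\<bar> + pi"
  have K2: "\<bar>\<Theta> p - L p\<bar> \<le> K2" if p: "p \<in> upper_pairs \<inter> right_pairs" for p
  proof -
    have "\<bar>(\<Theta> p - L p) - (\<Theta> (0, Complex 1 1) - L (0, Complex 1 1))\<bar> < pi"
    proof (rule cos_nonzero_osc[of "upper_pairs \<inter> right_pairs" "\<lambda>p. \<Theta> p - L p"])
      show "continuous_on (upper_pairs \<inter> right_pairs) (\<lambda>p. \<Theta> p - L p)"
        using \<Theta> L unfolding angle_lift_def by (intro continuous_intros) (auto intro: continuous_on_subset)
      fix q assume q: "q \<in> upper_pairs \<inter> right_pairs"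
      have "of_real (cmod (chord q)) * cis (\<Theta> q) = of_real (cmod (chord q)) * cis (L q)" "chord q \<noteq> 0"
        using \<Theta> L q unfolding angle_lift_def by auto
      then have "cis (\<Theta> q) = cis (L q)" by simp
      then have "cis (\<Theta> q - L q) = 1" by (metis cis_divide cis_neq_zero divide_self)
      then show "cos (\<Theta> q - L q) \<noteq> 0" by (metis cis.simps(1) one_complex.simps(1) zero_neq_one)
    qed (use p convex_upper_right convex_connected in \<open>auto simp: upper_pairs_def right_pairs_def complex_eq_iff\<close>)
    then show ?thesis unfolding K2_def by linarith
  qed
  define K3 where "K3 = \<bar>\<Theta> (Complex 1 (-1), 0) - L (0, Complex 1 (-1))\<bar> + pi"
  have K3: "\<bar>\<Theta> (snd p, fst p) - L p\<bar> \<le> K3" if p: "p \<in> lower_right_pairs" for p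
  proof -
    have sub: "q \<in> right_pairs" "(snd q, fst q) \<in> upper_pairs" if "q \<in> lower_right_pairs" for q
      using that by (auto simp: lower_right_pairs_def right_pairs_def upper_pairs_def)
    define f where "f p = \<Theta> (snd p, fst p) - L p" for p
    have "\<bar>f p - f (0, Complex 1 (-1))\<bar> < pi"
    proof (rule cos_nonzero_osc[of lower_right_pairs f])
      have "angle_lift lower_right_pairs (\<lambda>q. chord (snd q, fst q)) (\<lambda>q. \<Theta> (snd q, fst q))"
        by (rule angle_lift_compose[OF \<Theta>]) (use sub in \<open>auto intro!: continuous_intros\<close>)
      moreover have "angle_lift lower_right_pairs (\<lambda>q. chord q) (\<lambda>q. L q)"
        by (rule angle_lift_compose[OF L]) (use sub in \<open>auto intro!: continuous_intros\<close>)
      ultimately show "continuous_on lower_right_pairs f"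
        unfolding angle_lift_def f_def by (intro continuous_intros) auto
      fix q assume q: "q \<in> lower_right_pairs"
      have ch: "chord (snd q, fst q) = - chord q" by (simp add: chord_def)
      have "- chord q = of_real (cmod (chord q)) * cis (\<Theta> (snd q, fst q))"
        using \<Theta> sub(2)[OF q] unfolding angle_lift_def ch[symmetric] by (metis ch norm_minus_cancel)
      moreover have "chord q = of_real (cmod (chord q)) * cis (L q)" "chord q \<noteq> 0"
        using L sub(1)[OF q] unfolding angle_lift_def by auto
      ultimately have "of_real (cmod (chord q)) * cis (\<Theta> (snd q, fst q)) = of_real (cmod (chord q)) * (- cis (L q))"
        by (metis mult_minus_right)
      then have "cis (\<Theta> (snd q, fst q)) = - cis (L q)"
        using \<open>chord q \<noteq> 0\<close> by (metis mult_left_cancel norm_eq_zero of_real_eq_0_iff)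
      then have "cis (\<Theta> (snd q, fst q) - L q) = -1" by (simp add: cis_divide[symmetric])
      then have "Re (cis (f q)) = -1" by (simp add: f_def)
      then show "cos (f q) \<noteq> 0" by simp
    qed (use p convex_lower_right convex_connected in \<open>auto simp: lower_right_pairs_def\<close>)
    then show ?thesis unfolding K3_def f_def by simp
  qed
  have base: "\<exists>K. \<forall>z\<in>S. \<bar>\<Theta> (c z) - \<phi> (H z)\<bar> \<le> K"
    if c: "continuous_on S c" "c ` S \<subseteq> upper_pairs" and pos: "\<And>z. z \<in> S \<Longrightarrow> Re (chord (c z) * cis (- \<phi> (H z))) > 0" for c
  proof -
    have lift: "angle_lift S (\<lambda>z. chord (c z)) (\<lambda>z. \<Theta> (c z))" by (rule angle_lift_compose[OF \<Theta> c])
    have "\<bar>(\<Theta> (c z) - \<phi> (H z)) - (\<Theta> (c z0) - \<phi> (H z0))\<bar> < pi" if "z \<in> S" for z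
    proof (rule cos_nonzero_osc[of S "\<lambda>z. \<Theta> (c z) - \<phi> (H z)", OF S _ _ that z0])
      show "continuous_on S (\<lambda>z. \<Theta> (c z) - \<phi> (H z))"
        using lift continuous_on_compose2[OF \<phi> H_cont] unfolding angle_lift_def
        by (intro continuous_intros) (auto intro: continuous_on_subset)
      fix y assume y: "y \<in> S"
      have cy: "chord (c y) = of_real (cmod (chord (c y))) * cis (\<Theta> (c y))" using lift y by (auto simp: angle_lift_def)
      have "chord (c y) * cis (- \<phi> (H y)) = of_real (cmod (chord (c y))) * cis (\<Theta> (c y) - \<phi> (H y))"
        by (subst cy) (simp add: cis_mult mult.assoc)
      then have "Re (chord (c y) * cis (- \<phi> (H y))) = cmod (chord (c y)) * cos (\<Theta> (c y) - \<phi> (H y))" by simp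
      then show "cos (\<Theta> (c y) - \<phi> (H y)) \<noteq> 0" using pos[OF y] by auto
    qed
    then have "\<forall>z\<in>S. \<bar>\<Theta> (c z) - \<phi> (H z)\<bar> \<le> \<bar>\<Theta> (c z0) - \<phi> (H z0)\<bar> + pi"
      by (smt (verit))
    then show ?thesis by blast
  qed
  have "\<exists>K. \<forall>z\<in>S. \<bar>\<Theta> (z, z + \<i> * of_real t0) - \<phi> (H z)\<bar> \<le> K"
    by (rule base[of "\<lambda>z. (z, z + \<i> * of_real t0)"])
      (use up t0 in \<open>auto intro!: continuous_intros simp: upper_pairs_def chord_def\<close>)
  then obtain K1 where K1: "\<And>z. z \<in> S \<Longrightarrow> \<bar>\<Theta> (z, z + \<i> * of_real t0) - \<phi> (H z)\<bar> \<le> K1" by blast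
  have "\<exists>K. \<forall>z\<in>S. \<bar>\<Theta> (z - \<i> * of_real t0, z) - \<phi> (H z)\<bar> \<le> K"
    by (rule base[of "\<lambda>z. (z - \<i> * of_real t0, z)"])
      (use dn t0 in \<open>auto intro!: continuous_intros simp: upper_pairs_def chord_def\<close>)
  then obtain K1' where K1': "\<And>z. z \<in> S \<Longrightarrow> \<bar>\<Theta> (z - \<i> * of_real t0, z) - \<phi> (H z)\<bar> \<le> K1'" by blast
  define lam where "lam = 1 + m / (2 * M)"
  have grow_up: "\<bar>\<Theta> (z, z + \<i> * of_real t) - \<Theta> (z, z + \<i> * of_real t0)\<bar> \<le> real n * pi"
    if "t0 \<le> t" "t \<le> lam ^ n * t0" for z t n
  proof (rule vertical_growth[OF \<Theta> _ _ _ _ t0 that(1) that(2)[unfolded lam_def], where c="\<lambda>t. (z, z + \<i> * of_real t)"])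
    show "cmod (chord (z, z + \<i> * complex_of_real t) - chord (z, z + \<i> * complex_of_real s)) \<le> \<bar>t - s\<bar> / m" for t s
      using vert_lip[of "z + \<i> * complex_of_real t" "z + \<i> * complex_of_real s"] by (simp add: chord_def)
    show "t / M \<le> cmod (chord (z, z + \<i> * complex_of_real t))" if "t > 0" for t
      using H_lower[of "z + \<i> * complex_of_real t" z] that by (simp add: chord_def)
  qed (auto intro!: continuous_intros simp: upper_pairs_def)
  have grow_dn: "\<bar>\<Theta> (z - \<i> * of_real t, z) - \<Theta> (z - \<i> * of_real t0, z)\<bar> \<le> real n * pi"
    if "t0 \<le> t" "t \<le> lam ^ n * t0" for z t n
  proof (rule vertical_growth[OF \<Theta> _ _ _ _ t0 that(1) that(2)[unfolded lam_def], where c="\<lambda>t. (z - \<i> * of_real t, z)"])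
    show "cmod (chord (z - \<i> * complex_of_real t, z) - chord (z - \<i> * complex_of_real s, z)) \<le> \<bar>t - s\<bar> / m" for t s
      using vert_lip[of "z - \<i> * complex_of_real s" "z - \<i> * complex_of_real t"] by (simp add: chord_def)
    show "t / M \<le> cmod (chord (z - \<i> * complex_of_real t, z))" if "t > 0" for t
      using H_lower[of z "z - \<i> * complex_of_real t"] that by (simp add: chord_def)
  qed (auto intro!: continuous_intros simp: upper_pairs_def)
  (* The height \<open>T d\<close> is large enough that a chord of this height is longer than \<open>d\<close> and
     that the vertical chord found by the rotation has height at least \<open>t0\<close>; \<open>K\<close> makes all
     heights that occur at most \<open>lam ^ n * t0\<close>. *)
  define T where "T d = M * d + M * t0 / m + t0" for d
  define K where "K = (M + M * t0 / m + t0 + M * (M + M * t0 / m + t0) / m + M) / t0"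
  have Kp: "K > 0" using M m t0 by (auto simp: K_def intro!: divide_pos_pos add_pos_pos mult_pos_pos)
  have KT: "T d \<le> lam ^ n * t0" "M * (T d / m + d) \<le> lam ^ n * t0" if d: "d \<ge> 0" "K * (d + 1) \<le> lam ^ n" for d n
  proof -
    define A where "A = M + M * t0 / m + t0"
    have A: "A > 0" using M m t0 by (auto simp: A_def intro!: add_pos_pos)
    have "T d \<le> A * (d + 1)"
    proof -
      define q where "q = M * t0 / m"
      have "q \<ge> 0" using M m t0 by (simp add: q_def)
      then have "0 \<le> q * d" "0 \<le> t0 * d" using d t0 by auto
      moreover have "A * (d + 1) = M * d + q * d + t0 * d + M + q + t0"
        by (simp add: A_def flip: q_def) (simp add: algebra_simps)
      moreover have "T d = M * d + q + t0" by (simp add: T_def q_def)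
      ultimately show ?thesis using M by linarith
    qed
    have K: "K * t0 = A + M * A / m + M" using t0 by (simp add: K_def A_def)
    have "(A + M * A / m + M) * (d + 1) = K * (d + 1) * t0" unfolding K[symmetric] by simp
    also have "\<dots> \<le> lam ^ n * t0" using d t0 by (intro mult_right_mono) auto
    finally have *: "A * (d + 1) + M * (A * (d + 1)) / m + M * (d + 1) \<le> lam ^ n * t0" by (simp add: algebra_simps)
    have p: "0 \<le> M * (A * (d + 1)) / m" "0 \<le> M * (d + 1)" "0 \<le> A * (d+1)" using A M m d by auto
    show "T d \<le> lam ^ n * t0" using \<open>T d \<le> A * (d + 1)\<close> * p by linarith
    have "M * (T d / m) \<le> M * (A * (d + 1)) / m"
      using \<open>T d \<le> A * (d + 1)\<close> M m by (simp add: divide_right_mono mult_left_mono)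
    moreover have "M * d \<le> M * (d + 1)" using M by simp
    ultimately show "M * (T d / m + d) \<le> lam ^ n * t0" using * p by (simp only: distrib_left)
  qed
  have main: "\<bar>\<phi> (H a) - \<phi> (H b)\<bar> \<le> 2 * \<bar>K1\<bar> + \<bar>K1'\<bar> + 4 * pi + 2 * K2 + K3 + 2 * pi * real n"
    if a: "a \<in> S" and b: "b \<in> S" and d: "cmod (H a - H b) \<le> d" and K: "K * (d + 1) \<le> lam ^ n" and ab: "Re a \<le> Re b" for a b n d
  proof -
    have d0: "d \<ge> 0" using d norm_ge_zero order_trans by blast
    note KT = KT[OF d0 K]
    have T0: "T d > M * d" "T d \<ge> t0" "T d > 0" using M m t0 d0 by (auto simp: T_def intro: add_nonneg_pos)
    define w where "w = b + \<i> * of_real (T d)"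
    have w: "Re w = Re b" "Im w = Im b + T d" by (auto simp: w_def)
    have wb: "T d / M \<le> cmod (H w - H b)" "cmod (H w - H b) \<le> T d / m"
      using H_lower[of w b] vert_lip[of w b] w T0 by auto
    have dT: "d < T d / M" using T0(1) M by (simp add: field_simps)
    have 1: "\<bar>\<Theta> (b, w) - \<phi> (H b)\<bar> \<le> K1 + real n * pi"
      using K1[OF b] grow_up[OF T0(2) KT(1), of b] unfolding w_def by linarith
    define c where "c \<beta> = (G (H b + of_real \<beta> * (H a - H b)), w)" for \<beta> :: real
    have 2: "\<bar>\<Theta> (c 1) - \<Theta> (c 0)\<bar> < pi"
    proof (rule half_plane_lift[of "{0..1}" "\<lambda>\<beta>. chord (c \<beta>)" "\<lambda>\<beta>. \<Theta> (c \<beta>)" "chord (c 0)"])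
      have dist: "cmod (of_real \<beta> * (H a - H b)) \<le> d" if "\<beta> \<in> {0..1}" for \<beta> :: real
      proof -
        have "cmod (of_real \<beta> * (H a - H b)) = \<beta> * cmod (H a - H b)" using that by (simp add: norm_mult)
        also have "\<dots> \<le> 1 * d" using that d by (intro mult_mono) auto
        finally show ?thesis by simp
      qed
      show "angle_lift {0..1} (\<lambda>\<beta>. chord (c \<beta>)) (\<lambda>\<beta>. \<Theta> (c \<beta>))"
      proof (rule angle_lift_compose[OF \<Theta>])
        show "continuous_on {0..1} c"
          unfolding c_def by (intro continuous_intros continuous_on_compose2[OF G_cont]) auto
        show "c ` {0..1} \<subseteq> upper_pairs"
        proof (rule image_subsetI)
          fix \<beta> :: real assume "\<beta> \<in> {0..1}"
          then have "M * cmod (H b + of_real \<beta> * (H a - H b) - H b) \<le> M * d" using dist M by simp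
          then have "Im (G (H b + of_real \<beta> * (H a - H b))) < Im w"
            using level_lip[of "H b + of_real \<beta> * (H a - H b)" "H b"] T0 w by simp
          then show "c \<beta> \<in> upper_pairs" by (simp add: c_def upper_pairs_def)
        qed
      qed
      fix \<beta> :: real assume "\<beta> \<in> {0..1}"
      then have "cmod (chord (c \<beta>) - chord (c 0)) \<le> d" using dist[of \<beta>] by (simp add: chord_def c_def norm_minus_commute norm_mult)
      also have "\<dots> < cmod (chord (c 0))" using wb dT by (simp add: chord_def c_def)
      finally show "Re (chord (c \<beta>) * cnj (chord (c 0))) > 0" by (rule near_Re_pos)
    qed auto
    have c: "c 1 = (a, w)" "c 0 = (b, w)" by (simp_all add: c_def)
    have aw: "Im a < Im w"
      using level_lip[of "H a" "H b", simplified] mult_left_mono[OF d less_imp_le[OF M]] T0 w by linarith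
    have awne: "a \<noteq> w" using aw by auto
    have 3: "\<bar>\<Theta> (a, w) - L (a, w)\<bar> \<le> K2" using aw ab w by (intro K2) (auto simp: upper_pairs_def right_pairs_def)
    have "Re a \<le> Re w" using ab w by simp
    then obtain q where q: "Re q = Re a" "cmod (H q - H a) = cmod (H w - H a)" "\<bar>L (a, q) - L (a, w)\<bar> \<le> 3 * pi"
      using rotation_hits_line[OF L _ awne] by blast
    have r1: "cmod (H w - H a) \<ge> T d / M - d" "cmod (H w - H a) \<le> T d / m + d"
      using wb d norm_triangle_ineq2[of "H w - H b" "H a - H b"] norm_triangle_ineq4[of "H w - H b" "H a - H b"] by auto
    define t where "t = \<bar>Im q - Im a\<bar>"
    have qa: "t / M \<le> cmod (H w - H a)" "cmod (H w - H a) \<le> t / m"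
      using H_lower[of q a] vert_lip[of q a] q by (auto simp: t_def)
    have tl: "t0 \<le> t"
    proof -
      have "t0 / m \<le> T d / M - d" using M m t0 by (simp add: T_def field_simps)
      then have "t0 / m \<le> t / m" using r1 qa by linarith
      then show ?thesis using m by (simp add: divide_le_cancel)
    qed
    have tu: "t \<le> lam ^ n * t0"
    proof -
      have "t \<le> M * cmod (H w - H a)" using qa(1) M by (simp add: field_simps)
      also have "\<dots> \<le> M * (T d / m + d)" using r1 M by (intro mult_left_mono) auto
      finally show ?thesis using KT(2) by linarith
    qed
    have 4: "\<bar>L (a, q) - \<phi> (H a)\<bar> \<le> \<bar>K1\<bar> + \<bar>K1'\<bar> + K2 + K3 + real n * pi"
    proof (cases "Im q > Im a")
      case True
      then have qe: "q = a + \<i> * of_real t" using q by (simp add: t_def complex_eq_iff)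
      have "\<bar>\<Theta> (a, q) - L (a, q)\<bar> \<le> K2" using True q by (intro K2) (auto simp: upper_pairs_def right_pairs_def)
      moreover have "\<bar>\<Theta> (a, q) - \<phi> (H a)\<bar> \<le> K1 + real n * pi"
        using K1[OF a] grow_up[OF tl tu, of a] unfolding qe by linarith
      moreover have "K3 \<ge> 0" by (simp add: K3_def)
      ultimately show ?thesis by linarith
    next
      case False
      then have qe: "q = a - \<i> * of_real t" using q by (simp add: t_def complex_eq_iff)
      have "Im q < Im a" using qe tl t0 by simp
      then have "\<bar>\<Theta> (q, a) - L (a, q)\<bar> \<le> K3" using K3[of "(a, q)"] q by (simp add: lower_right_pairs_def)
      moreover have "\<bar>\<Theta> (q, a) - \<phi> (H a)\<bar> \<le> K1' + real n * pi"
        using K1'[OF a] grow_dn[OF tl tu, of a] unfolding qe by linarith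
      moreover have "K2 \<ge> 0" by (simp add: K2_def)
      ultimately show ?thesis by linarith
    qed
    have "2 * pi * real n = 2 * (real n * pi)" by simp
    then show ?thesis using 1 2[unfolded c] 3 q(3) 4 by linarith
  qed
  show ?thesis
  proof (intro exI conjI ballI allI impI)
    show "K > 0" by (rule Kp)
    fix a b n d assume h: "a \<in> S" "b \<in> S" "cmod (H a - H b) \<le> d" "K * (d + 1) \<le> (1 + m / (2 * M)) ^ n"
    show "\<bar>\<phi> (H a) - \<phi> (H b)\<bar> \<le> (2 * \<bar>K1\<bar> + \<bar>K1'\<bar> + 4 * pi + 2 * K2 + K3) + 2 * pi * real n"
    proof (cases "Re a \<le> Re b")
      case True
      then show ?thesis using main[of a b d n] h by (simp add: lam_def)
    next
      case False
      then show ?thesis using main[of b a d n] h by (simp add: lam_def norm_minus_commute abs_minus_commute)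
    qed
  qed
qed

end

section \<open>Flow coordinates of a stream function\<close>

lemma segment_bound:
  assumes f: "C1_grad f g" and b: "\<And>z. z \<in> closed_segment x y \<Longrightarrow> cmod (g z) \<le> L"
  shows "\<bar>f x - f y\<bar> \<le> L * cmod (x - y)"
proof -
  have "norm (f x - f y) \<le> L * norm (x - y)"
  proof (rule differentiable_bound[of "closed_segment x y" f "\<lambda>z h. g z \<bullet> h"])
    fix z assume z: "z \<in> closed_segment x y"
    show "(f has_derivative (\<lambda>h. g z \<bullet> h)) (at z within closed_segment x y)"
      by (rule has_derivative_at_withinI[OF C1_gradD(2)[OF f]])
    show "onorm (\<lambda>h. g z \<bullet> h) \<le> L"
    proof (rule onorm_le)
      fix h
      have "norm (g z \<bullet> h) \<le> cmod (g z) * cmod h" using Cauchy_Schwarz_ineq2[of "g z" h] by simp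
      also have "\<dots> \<le> L * cmod h" by (intro mult_right_mono b z) auto
      finally show "norm (g z \<bullet> h) \<le> L * norm h" .
    qed
  qed auto
  then show ?thesis by simp
qed

lemma C1_loc_bound:
  assumes f: "C1_grad f g"
  shows "\<exists>L>0. \<forall>x\<in>cball 0 R. \<forall>y\<in>cball 0 R. \<bar>f x - f y\<bar> \<le> L * cmod (x - y)"
proof -
  have "compact (g ` cball 0 R)"
    by (rule compact_continuous_image[OF continuous_on_subset[OF C1_gradD(1)[OF f]]]) auto
  then obtain L where L: "L > 0" "\<And>z. z \<in> cball 0 R \<Longrightarrow> cmod (g z) \<le> L"
    using compact_imp_bounded[of "g ` cball 0 R"] unfolding bounded_pos by auto
  have "\<bar>f x - f y\<bar> \<le> L * cmod (x - y)" if "x \<in> cball 0 R" "y \<in> cball 0 R" for x y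
    using closed_segment_subset[OF that convex_cball] by (intro segment_bound[OF f] L) auto
  then show ?thesis using L(1) by blast
qed

lemma C1_loc_lip:
  assumes a: "C1_grad (\<lambda>z. Re (f z)) A" and b: "C1_grad (\<lambda>z. Im (f z)) B"
  shows "loc_lip f"
  unfolding loc_lip_def
proof
  fix R
  obtain L1 where L1: "L1 > 0" "\<And>x y. x \<in> cball 0 R \<Longrightarrow> y \<in> cball 0 R \<Longrightarrow> \<bar>Re (f x) - Re (f y)\<bar> \<le> L1 * cmod (x - y)"
    using C1_loc_bound[OF a] by blast
  obtain L2 where L2: "L2 > 0" "\<And>x y. x \<in> cball 0 R \<Longrightarrow> y \<in> cball 0 R \<Longrightarrow> \<bar>Im (f x) - Im (f y)\<bar> \<le> L2 * cmod (x - y)"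
    using C1_loc_bound[OF b] by blast
  have "norm (f x - f y) \<le> (L1 + L2) * norm (x - y)" if "x \<in> cball 0 R" "y \<in> cball 0 R" for x y
    using cmod_le[of "f x - f y"] L1(2)[OF that] L2(2)[OF that] by (simp add: distrib_right)
  then show "\<exists>L>0. \<forall>x\<in>cball 0 R. \<forall>y\<in>cball 0 R. norm (f x - f y) \<le> L * norm (x - y)"
    using L1(1) L2(1) by (intro exI[of _ "L1 + L2"]) auto
qed

locale stream =
  fixes u :: "complex \<Rightarrow> real" and gu :: "complex \<Rightarrow> complex" and M m :: real
  assumes u: "C1_grad u gu" and gu_lip: "loc_lip gu" and m: "m > 0"
    and gu_lower: "m \<le> cmod (gu z)" and gu_upper: "cmod (gu z) \<le> M"
begin

lemma M: "M > 0" using m gu_lower[of 0] gu_upper[of 0] by linarith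
lemma gu_nz: "gu z \<noteq> 0" using gu_lower[of z] m by auto

text \<open>The gradient divided by its squared norm, along which \<open>u\<close> increases at unit rate.\<close>

definition up :: "complex \<Rightarrow> complex" where "up z = inverse (cnj (gu z))"

text \<open>The gradient rotated by a right angle; it is tangent to the level sets and will be the
velocity.\<close>

definition along :: "complex \<Rightarrow> complex" where "along z = \<i> * gu z"

lemma up_bound: "cmod (up z) \<le> 1 / m"
  using gu_lower[of z] m by (simp add: up_def norm_inverse divide_inverse le_imp_inverse_le)

lemma along_bound: "cmod (along z) \<le> M"
  using gu_upper by (simp add: along_def norm_mult)

lemma along_lip: "loc_lip along"
proof -
  have "cmod (along x - along y) = cmod (gu x - gu y)" for x y
    by (simp add: along_def norm_mult flip: right_diff_distrib)
  then show ?thesis using gu_lip by (simp add: loc_lip_def)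
qed

lemma up_lip: "loc_lip up"
  unfolding loc_lip_def
proof
  fix R
  obtain L where L: "L > 0" "\<And>x y. x \<in> cball 0 R \<Longrightarrow> y \<in> cball 0 R \<Longrightarrow> cmod (gu x - gu y) \<le> L * cmod (x - y)"
    using gu_lip unfolding loc_lip_def by blast
  have "cmod (up x - up y) \<le> L / m\<^sup>2 * cmod (x - y)" if xy: "x \<in> cball 0 R" "y \<in> cball 0 R" for x y
  proof -
    have "up x - up y = cnj (gu y - gu x) / (cnj (gu x) * cnj (gu y))"
      using gu_nz[of x] gu_nz[of y] by (simp add: up_def field_simps)
    then have "cmod (up x - up y) = cmod (gu x - gu y) / (cmod (gu x) * cmod (gu y))"
      by (simp add: norm_divide norm_mult norm_minus_commute del: complex_cnj_diff)
    also have "\<dots> \<le> (L * cmod (x - y)) / (m * m)"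
      using L(1) m by (intro frac_le L(2)[OF xy] mult_mono gu_lower) auto
    finally show ?thesis by (simp add: power2_eq_square)
  qed
  then show "\<exists>L>0. \<forall>x\<in>cball 0 R. \<forall>y\<in>cball 0 R. cmod (up x - up y) \<le> L * cmod (x - y)"
    using L(1) m by (intro exI[of _ "L / m\<^sup>2"]) auto
qed

definition FX where "FX = (SOME F. is_flow up F)"
definition FY where "FY = (SOME F. is_flow along F)"

lemma FX: "is_flow up FX" unfolding FX_def by (rule someI_ex[OF flow_exists[OF up_lip up_bound]])
lemma FY: "is_flow along FY" unfolding FY_def by (rule someI_ex[OF flow_exists[OF along_lip along_bound]])

lemma flowD:
  assumes "is_flow f F"
  shows "F 0 x = x" "((\<lambda>t. F t x) has_vector_derivative f (F t x)) (at t)" "F (s + t) x = F s (F t x)"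
    "continuous_on S k \<Longrightarrow> continuous_on S l \<Longrightarrow> continuous_on S (\<lambda>q. F (k q) (l q))"
proof -
  show "F 0 x = x" "((\<lambda>t. F t x) has_vector_derivative f (F t x)) (at t)" "F (s + t) x = F s (F t x)"
    using assms by (auto simp: is_flow_def)
  assume k: "continuous_on S k" and l: "continuous_on S l"
  have "continuous_on UNIV (\<lambda>(t, x). F t x)" using assms by (simp add: is_flow_def)
  from continuous_on_compose2[OF this continuous_on_Pair[OF k l]] show "continuous_on S (\<lambda>q. F (k q) (l q))" by simp
qed

lemmas FX0 [simp] = flowD(1)[OF FX] and FX_deriv = flowD(2)[OF FX] and FX_add = flowD(3)[OF FX] and FX_cont = flowD(4)[OF FX]
lemmas FY0 [simp] = flowD(1)[OF FY] and FY_deriv = flowD(2)[OF FY] and FY_add = flowD(3)[OF FY] and FY_cont = flowD(4)[OF FY]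

lemma u_FX: "u (FX s x) = u x + s"
proof -
  have "((\<lambda>s. u (FX s x) - s) has_real_derivative 0) (at s)" for s
  proof -
    have "gu (FX s x) \<bullet> up (FX s x) = 1"
    proof -
      have "gu y \<bullet> up y = Re (cnj (gu y) * up y)" for y by (simp add: inner_complex_def)
      then show ?thesis using gu_nz by (simp add: up_def)
    qed
    then show ?thesis using C1_grad_along[OF u FX_deriv[of x s]] by (auto intro!: derivative_eq_intros)
  qed
  then have "u (FX s x) - s = u (FX 0 x) - 0" by (intro DERIV_isconst_all) auto
  then show ?thesis by simp
qed

lemma u_FY: "u (FY s x) = u x"
proof -
  have "((\<lambda>s. u (FY s x)) has_real_derivative 0) (at s)" for s
    using C1_grad_along[OF u FY_deriv[of x s]] by (simp add: along_def inner_complex_def)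
  then have "u (FY s x) = u (FY 0 x)" by (intro DERIV_isconst_all) auto
  then show ?thesis by simp
qed

lemma FX_inv: "FX s x = FX s y \<longleftrightarrow> x = y"
proof
  assume "FX s x = FX s y"
  then have "FX (- s) (FX s x) = FX (- s) (FX s y)" by simp
  then show "x = y" by (simp flip: FX_add)
qed simp

lemma u_lip: "\<bar>u z - u w\<bar> \<le> M * cmod (z - w)"
  by (rule segment_bound[OF u gu_upper])

text \<open>The real part is the time along the level set of \<open>x\<close>, the imaginary part is the value of
\<open>u\<close>.\<close>

definition fbox :: "complex \<Rightarrow> complex \<Rightarrow> complex" where
  "fbox x z = FX (Im z - u x) (FY (Re z) x)"

lemma u_fbox: "u (fbox x z) = Im z" by (simp add: fbox_def u_FX u_FY)

lemma fbox_cont: "continuous_on S (fbox x)"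
  unfolding fbox_def by (intro FX_cont FY_cont continuous_intros)

lemma fbox_eqD:
  assumes "fbox x z = fbox x w" shows "Im z = Im w" "FY (Re z) x = FY (Re w) x"
proof -
  show "Im z = Im w" using assms u_fbox by metis
  then show "FY (Re z) x = FY (Re w) x" using assms by (simp add: fbox_def FX_inv)
qed

lemma FY_locally_inj: "\<exists>d>0. inj_on (\<lambda>t. FY t x) {t0-d<..<t0+d}"
proof -
  define e where "e = along (FY t0 x)"
  define g where "g t = along (FY t x) \<bullet> e" for t
  have "e \<noteq> 0" using gu_nz by (simp add: e_def along_def)
  then have g0: "g t0 > 0" by (simp add: g_def e_def)
  have ac: "continuous_on UNIV along"
  proof -
    have "continuous_on UNIV gu" using u by (rule C1_gradD)
    then show ?thesis unfolding along_def by (intro continuous_intros)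
  qed
  have "continuous_on UNIV (\<lambda>t. FY t x)" by (intro FY_cont continuous_intros)
  then have "continuous_on UNIV g" unfolding g_def
    by (intro continuous_intros continuous_on_compose2[OF ac]) auto
  then have "isCont g t0" by (simp add: continuous_on_eq_continuous_at)
  then have "(g \<longlongrightarrow> g t0) (nhds t0)" by (simp add: isCont_def tendsto_at_iff_tendsto_nhds)
  then have "eventually (\<lambda>t. g t > 0) (nhds t0)" by (rule order_tendstoD(1)) (rule g0)
  then obtain d where d: "d > 0" "\<And>t. dist t t0 < d \<Longrightarrow> g t > 0" unfolding eventually_nhds_metric by blast
  have inc: "FY s x \<bullet> e < FY t x \<bullet> e" if st: "s \<in> {t0-d<..<t0+d}" "t \<in> {t0-d<..<t0+d}" "s < t" for s t
  proof (rule DERIV_pos_imp_increasing[OF st(3)])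
    fix r assume r: "s \<le> r" "r \<le> t"
    have "((\<lambda>t. FY t x) has_derivative (\<lambda>h. h *\<^sub>R along (FY r x))) (at r)"
      using FY_deriv[of x r] by (simp add: has_vector_derivative_def)
    then have "((\<lambda>t. FY t x \<bullet> e) has_derivative (\<lambda>h. (h *\<^sub>R along (FY r x)) \<bullet> e)) (at r)"
      by (rule has_derivative_inner_left)
    then have "((\<lambda>t. FY t x \<bullet> e) has_real_derivative g r) (at r)"
      by (simp add: has_field_derivative_def g_def mult_commute_abs)
    moreover have "g r > 0" using d(2)[of r] r st by (auto simp: dist_real_def)
    ultimately show "\<exists>y. ((\<lambda>t. FY t x \<bullet> e) has_real_derivative y) (at r) \<and> 0 < y" by blast
  qed
  have "inj_on (\<lambda>t. FY t x) {t0-d<..<t0+d}"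
  proof (rule linorder_inj_onI')
    fix s t assume "s \<in> {t0-d<..<t0+d}" "t \<in> {t0-d<..<t0+d}" "s < t"
    then show "FY s x \<noteq> FY t x" using inc[of s t] by auto
  qed
  then show ?thesis using d(1) by blast
qed

text \<open>The coordinate map is locally injective because the field \<open>along\<close> has no zero; invariance of
domain does the rest.\<close>

lemma open_fbox_range: "open (range (fbox x))"
proof (subst open_subopen, intro ballI)
  fix y assume "y \<in> range (fbox x)"
  then obtain z where z: "y = fbox x z" by blast
  obtain d where d: "d > 0" "inj_on (\<lambda>t. FY t x) {Re z-d<..<Re z+d}" using FY_locally_inj by blast
  define U where "U = {w. Re z - d < Re w \<and> Re w < Re z + d}"
  have "open U" unfolding U_def by (intro open_Collect_conj open_Collect_less continuous_intros)
  moreover have "inj_on (fbox x) U"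
  proof (rule inj_onI)
    fix a b assume ab: "a \<in> U" "b \<in> U" "fbox x a = fbox x b"
    have "Re a = Re b" using fbox_eqD(2)[OF ab(3)] ab d(2) by (auto simp: U_def inj_on_def)
    then show "a = b" using fbox_eqD(1)[OF ab(3)] by (simp add: complex_eq_iff)
  qed
  ultimately have "open (fbox x ` U)" by (intro invariance_of_domain fbox_cont)
  then show "\<exists>T. open T \<and> y \<in> T \<and> T \<subseteq> range (fbox x)"
    using z d(1) by (intro exI[of _ "fbox x ` U"]) (auto simp: U_def)
qed

text \<open>The images for different base points on one level set are open, and any two of them coincide
or are disjoint; they partition the connected plane.\<close>

lemma fbox_surj: "range (fbox x) = UNIV"
proof -
  have "- range (fbox x) = (\<Union>y\<in>{y. u y = u x \<and> range (fbox y) \<inter> range (fbox x) = {}}. range (fbox y))"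
  proof (intro equalityI subsetI)
    fix p assume p: "p \<in> - range (fbox x)"
    define y where "y = FX (u x - u p) p"
    have uy: "u y = u x" by (simp add: y_def u_FX)
    have py: "p = fbox y (Complex 0 (u p))"
      by (simp add: fbox_def uy) (simp add: y_def flip: FX_add)
    have "range (fbox y) \<inter> range (fbox x) = {}"
    proof (rule ccontr)
      assume "\<not> ?thesis"
      then obtain a b where ab: "fbox y a = fbox x b" by blast
      have "Im a = Im b" using ab u_fbox by metis
      then have e: "FY (Re a) y = FY (Re b) x" using ab uy by (simp add: fbox_def FX_inv)
      have "y = FY (- Re a) (FY (Re a) y)" by (simp flip: FY_add)
      also have "\<dots> = FY (- Re a + Re b) x" by (simp only: e FY_add)
      finally have yx: "y = FY (- Re a + Re b) x" .
      have "fbox y (Complex 0 (u p)) = FX (u p - u x) y" by (simp add: fbox_def uy)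
      moreover have "fbox x (Complex (- Re a + Re b) (u p)) = FX (u p - u x) (FY (- Re a + Re b) x)"
        by (simp add: fbox_def)
      ultimately have "p = fbox x (Complex (- Re a + Re b) (u p))" using py yx by metis
      then show False using p by blast
    qed
    then show "p \<in> (\<Union>y\<in>{y. u y = u x \<and> range (fbox y) \<inter> range (fbox x) = {}}. range (fbox y))"
      using uy py by blast
  qed auto
  then have "open (- range (fbox x))" using open_fbox_range by auto
  then have "closed (range (fbox x))" by (simp add: closed_def)
  then show ?thesis
    using open_fbox_range[of x] clopen[of "range (fbox x)"] by auto
qed

lemma level_orbit:
  assumes "u y = u x" obtains t where "y = FY t x"
proof -
  obtain z where z: "y = fbox x z" using fbox_surj[of x] by (metis UNIV_I imageE)
  have "Im z = u x" using u_fbox[of x z] z assms by simp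
  then have "y = FY (Re z) x" using z by (simp add: fbox_def)
  then show ?thesis using that by blast
qed

text \<open>If the level set lay in a ball, \<open>u\<close> would omit the value \<open>u x\<close> on the connected complement,
although the gradient trajectory through \<open>x\<close> leaves the ball with larger and with smaller
values of \<open>u\<close>.\<close>

lemma level_not_compact: "\<not> bounded {y. u y = u x}"
proof
  assume "bounded {y. u y = u x}"
  then obtain R where R: "{y. u y = u x} \<subseteq> ball 0 R" using bounded_subset_ballD by blast
  have cu: "continuous_on S u" for S using C1_gradD(3)[OF u] continuous_on_subset by blast
  have "connected (- ball (0::complex) R)"
    by (rule connected_complement_bounded_convex) auto
  then have con: "connected (u ` (- ball 0 R))" by (intro connected_continuous_image cu)
  have ne: "u x \<notin> u ` (- ball 0 R)" using R by auto
  have "compact (u ` cball 0 R)" by (intro compact_continuous_image cu) auto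
  then have "\<exists>B. \<forall>y\<in>cball 0 R. \<bar>u y\<bar> \<le> B"
    using compact_imp_bounded[of "u ` cball 0 R"] unfolding bounded_iff by auto
  then obtain B where B: "\<And>y. y \<in> cball 0 R \<Longrightarrow> \<bar>u y\<bar> \<le> B" by blast
  define s where "s = \<bar>u x\<bar> + \<bar>B\<bar> + 1"
  have far: "FX t x \<in> - ball 0 R" if "\<bar>t\<bar> = s" for t
  proof -
    have "\<bar>u (FX t x)\<bar> > B" using that by (simp add: u_FX s_def)
    then have "FX t x \<notin> cball 0 R" using B[of "FX t x"] by auto
    then show ?thesis by auto
  qed
  have sp: "s > 0" by (simp add: s_def)
  have "u (FX s x) \<in> u ` (- ball 0 R)" "u (FX (-s) x) \<in> u ` (- ball 0 R)" using far[of s] far[of "-s"] sp by auto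
  then have "{u (FX (-s) x)..u (FX s x)} \<subseteq> u ` (- ball 0 R)" using con connected_contains_Icc by blast
  moreover have "u x \<in> {u (FX (-s) x)..u (FX s x)}" using sp by (simp add: u_FX)
  ultimately show False using ne by blast
qed

text \<open>A periodic orbit would be a compact level set.\<close>

lemma FY_inj:
  assumes "FY s x = FY t x" shows "s = t"
proof (rule ccontr)
  assume "s \<noteq> t"
  define P where "P = \<bar>t - s\<bar>"
  have P: "P > 0" using \<open>s \<noteq> t\<close> by (simp add: P_def)
  have st: "FY (t - s) x = x" "FY (s - t) x = x"
  proof -
    have "FY (t - s) x = FY (-s) (FY t x)" by (simp flip: FY_add)
    also have "\<dots> = FY (- s) (FY s x)" using assms by simp
    also have "\<dots> = x" by (simp flip: FY_add)
    finally show "FY (t - s) x = x" .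
    have "FY (s - t) x = FY (-t) (FY s x)" by (simp flip: FY_add)
    also have "\<dots> = FY (- t) (FY t x)" using assms by simp
    also have "\<dots> = x" by (simp flip: FY_add)
    finally show "FY (s - t) x = x" .
  qed
  then have per: "FY P x = x" "FY (-P) x = x" by (auto simp: P_def abs_if)
  have n: "FY (real n * Q) x = x" if "FY Q x = x" for n Q
  proof (induction n)
    case (Suc n)
    have "FY (real (Suc n) * Q) x = FY (Q + real n * Q) x" by (simp add: algebra_simps)
    also have "\<dots> = x" unfolding FY_add by (simp only: Suc that)
    finally show ?case .
  qed simp
  have i: "FY (of_int k * P) x = x" for k
  proof (cases "k \<ge> 0")
    case True
    then show ?thesis using n[OF per(1), of "nat k"] by simp
  next
    case False
    then show ?thesis using n[OF per(2), of "nat (-k)"] by simp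
  qed
  have "{y. u y = u x} \<subseteq> (\<lambda>t. FY t x) ` {0..P}"
  proof
    fix y assume "y \<in> {y. u y = u x}"
    then obtain r where r: "y = FY r x" using level_orbit by blast
    define k where "k = \<lfloor>r / P\<rfloor>"
    have "of_int k \<le> r / P" "r / P < of_int k + 1" unfolding k_def by linarith+
    then have "r - of_int k * P \<in> {0..P}" using P by (auto simp: field_simps)
    moreover have "y = FY (r - of_int k * P) x"
    proof -
      have "FY (r - of_int k * P + of_int k * P) x = FY (r - of_int k * P) (FY (of_int k * P) x)" by (rule FY_add)
      then show ?thesis using r i by simp
    qed
    ultimately show "y \<in> (\<lambda>t. FY t x) ` {0..P}" by blast
  qed
  moreover have "compact ((\<lambda>t. FY t x) ` {0..P})"
    by (intro compact_continuous_image FY_cont continuous_intros) auto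
  ultimately have "bounded {y. u y = u x}" using compact_imp_bounded bounded_subset by blast
  then show False using level_not_compact by blast
qed

lemma fbox_inj: "inj (fbox x)"
proof (rule injI)
  fix a b assume "fbox x a = fbox x b"
  from fbox_eqD(1)[OF this] FY_inj[OF fbox_eqD(2)[OF this]] show "a = b" by (simp add: complex_eq_iff)
qed

lemma fbox_vert_deriv: "((\<lambda>t. fbox x (z + \<i> * of_real t)) has_vector_derivative up (fbox x (z + \<i> * of_real t))) (at t)"
proof -
  have "(((\<lambda>s. FX s (FY (Re z) x)) \<circ> (\<lambda>t. Im z - u x + t)) has_vector_derivative 1 *\<^sub>R up (FX (Im z - u x + t) (FY (Re z) x))) (at t)"
    by (rule vector_diff_chain_at) (auto intro!: derivative_eq_intros FX_deriv)
  moreover have "fbox x (z + \<i> * of_real t) = FX (Im z - u x + t) (FY (Re z) x)" for t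
    by (simp add: fbox_def algebra_simps)
  ultimately show ?thesis by (simp add: o_def)
qed

lemma fbox_vert_lip: "cmod (fbox x (z + \<i> * of_real t) - fbox x (z + \<i> * of_real s)) \<le> \<bar>t - s\<bar> / m"
  using ode_speed[OF fbox_vert_deriv up_bound, of x z t s] by simp

definition fboxinv :: "complex \<Rightarrow> complex \<Rightarrow> complex" where "fboxinv x = inv (fbox x)"

lemma fbox_fboxinv: "fbox x (fboxinv x z) = z" and fboxinv_fbox: "fboxinv x (fbox x z) = z"
  unfolding fboxinv_def using fbox_surj[of x] fbox_inj[of x] by (auto intro: surj_f_inv_f)

lemma Im_fboxinv: "Im (fboxinv x z) = u z" by (metis u_fbox fbox_fboxinv)

sublocale foliation "fbox x" "fboxinv x" M m for x
proof
  show "continuous_on UNIV (fbox x)" by (rule fbox_cont)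
  obtain g where g: "homeomorphism UNIV (range (fbox x)) (fbox x) g"
    using invariance_of_domain_homeomorphism[OF open_UNIV fbox_cont _ fbox_inj, of x] by auto
  have "g z = fboxinv x z" for z
    using g fbox_surj[of x] by (metis UNIV_I fboxinv_fbox homeomorphism_def)
  then have "g = fboxinv x" by (rule ext)
  then show "continuous_on UNIV (fboxinv x)" using g fbox_surj[of x] by (simp add: homeomorphism_def)
  show "fboxinv x (fbox x z) = z" "fbox x (fboxinv x z) = z" for z by (rule fboxinv_fbox fbox_fboxinv)+
  show "\<bar>Im (fboxinv x z) - Im (fboxinv x w)\<bar> \<le> M * cmod (z - w)" for z w
    by (simp add: Im_fboxinv u_lip)
  show "cmod (fbox x a - fbox x b) \<le> \<bar>Im a - Im b\<bar> / m" if "Re a = Re b" for a b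
  proof -
    have "a = Complex (Re a) 0 + \<i> * of_real (Im a)" "b = Complex (Re a) 0 + \<i> * of_real (Im b)"
      using that by (auto simp: complex_eq_iff)
    then show ?thesis using fbox_vert_lip[of x "Complex (Re a) 0" "Im a" "Im b"] by metis
  qed
qed (use m M in auto)

end

section \<open>Pressure and angle in a strip between two streamlines\<close>

lemma cutg_sq: "cutg 4 z r y = (2 * cutf 2 z r y) *\<^sub>R cutg 2 z r y"
proof -
  have "bump 3 t = bump 1 t * bump 2 t" "bump 4 t = bump 2 t * bump 2 t" for t
    by (simp_all add: bump_def power_add[symmetric] power_Suc[symmetric] del: power_Suc flip: power_add)
  then show ?thesis by (simp add: cutg_def cutf_def Let_def complex_eq_iff algebra_simps)
qed

lemma cutf_sq: "cutf 4 z r y = (cutf 2 z r y)\<^sup>2"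
  by (simp add: cutf_def bump_def power_mult_distrib flip: power_mult)

text \<open>The factors of the fourth power of the cutoff are twice continuously differentiable.\<close>

lemma cutg_closed:
  assumes r: "r > 0" shows "closed_form (cutg 4 z r)"
proof -
  have r0: "r \<noteq> 0" using r by simp
  define b where "b c t = bump 4 ((t - c) / r)" for c t
  define b' where "b' c t = - 8 / r * ((t - c) / r * bump 3 ((t-c)/r))" for c t
  define b'' where "b'' c t = - 8 / r * (1 / r * bump 3 ((t-c)/r) + (t - c) / r * (- 6 / r * ((t - c) / r * bump 2 ((t-c)/r))))" for c t
  have b: "(b c has_real_derivative b' c t) (at t)" for c t
    unfolding b_def[abs_def] b'_def using bump_scaled_deriv[OF r0, of 2 c t] by (simp add: eval_nat_numeral)
  have d3: "((\<lambda>t. bump 3 ((t - c) / r)) has_real_derivative (- 6 / r * ((t - c) / r * bump 2 ((t-c)/r)))) (at t)" for c t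
    using bump_scaled_deriv[OF r0, of 1 c t] by (simp add: eval_nat_numeral)
  have dl: "((\<lambda>t. (t - c) / r) has_real_derivative 1 / r) (at t)" for c t
    using r0 by (auto intro!: derivative_eq_intros)
  have b': "(b' c has_real_derivative b'' c t) (at t)" for c t
    unfolding b'_def[abs_def] b''_def
    by (rule DERIV_cong[OF DERIV_cmult[OF DERIV_mult[OF dl d3]]]) (simp add: algebra_simps)
  have c: "continuous_on UNIV (b' c)" "continuous_on UNIV (b'' c)" for c
    unfolding b'_def b''_def using r0 by (intro continuous_intros; simp)+
  have Re: "Re (cutg 4 z r y) = b' (Re z) (Re y) * b (Im z) (Im y)" and Im: "Im (cutg 4 z r y) = b (Re z) (Re y) * b' (Im z) (Im y)" for y
    by (auto simp: cutg_def Let_def b_def b'_def)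
  show ?thesis
    unfolding closed_form_def Re Im
    by (intro exI conjI) (rule C1_grad_prod[OF b' c(2) b c(1)], rule C1_grad_prod[OF b c(1) b' c(2)], simp)
qed

text \<open>A continuously differentiable transition from 0 (for \<open>t \<le> 0\<close>) to 1 (for \<open>t \<ge> 1\<close>).\<close>

definition step :: "real \<Rightarrow> real" where "step t = 1 - (max 0 (1 - (max 0 t)\<^sup>2))\<^sup>2"
definition step' :: "real \<Rightarrow> real" where "step' t = 4 * max 0 (1 - (max 0 t)\<^sup>2) * max 0 t"

lemma step_deriv: "(step has_real_derivative step' t) (at t)"
proof -
  have p: "((\<lambda>t::real. (max 0 t)\<^sup>2) has_real_derivative 2 * max 0 t) (at t)" for t
    using pos_power_deriv[of 0 t] by (simp add: numeral_2_eq_2)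
  have "((\<lambda>t::real. 1 - (max 0 t)\<^sup>2) has_real_derivative - (2 * max 0 t)) (at t)"
    using DERIV_diff[OF DERIV_const p[of t], of 1] by simp
  from DERIV_diff[OF DERIV_const DERIV_chain2[OF p this], of 1]
  show ?thesis unfolding step_def[abs_def] step'_def by (rule DERIV_cong) simp
qed

lemma step'_cont: "continuous_on S step'" unfolding step'_def by (intro continuous_intros)

lemma step_0: "t \<le> 0 \<Longrightarrow> step t = 0" "t \<le> 0 \<Longrightarrow> step' t = 0" by (auto simp: step_def step'_def max_def)
lemma step_1:
  assumes "t \<ge> 1" shows "step t = 1" "step' t = 0"
proof -
  have "1 \<le> t\<^sup>2" using assms by (rule one_le_power)
  moreover have "max 0 t = t" using assms by simp
  ultimately have "max 0 (1 - (max 0 t)\<^sup>2) = 0" by (intro max_absorb1) linarith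
  then show "step t = 1" "step' t = 0" by (simp_all add: step_def step'_def)
qed
lemma step'_bounds: "0 \<le> step' t" "step' t \<le> 4"
proof -
  show "0 \<le> step' t" by (simp add: step'_def)
  show "step' t \<le> 4"
  proof (cases "t \<ge> 1")
    case False
    have "max 0 (1 - (max 0 t)\<^sup>2) * max 0 t \<le> 1 * 1"
      using False by (intro mult_mono) auto
    then show ?thesis by (simp add: step'_def)
  qed (simp add: step_1)
qed

lemma cos_pos_near_0:
  assumes "\<bar>x\<bar> \<le> (1::real)" shows "cos x > 0"
  by (rule cos_gt_zero_pi) (use assms pi_gt3 in linarith)+

text \<open>Pressure \<open>p\<close> and angle \<open>\<phi>\<close> of an Euler flow with stream function \<open>u\<close>. The momentum equation
is the conjugacy \<open>conj\<close>; from Bernoulli's law only the bounded oscillation of \<open>p\<close> on level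
sets is kept.\<close>

locale euler = stream +
  fixes p gp \<phi> g\<phi>
  assumes p: "C1_grad p gp" and \<phi>: "C1_grad \<phi> g\<phi>" and gp_closed: "closed_form gp" and g\<phi>_closed: "closed_form g\<phi>"
    and conj: "gp z = - \<i> * of_real ((cmod (gu z))\<^sup>2) * g\<phi> z"
    and angle: "gu z = of_real (cmod (gu z)) * cis (\<phi> z)"
    and bernoulli: "u x = u y \<Longrightarrow> \<bar>p x - p y\<bar> \<le> M\<^sup>2"
begin

definition a where "a z = (cmod (gu z))\<^sup>2"

lemma a_bounds: "m\<^sup>2 \<le> a z" "a z \<le> M\<^sup>2" "a z > 0"
  using gu_lower[of z] gu_upper[of z] m gu_nz[of z] by (auto simp: a_def intro!: power_mono)

lemma a_cont: "continuous_on S a"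
proof -
  have "continuous_on UNIV gu" using u by (rule C1_gradD)
  then have "continuous_on UNIV a" unfolding a_def by (intro continuous_intros)
  then show ?thesis by (rule continuous_on_subset) auto
qed

lemma gp_eq: "gp z = - \<i> * of_real (a z) * g\<phi> z" using conj by (simp add: a_def)
lemma g\<phi>_eq: "g\<phi> z = \<i> / of_real (a z) * gp z" using a_bounds(3)[of z] by (simp add: gp_eq field_simps)

lemma norm_g: "(cmod (gp z))\<^sup>2 = (a z)\<^sup>2 * (cmod (g\<phi> z))\<^sup>2"
  by (simp add: gp_eq norm_mult power_mult_distrib)

lemma cross_phi: "Im (cnj q * g\<phi> z) = (q \<bullet> gp z) / a z"
proof -
  have "q \<bullet> gp z = a z * Im (cnj q * g\<phi> z)" by (simp add: gp_eq inner_complex_def algebra_simps)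
  then show ?thesis using a_bounds(3)[of z] by simp
qed

lemma cross_p: "Im (cnj q * gp z) = - (a z * (q \<bullet> g\<phi> z))"
  by (simp add: gp_eq inner_complex_def algebra_simps)

text \<open>Conjugacy makes \<open>grad p / a\<close> the rotated gradient of \<open>\<phi>\<close>, which is divergence free.\<close>

lemma weak_p: "weak_sol (\<lambda>z. 1 / a z) p gp"
  unfolding weak_sol_def
proof (intro conjI allI impI p)
  show "continuous_on UNIV (\<lambda>z. 1 / a z)"
    using a_bounds(3) by (intro continuous_intros a_cont) (metis less_irrefl)
  fix z r q gq assume "r > 0" "C1_grad q gq" "\<forall>y. y \<notin> obox z r \<longrightarrow> q y = 0"
  then have "bint z r (\<lambda>y. Im (cnj (gq y) * g\<phi> y)) = 0" by (intro green g\<phi>_closed) auto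
  then show "bint z r (\<lambda>y. 1 / a y * (gq y \<bullet> gp y)) = 0" unfolding cross_phi by simp
qed

lemma weak_phi: "weak_sol a \<phi> g\<phi>"
  unfolding weak_sol_def
proof (intro conjI allI impI \<phi> a_cont)
  fix z r q gq assume "r > 0" "C1_grad q gq" "\<forall>y. y \<notin> obox z r \<longrightarrow> q y = 0"
  then have "bint z r (\<lambda>y. Im (cnj (gq y) * gp y)) = 0" by (intro green gp_closed) auto
  then have "bint z r (\<lambda>y. (-1) * (a y * (gq y \<bullet> g\<phi> y))) = 0" unfolding cross_p by simp
  then show "bint z r (\<lambda>y. a y * (gq y \<bullet> g\<phi> y)) = 0" unfolding bint_cmult by simp
qed

lemma inv_a_bounds: "1 / M\<^sup>2 \<le> 1 / a z" "1 / a z \<le> 1 / m\<^sup>2" "1 / a z > 0"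
  using a_bounds[of z] m M by (auto intro!: divide_left_mono mult_pos_pos)

lemma bounded_p_imp_const:
  assumes "\<And>z. \<bar>p z\<bar> \<le> K" shows "\<phi> z = \<phi> w"
proof -
  have M2: "1 / M\<^sup>2 > 0" using M by simp
  have pc: "p z = p 0" for z by (rule weak_liouville[OF weak_p M2 inv_a_bounds(1,2) assms])
  have gp0: "gp z = 0" for z
  proof -
    have "((\<lambda>_. p 0) has_derivative (\<lambda>h. gp z \<bullet> h)) (at z)"
      using C1_gradD(2)[OF p, of z] pc by (metis ext)
    moreover have "((\<lambda>_. p 0) has_derivative (\<lambda>h. 0)) (at z)" by simp
    ultimately have "(\<lambda>h. gp z \<bullet> h) = (\<lambda>h. 0)" by (rule has_derivative_unique)
    then have "gp z \<bullet> gp z = 0" by metis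
    then show ?thesis by simp
  qed
  then have "g\<phi> z = 0" for z by (simp add: g\<phi>_eq)
  then have "\<exists>c. \<forall>z\<in>UNIV. \<phi> z = c"
    using C1_gradD(2)[OF \<phi>] by (intro has_derivative_zero_constant) auto
  then show ?thesis by auto
qed

text \<open>A compact piece of one gradient trajectory meets every level set of the strip, and on each
of them the oscillation of \<open>p\<close> is bounded.\<close>

lemma p_bounded_on_strip:
  shows "\<exists>K. \<forall>z. lo \<le> u z \<and> u z \<le> hi \<longrightarrow> \<bar>p z\<bar> \<le> K"
proof -
  define c where "c s = fbox 0 (\<i> * of_real s)" for s
  have uc: "u (c s) = s" for s by (simp add: c_def u_fbox)
  have cc: "continuous_on UNIV c" unfolding c_def by (intro continuous_on_compose2[OF fbox_cont[of UNIV]] continuous_intros) auto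
  have "compact ((\<lambda>s. p (c s)) ` {lo..hi})"
    by (intro compact_continuous_image continuous_on_compose2[OF C1_gradD(3)[OF p]] continuous_on_subset[OF cc]) auto
  then have "\<exists>K. \<forall>s\<in>{lo..hi}. \<bar>p (c s)\<bar> \<le> K"
    using compact_imp_bounded[of "(\<lambda>s. p (c s)) ` {lo..hi}"] unfolding bounded_iff by auto
  then obtain K where K: "\<And>s. s \<in> {lo..hi} \<Longrightarrow> \<bar>p (c s)\<bar> \<le> K" by blast
  have "\<bar>p z\<bar> \<le> K + M\<^sup>2" if "lo \<le> u z" "u z \<le> hi" for z
    using K[of "u z"] that bernoulli[of z "c (u z)"] uc[of "u z"] by auto
  then show ?thesis by blast
qed

lemma cbx_dist: "y \<in> cbx z r \<Longrightarrow> cmod (y - z) \<le> 2 * r"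
  using cmod_le[of "y - z"] by (auto simp: cbx_def)

lemma strip_energy:
  shows "\<exists>E. \<forall>z. lo \<le> u z \<and> u z \<le> hi \<longrightarrow> energy gp z 1 \<le> E"
proof -
  obtain K where K: "\<And>z. lo - 4 * M \<le> u z \<Longrightarrow> u z \<le> hi + 4 * M \<Longrightarrow> \<bar>p z\<bar> \<le> K"
    using p_bounded_on_strip[of "lo - 4 * M" "hi + 4 * M"] by blast
  have M2: "1 / M\<^sup>2 > 0" using M by simp
  have "energy gp z (2/2) \<le> 10^5 * (1 / m\<^sup>2 / (1 / M\<^sup>2)) * K\<^sup>2" if z: "lo \<le> u z" "u z \<le> hi" for z
  proof (rule caccioppoli[OF weak_p M2 inv_a_bounds(1,2)])
    fix y assume "y \<in> cbx z 2"
    then have "\<bar>u y - u z\<bar> \<le> M * 4" using u_lip[of y z] mult_left_mono[OF cbx_dist[of y z 2] less_imp_le[OF M]] by simp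
    then show "\<bar>p y - 0\<bar> \<le> K" using K[of y] z by simp
  qed simp
  then show ?thesis by auto
qed

text \<open>The energy of \<open>p\<close> on unit squares, and with it that of \<open>\<phi>\<close>, is bounded uniformly along the
strip, so \<open>courant_lebesgue\<close> yields a radius that does not depend on the point.\<close>

lemma strip_uniform:
  assumes e: "e > 0"
  shows "\<exists>\<rho>>0. \<forall>z. lo \<le> u z \<and> u z \<le> hi \<longrightarrow>
    (\<forall>y\<in>cbx z \<rho>. \<forall>w\<in>cbx z \<rho>. \<bar>p y - p w\<bar> \<le> e \<and> \<bar>\<phi> y - \<phi> w\<bar> \<le> e)"
proof -
  obtain E where E: "\<And>z. lo \<le> u z \<Longrightarrow> u z \<le> hi \<Longrightarrow> energy gp z 1 \<le> E"
    using strip_energy[of lo hi] by blast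
  define F where "F = \<bar>E\<bar> + \<bar>E\<bar> / (m\<^sup>2)\<^sup>2"
  have E\<phi>: "energy g\<phi> z 1 \<le> F" if z: "lo \<le> u z" "u z \<le> hi" for z
  proof -
    have "energy g\<phi> z 1 \<le> bint z 1 (\<lambda>y. (1 / (m\<^sup>2)\<^sup>2) * (cmod (gp y))\<^sup>2)"
    proof (intro bint_mono)
      fix y
      have "(m\<^sup>2)\<^sup>2 * (cmod (g\<phi> y))\<^sup>2 \<le> (cmod (gp y))\<^sup>2"
        unfolding norm_g using a_bounds(1)[of y] by (intro mult_right_mono power_mono) auto
      then show "(cmod (g\<phi> y))\<^sup>2 \<le> (1 / (m\<^sup>2)\<^sup>2) * (cmod (gp y))\<^sup>2" using m by (simp add: field_simps)
    qed (intro continuous_intros sq_norm_cont C1_gradD(1)[OF p] C1_gradD(1)[OF \<phi>])+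
    also have "\<dots> \<le> (1 / (m\<^sup>2)\<^sup>2) * \<bar>E\<bar>"
      unfolding bint_cmult using E[OF z] by (intro mult_left_mono) auto
    also have "\<dots> \<le> F" by (simp add: F_def)
    finally show ?thesis .
  qed
  have Ep: "energy gp z 1 \<le> F" if z: "lo \<le> u z" "u z \<le> hi" for z
  proof -
    have "0 \<le> \<bar>E\<bar> / (m\<^sup>2)\<^sup>2" by simp
    then show ?thesis using E[OF z] abs_ge_self[of E] by (simp only: F_def)
  qed
  obtain N where "F / (e/12)\<^sup>2 < real N" using reals_Archimedean2 by blast
  then have N: "F < real N * (e/12)\<^sup>2" using e by (simp add: field_simps)
  define \<rho> :: real where "\<rho> = 1 / 2 ^ N"
  have \<rho>: "\<rho> > 0" "2 ^ N * \<rho> = 1" by (simp_all add: \<rho>_def)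
  have e12: "e / 12 > 0" using e by simp
  have "\<bar>p y - p w\<bar> \<le> 12 * (e/12) \<and> \<bar>\<phi> y - \<phi> w\<bar> \<le> 12 * (e/12)"
    if z: "lo \<le> u z" "u z \<le> hi" and yw: "y \<in> cbx z \<rho>" "w \<in> cbx z \<rho>" for z y w
  proof
    show "\<bar>p y - p w\<bar> \<le> 12 * (e/12)"
      by (rule courant_lebesgue[OF weak_p inv_a_bounds(3) \<rho>(1) e12 _ N yw]) (simp add: \<rho>(2) Ep z)
    show "\<bar>\<phi> y - \<phi> w\<bar> \<le> 12 * (e/12)"
      by (rule courant_lebesgue[OF weak_phi a_bounds(3) \<rho>(1) e12 _ N yw]) (simp add: \<rho>(2) E\<phi> z)
  qed
  then show ?thesis using \<rho>(1) by auto
qed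

text \<open>On the scale where \<open>\<phi>\<close> varies by at most 1, a gradient trajectory keeps moving into the half
plane with normal direction \<open>\<phi>\<close>; this is the local hypothesis of \<open>angle_growth\<close>.\<close>

lemma strip_angle_growth:
  shows "\<exists>C K. K > 0 \<and> (\<forall>x y n d. lo \<le> u x \<and> u x \<le> hi \<and> lo \<le> u y \<and> u y \<le> hi \<and> cmod (x - y) \<le> d \<and> K * (d + 1) \<le> (1 + m / (2 * M)) ^ n
     \<longrightarrow> \<bar>\<phi> x - \<phi> y\<bar> \<le> C + 2 * pi * real n)"
proof -
  obtain \<rho> where \<rho>: "\<rho> > 0" "\<And>z y. lo \<le> u z \<Longrightarrow> u z \<le> hi \<Longrightarrow> y \<in> cbx z \<rho> \<Longrightarrow> \<bar>\<phi> y - \<phi> z\<bar> \<le> 1"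
  proof -
    obtain \<rho> where "\<rho> > 0" "\<forall>z. lo \<le> u z \<and> u z \<le> hi \<longrightarrow> (\<forall>y\<in>cbx z \<rho>. \<forall>w\<in>cbx z \<rho>. \<bar>p y - p w\<bar> \<le> 1 \<and> \<bar>\<phi> y - \<phi> w\<bar> \<le> 1)"
      using strip_uniform[of 1 lo hi] by auto
    moreover from this have "z \<in> cbx z \<rho>" for z by (auto simp: cbx_def)
    ultimately show ?thesis using that by blast
  qed
  (* Up to this height a trajectory stays in the square of half side \<open>\<rho>\<close>, as its speed is at
     most \<open>1 / m\<close>. *)
  define t0 where "t0 = m * \<rho>"
  have t0: "t0 > 0" using m \<rho> by (simp add: t0_def)
  define S where "S = {z. lo \<le> Im z \<and> Im z \<le> hi}"
  have Sc: "connected S"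
    unfolding S_def Collect_conj_eq by (intro convex_connected convex_Int convex_halfspace_Im_ge convex_halfspace_Im_le)
  have inc: "Re ((fbox 0 (z + \<i> * of_real t) - fbox 0 (z + \<i> * of_real s)) * cis (- \<phi> (fbox 0 z))) > 0"
    if z: "z \<in> S" and st: "- t0 \<le> s" "s < t" "t \<le> t0" for z s t
  proof -
    define w where "w = fbox 0 z"
    define c where "c t = fbox 0 (z + \<i> * of_real t)" for t
    have cd: "(c has_vector_derivative up (c t)) (at t)" for t unfolding c_def by (rule fbox_vert_deriv)
    have near: "\<bar>\<phi> (c r) - \<phi> w\<bar> \<le> 1" if "s \<le> r" "r \<le> t" for r
    proof (rule \<rho>(2))
      show "lo \<le> u w" "u w \<le> hi" using z by (auto simp: w_def u_fbox S_def)
      have "cmod (c r - w) \<le> \<bar>r - 0\<bar> / m"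
        using fbox_vert_lip[of 0 z r 0] by (simp add: c_def w_def)
      also have "\<dots> \<le> t0 / m" using that st m by (intro divide_right_mono) auto
      also have "\<dots> = \<rho>" using m by (simp add: t0_def)
      finally show "c r \<in> cbx w \<rho>"
        using abs_Re_le_cmod[of "c r - w"] abs_Im_le_cmod[of "c r - w"] by (simp add: cbx_def)
    qed
    have "Re (c s * cis (- \<phi> w)) < Re (c t * cis (- \<phi> w))"
    proof (rule DERIV_pos_imp_increasing[OF st(2)])
      fix r assume r: "s \<le> r" "r \<le> t"
      have "((\<lambda>t. c t * cis (- \<phi> w)) has_vector_derivative up (c r) * cis (- \<phi> w)) (at r)"
        by (intro has_vector_derivative_mult_left cd)
      then have "((\<lambda>t. Re (c t * cis (- \<phi> w))) has_vector_derivative Re (up (c r) * cis (- \<phi> w))) (at r)"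
        by (rule bounded_linear.has_vector_derivative[OF bounded_linear_Re])
      then have "((\<lambda>t. Re (c t * cis (- \<phi> w))) has_real_derivative Re (up (c r) * cis (- \<phi> w))) (at r)"
        by (simp add: has_real_derivative_iff_has_vector_derivative)
      moreover have "Re (up (c r) * cis (- \<phi> w)) > 0"
      proof -
        have "up (c r) = of_real (1 / cmod (gu (c r))) * cis (\<phi> (c r))"
          unfolding up_def by (subst angle) (simp add: cis_cnj divide_inverse)
        then have "up (c r) * cis (- \<phi> w) = of_real (1 / cmod (gu (c r))) * cis (\<phi> (c r) - \<phi> w)"
          using cis_mult[of "\<phi> (c r)" "- \<phi> w"] by (simp add: mult.assoc)
        then have "Re (up (c r) * cis (- \<phi> w)) = 1 / cmod (gu (c r)) * cos (\<phi> (c r) - \<phi> w)" by simp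
        moreover have "cos (\<phi> (c r) - \<phi> w) > 0" by (rule cos_pos_near_0[OF near[OF r]])
        ultimately show ?thesis using gu_nz[of "c r"] by simp
      qed
      ultimately show "\<exists>y. ((\<lambda>t. Re (c t * cis (- \<phi> w))) has_real_derivative y) (at r) \<and> 0 < y" by blast
    qed
    then show ?thesis by (simp add: c_def w_def left_diff_distrib)
  qed
  have "\<exists>C K. K > 0 \<and> (\<forall>a\<in>S. \<forall>b\<in>S. \<forall>n d. cmod (fbox 0 a - fbox 0 b) \<le> d \<longrightarrow> K * (d + 1) \<le> (1 + m / (2 * M)) ^ n
     \<longrightarrow> \<bar>\<phi> (fbox 0 a) - \<phi> (fbox 0 b)\<bar> \<le> C + 2 * pi * real n)"
  proof (rule angle_growth[OF C1_gradD(3)[OF \<phi>] t0 _ _ Sc])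
    fix z assume z: "z \<in> S"
    show "0 < Re ((fbox 0 (z + \<i> * complex_of_real t0) - fbox 0 z) * cis (- \<phi> (fbox 0 z)))"
      using inc[OF z, of 0 t0] t0 by simp
    show "0 < Re ((fbox 0 z - fbox 0 (z - \<i> * complex_of_real t0)) * cis (- \<phi> (fbox 0 z)))"
      using inc[OF z, of "-t0" 0] t0 by simp
  qed
  then obtain C K where K: "K > 0" and CK: "\<And>a b n d. a \<in> S \<Longrightarrow> b \<in> S \<Longrightarrow> cmod (fbox 0 a - fbox 0 b) \<le> d \<Longrightarrow>
     K * (d + 1) \<le> (1 + m / (2 * M)) ^ n \<Longrightarrow> \<bar>\<phi> (fbox 0 a) - \<phi> (fbox 0 b)\<bar> \<le> C + 2 * pi * real n" by blast
  have "\<bar>\<phi> x - \<phi> y\<bar> \<le> C + 2 * pi * real n"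
    if h: "lo \<le> u x" "u x \<le> hi" "lo \<le> u y" "u y \<le> hi" "cmod (x - y) \<le> d" "K * (d + 1) \<le> (1 + m / (2 * M)) ^ n" for x y n d
    using CK[of "fboxinv 0 x" "fboxinv 0 y" d n] h by (simp add: fbox_fboxinv Im_fboxinv S_def)
  then show ?thesis using K by blast
qed

end

section \<open>Boundedness of the pressure\<close>

context euler begin

text \<open>Rescaled so that the strip is \<open>0 \<le> level \<le> 1\<close>; \<open>s0\<close> may be larger than \<open>s1\<close>.\<close>

definition level :: "real \<Rightarrow> real \<Rightarrow> complex \<Rightarrow> real" where "level s0 s1 z = (u z - s0) / (s1 - s0)"

text \<open>The truncated pressure: constant 0 and 1 on the two sides of the strip.\<close>

definition P :: "real \<Rightarrow> real \<Rightarrow> real \<Rightarrow> complex \<Rightarrow> real" where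
  "P s0 s1 c z = (if level s0 s1 z \<le> 0 then 0 else if 1 \<le> level s0 s1 z then 1 else step (p z - c))"

definition gP :: "real \<Rightarrow> real \<Rightarrow> real \<Rightarrow> complex \<Rightarrow> complex" where
  "gP s0 s1 c z = (if 0 < level s0 s1 z \<and> level s0 s1 z < 1 then step' (p z - c) *\<^sub>R gp z else 0)"

lemma level_cont: "s0 \<noteq> s1 \<Longrightarrow> continuous_on S (level s0 s1)"
  unfolding level_def by (intro continuous_intros continuous_on_subset[OF C1_gradD(3)[OF u]]) auto

text \<open>Near the two boundary curves of the strip the truncation is already constant, because \<open>p\<close> is
below \<open>c\<close> on one and above \<open>c + 1\<close> on the other.\<close>

lemma P_C1:
  assumes s: "s0 \<noteq> s1" and lo: "\<And>z. u z = s0 \<Longrightarrow> p z < c" and hi: "\<And>z. u z = s1 \<Longrightarrow> p z > c + 1"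
  shows "C1_grad (P s0 s1 c) (gP s0 s1 c)"
proof (rule C1_grad_local)
  fix z
  have lc: "continuous_on UNIV (level s0 s1)" by (rule level_cont[OF s])
  have pc: "continuous_on UNIV p" by (rule C1_gradD(3)[OF p])
  have oL: "open {y. level s0 s1 y < t}" "open {y. t < level s0 s1 y}" "open {y. p y < t}" "open {y. t < p y}" for t
    by (intro open_Collect_less lc pc continuous_intros)+
  have z0: "level s0 s1 z = 0 \<Longrightarrow> u z = s0" using s by (simp add: level_def)
  have z1: "level s0 s1 z = 1 \<Longrightarrow> u z = s1" using s by (simp add: level_def field_simps)
  consider "0 < level s0 s1 z" "level s0 s1 z < 1" | "level s0 s1 z \<le> 0" | "1 \<le> level s0 s1 z" by linarith
  then show "\<exists>U F G. open U \<and> z \<in> U \<and> C1_grad F G \<and> (\<forall>y\<in>U. P s0 s1 c y = F y \<and> gP s0 s1 c y = G y)"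
  proof cases
    case 1
    have "C1_grad (\<lambda>z. step (p z - c)) (\<lambda>z. step' (p z - c) *\<^sub>R gp z)"
      by (rule C1_grad_chain[OF C1_grad_diff_const[OF p] step_deriv step'_cont])
    moreover have "open ({y. level s0 s1 y < 1} \<inter> {y. 0 < level s0 s1 y})" by (intro open_Int oL)
    ultimately show ?thesis using 1
      by (intro exI[of _ "{y. level s0 s1 y < 1} \<inter> {y. 0 < level s0 s1 y}"] exI[of _ "\<lambda>z. step (p z - c)"] exI[of _ "\<lambda>z. step' (p z - c) *\<^sub>R gp z"])
        (auto simp: P_def gP_def)
  next
    case 2
    define U where "U = {y. level s0 s1 y < 1} \<inter> ({y. p y < c} \<union> {y. level s0 s1 y < 0})"
    have "open U" unfolding U_def by (intro open_Int open_Un oL)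
    moreover have "z \<in> U" using 2 lo[OF z0] by (cases "level s0 s1 z = 0") (auto simp: U_def)
    moreover have "\<forall>y\<in>U. P s0 s1 c y = 0 \<and> gP s0 s1 c y = 0"
      by (auto simp: U_def P_def gP_def step_0)
    ultimately show ?thesis using C1_grad_const[of 0] by blast
  next
    case 3
    define U where "U = {y. 0 < level s0 s1 y} \<inter> ({y. c + 1 < p y} \<union> {y. 1 < level s0 s1 y})"
    have "open U" unfolding U_def by (intro open_Int open_Un oL)
    moreover have "z \<in> U" using 3 hi[OF z1] by (cases "level s0 s1 z = 1") (auto simp: U_def)
    moreover have "\<forall>y\<in>U. P s0 s1 c y = 1 \<and> gP s0 s1 c y = 0"
      by (auto simp: U_def P_def gP_def step_1)
    ultimately show ?thesis using C1_grad_const[of 1] by blast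
  qed
qed

text \<open>Let \<open>k\<close> be a cutoff and \<open>f\<close> the angle minus a constant. The exact forms \<open>d (k P d\<phi>)\<close> and
\<open>d (f P dk)\<close> have integral zero. In their sum the terms \<open>P dk d\<phi>\<close> cancel, and what remains
is \<open>k dP d\<phi> + f dP dk\<close>, an expression supported in the strip. Its first term controls the
energy of \<open>P\<close>; the second is absorbed because \<open>dk\<close> is \<open>2 e de\<close> when \<open>k = e^2\<close>.\<close>

lemma strip_energy_bound:
  assumes s: "s0 \<noteq> s1" and lo: "\<And>z. u z = s0 \<Longrightarrow> p z < c" and hi: "\<And>z. u z = s1 \<Longrightarrow> p z > c + 1"
    and R: "R > 0" and D: "\<And>y. y \<in> cbx z R \<Longrightarrow> 0 < level s0 s1 y \<Longrightarrow> level s0 s1 y < 1 \<Longrightarrow> \<bar>\<phi> y - \<phi> z\<bar> \<le> D"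
  shows "energy (gP s0 s1 c) z (R/2) \<le> 10^6 * M\<^sup>2 * M\<^sup>2 * D\<^sup>2"
proof -
  define Q where "Q = P s0 s1 c"
  define gQ where "gQ = gP s0 s1 c"
  have Q: "C1_grad Q gQ" unfolding Q_def gQ_def by (rule P_C1[OF s lo hi])
  define k where "k = cutf 4 z R"
  define gk where "gk = cutg 4 z R"
  have k: "C1_grad k gk" using cutf_C1[OF R, of 2 z] by (simp add: k_def gk_def eval_nat_numeral)
  define f where "f y = \<phi> y - \<phi> z" for y
  have f: "C1_grad f g\<phi>" unfolding f_def by (rule C1_grad_diff_const[OF \<phi>])
  note cs = C1_gradD(1)[OF Q] C1_gradD(1)[OF k] C1_gradD(1)[OF f] C1_gradD(3)[OF Q] C1_gradD(3)[OF k] C1_gradD(3)[OF f]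
  have kz: "k y = 0" "gk y = 0" if "y \<notin> obox z R" for y
    using cutf_zero[OF that R, of 4] cutg_zero[OF that R, of 4] by (auto simp: k_def gk_def)
  have 1: "bint z R (\<lambda>y. Im (cnj (k y *\<^sub>R gQ y + Q y *\<^sub>R gk y) * g\<phi> y)) = 0"
    by (rule green[OF C1_grad_mult[OF k Q] g\<phi>_closed]) (use kz R in auto)
  have 2: "bint z R (\<lambda>y. Im (cnj (f y *\<^sub>R gQ y + Q y *\<^sub>R g\<phi> y) * gk y)) = 0"
    by (rule green[OF C1_grad_mult[OF f Q]]) (use kz R cutg_closed[OF R, of z] in \<open>auto simp: gk_def\<close>)
  define I where "I y = k y * Im (cnj (gQ y) * g\<phi> y) + f y * Im (cnj (gQ y) * gk y)" for y
  have Ic: "continuous_on UNIV I" unfolding I_def by (intro continuous_intros cs)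
  have "bint z R I = bint z R (\<lambda>y. Im (cnj (k y *\<^sub>R gQ y + Q y *\<^sub>R gk y) * g\<phi> y) + Im (cnj (f y *\<^sub>R gQ y + Q y *\<^sub>R g\<phi> y) * gk y))"
    by (rule arg_cong[of _ _ "bint z R"], rule ext) (simp add: I_def algebra_simps)
  also have "\<dots> = 0" by (subst bint_add, (intro continuous_intros cs)+) (simp only: 1 2)
  finally have I0: "bint z R I = 0" .
  define e where "e = cutf 2 z R"
  define ge where "ge = cutg 2 z R"
  have geb: "cmod (ge y) \<le> 8 / R" for y
    using cutg_bound[OF R, of 0 z y] by (simp add: ge_def numeral_2_eq_2)
  have en: "e y \<ge> 0" for y by (simp add: e_def cutf_nonneg)
  have ke: "k y = (e y)\<^sup>2" "gk y = (2 * e y) *\<^sub>R ge y" for y by (simp_all add: k_def gk_def e_def ge_def cutf_sq cutg_sq)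
  have pt: "k y * (cmod (gQ y))\<^sup>2 \<le> 4 * M\<^sup>2 * (2 * I y + 16 * M\<^sup>2 * D\<^sup>2 * (8/R)\<^sup>2)" if y: "y \<in> cbx z R" for y
  proof (cases "0 < level s0 s1 y \<and> level s0 s1 y < 1")
    case False
    then have "gQ y = 0" by (auto simp: gQ_def gP_def)
    then show ?thesis by (simp add: I_def)
  next
    case True
    define d where "d = step' (p y - c)"
    have d: "0 \<le> d" "d \<le> 4" by (simp_all add: d_def step'_bounds)
    define G where "G = cmod (gp y)"
    have gQ: "gQ y = d *\<^sub>R gp y" using True by (simp add: gQ_def gP_def d_def)
    have i1: "Im (cnj (gQ y) * g\<phi> y) = d * G\<^sup>2 / a y"
      by (simp only: cross_phi gQ inner_scaleR_left G_def power2_norm_eq_inner)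
    have fD: "\<bar>f y\<bar> \<le> D" using D[OF y] True by (simp add: f_def)
    have "\<bar>f y * Im (cnj (gQ y) * gk y)\<bar> \<le> D * (d * G * (2 * e y * (8 / R)))"
    proof -
      have "\<bar>Im (cnj (gQ y) * gk y)\<bar> \<le> cmod (gQ y) * cmod (gk y)"
        using abs_Im_le_cmod[of "cnj (gQ y) * gk y"] by (simp add: norm_mult)
      also have "\<dots> = d * G * (2 * e y * cmod (ge y))" using d en[of y] by (simp add: gQ ke G_def)
      also have "\<dots> \<le> d * G * (2 * e y * (8 / R))"
        using d en[of y] by (intro mult_left_mono geb) (auto simp: G_def)
      finally show ?thesis unfolding abs_mult using fD by (intro mult_mono) auto
    qed
    also have "\<dots> = d * (2 * (e y * G) * (D * (8/R)))" by simp
    also have "\<dots> \<le> d * ((e y * G)\<^sup>2 / (2 * a y) + 2 * a y * (D * (8/R))\<^sup>2)"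
    proof (intro mult_left_mono d)
      define X where "X = e y * G"
      define Y where "Y = D * (8/R)"
      have ap: "a y > 0" by (rule a_bounds)
      have "0 \<le> (X - 2 * a y * Y)\<^sup>2 / (2 * a y)" using ap by simp
      also have "\<dots> = X\<^sup>2 / (2 * a y) + 2 * a y * Y\<^sup>2 - 2 * X * Y"
        using ap by (simp add: power2_eq_square field_simps)
      finally show "2 * X * Y \<le> X\<^sup>2 / (2 * a y) + 2 * a y * Y\<^sup>2" by simp
    qed
    finally have A: "\<bar>f y * Im (cnj (gQ y) * gk y)\<bar> \<le> d * (e y * G)\<^sup>2 / (2 * a y) + d * (2 * a y * (D * (8/R))\<^sup>2)"
      by (simp add: distrib_left)
    have B: "d * (2 * a y * (D * (8/R))\<^sup>2) \<le> 4 * (2 * M\<^sup>2 * (D * (8/R))\<^sup>2)"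
      using d a_bounds[of y] by (intro mult_mono) auto
    have C: "k y * (d * G\<^sup>2 / a y) = 2 * (d * (e y * G)\<^sup>2 / (2 * a y))" by (simp add: ke power_mult_distrib)
    have "k y * (d * G\<^sup>2 / a y) \<le> 2 * I y + 2 * (4 * (2 * M\<^sup>2 * (D * (8/R))\<^sup>2))"
    proof -
      have "T \<le> 2 * T + 2 * J + 2 * B" if "\<bar>J\<bar> \<le> A1 + B'" "B' \<le> B" "T = 2 * A1" for T J A1 B B' :: real
        using that by linarith
      from this[OF A B C] show ?thesis unfolding I_def i1 distrib_left[of 2] .
    qed
    then have E: "k y * (d * G\<^sup>2 / a y) \<le> 2 * I y + 16 * M\<^sup>2 * D\<^sup>2 * (8/R)\<^sup>2"
      by (simp add: power_mult_distrib power_divide)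
    have "k y * (cmod (gQ y))\<^sup>2 = k y * (d * (d * G\<^sup>2))" using d by (simp add: gQ G_def power2_eq_square)
    also have "\<dots> \<le> k y * (4 * (M\<^sup>2 * (d * G\<^sup>2 / a y)))"
    proof (rule mult_left_mono, rule mult_mono)
      have "a y * (d * G\<^sup>2 / a y) \<le> M\<^sup>2 * (d * G\<^sup>2 / a y)"
        using a_bounds[of y] d by (intro mult_right_mono) auto
      then show "d * G\<^sup>2 \<le> M\<^sup>2 * (d * G\<^sup>2 / a y)" using a_bounds(3)[of y] by simp
    qed (use d in \<open>auto simp: ke\<close>)
    also have "\<dots> = 4 * M\<^sup>2 * (k y * (d * G\<^sup>2 / a y))" by simp
    also have "\<dots> \<le> 4 * M\<^sup>2 * (2 * I y + 16 * M\<^sup>2 * D\<^sup>2 * (8/R)\<^sup>2)"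
      by (intro mult_left_mono E) auto
    finally show ?thesis .
  qed
  have cgQ: "continuous_on UNIV gQ" by (rule cs)
  have "(9/16)^4 * energy gQ z (R/2) = bint z (R/2) (\<lambda>y. (9/16)^4 * (cmod (gQ y))\<^sup>2)"
    by (simp only: bint_cmult)
  also have "\<dots> \<le> bint z (R/2) (\<lambda>y. k y * (cmod (gQ y))\<^sup>2)"
    unfolding k_def
    by (intro bint_mono_cbx mult_right_mono cutf_half R continuous_intros sq_norm_cont cgQ cs[unfolded k_def]) auto
  also have "\<dots> \<le> bint z R (\<lambda>y. k y * (cmod (gQ y))\<^sup>2)"
    using R by (intro bint_subset continuous_intros sq_norm_cont cgQ cs) (auto simp: ke)
  also have "\<dots> \<le> bint z R (\<lambda>y. 4 * M\<^sup>2 * (2 * I y + 16 * M\<^sup>2 * D\<^sup>2 * (8/R)\<^sup>2))"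
    by (intro bint_mono_cbx pt continuous_intros sq_norm_cont cgQ cs Ic)
  also have "\<dots> = 4 * M\<^sup>2 * (2 * 0 + 4 * R\<^sup>2 * (16 * M\<^sup>2 * D\<^sup>2 * (8/R)\<^sup>2))"
    unfolding bint_cmult by (subst bint_add, (intro continuous_intros Ic)+) (use R in \<open>(simp only: bint_cmult I0 bint_const less_imp_le, simp add: mult_ac)\<close>)
  also have "\<dots> = 16384 * (M\<^sup>2 * M\<^sup>2 * D\<^sup>2)" using R by (simp add: power_divide)
  also have "\<dots> \<le> ((9/16)^4 * 10^6) * (M\<^sup>2 * M\<^sup>2 * D\<^sup>2)"
    by (intro mult_right_mono) (auto simp: power_divide)
  finally have "(9/16)^4 * energy gQ z (R/2) \<le> (9/16)^4 * (10^6 * M\<^sup>2 * M\<^sup>2 * D\<^sup>2)"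
    by (simp only: mult.assoc)
  then have "energy gQ z (R/2) \<le> 10^6 * M\<^sup>2 * M\<^sup>2 * D\<^sup>2"
    by (rule mult_left_le_imp_le) simp
  then show ?thesis by (simp only: gQ_def)
qed

text \<open>The squares of half side \<open>\<rho>\<close> about a point of the first boundary curve and about the end of
the gradient trajectory that starts there carry the values 0 and 1 of \<open>P\<close>. Joining
corresponding points by a horizontal and a vertical segment, one family of parallel segments
must consist of segments along which \<open>P\<close> changes noticeably.\<close>

lemma strip_energy_lower:
  assumes s: "s0 \<noteq> s1" and lo: "\<And>z. u z = s0 \<Longrightarrow> p z < c - 1/4" and hi: "\<And>z. u z = s1 \<Longrightarrow> p z > c + 5/4"
  shows "\<exists>r>0. \<exists>e>0. \<forall>y. u y = s0 \<longrightarrow> e \<le> energy (gP s0 s1 c) y r"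
proof -
  define Q where "Q = P s0 s1 c"
  define gQ where "gQ = gP s0 s1 c"
  have Q: "C1_grad Q gQ" unfolding Q_def gQ_def by (rule P_C1[OF s]) (use lo hi in force)+
  define h where "h y = (cmod (gQ y))\<^sup>2" for y
  have hc: "continuous_on UNIV h" unfolding h_def by (intro sq_norm_cont C1_gradD(1)[OF Q])
  have hn: "h y \<ge> 0" for y by (simp add: h_def)
  have hl: "(Re (gQ y))\<^sup>2 \<le> h y" "(Im (gQ y))\<^sup>2 \<le> h y" for y by (simp_all add: h_def cmod_power2)
  obtain \<rho>1 where \<rho>1: "\<rho>1 > 0" "\<And>z y w. min s0 s1 \<le> u z \<Longrightarrow> u z \<le> max s0 s1 \<Longrightarrow> y \<in> cbx z \<rho>1 \<Longrightarrow> w \<in> cbx z \<rho>1 \<Longrightarrow> \<bar>p y - p w\<bar> \<le> 1/4"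
    using strip_uniform[of "1/4" "min s0 s1" "max s0 s1"] by auto
  define \<rho> where "\<rho> = min \<rho>1 (\<bar>s1 - s0\<bar> / (4 * M))"
  have \<rho>: "\<rho> > 0" "\<rho> \<le> \<rho>1" "M * (2 * \<rho>) < \<bar>s1 - s0\<bar>"
  proof -
    show "\<rho> > 0" "\<rho> \<le> \<rho>1" using \<rho>1 s M by (auto simp: \<rho>_def)
    have "\<rho> \<le> \<bar>s1 - s0\<bar> / (4 * M)" by (simp add: \<rho>_def)
    then have "M * (2 * \<rho>) \<le> \<bar>s1 - s0\<bar> / 2" using M by (simp add: field_simps)
    also have "\<dots> < \<bar>s1 - s0\<bar>" using s by simp
    finally show "M * (2 * \<rho>) < \<bar>s1 - s0\<bar>" .
  qed
  have self: "z \<in> cbx z \<rho>1" for z using \<rho>1 by (auto simp: cbx_def)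
  have Q0: "Q y = 0" if z: "u z = s0" and y: "y \<in> cbx z \<rho>" for z y
  proof -
    have "\<bar>p y - p z\<bar> \<le> 1/4" using y \<rho>(2) cbx_mono[of \<rho> \<rho>1 z] z self by (intro \<rho>1(2)[of z]) auto
    then have pc: "p y \<le> c" using lo[OF z] by linarith
    have "\<bar>u y - s0\<bar> < \<bar>s1 - s0\<bar>"
      using u_lip[of y z] mult_left_mono[OF cbx_dist[OF y] less_imp_le[OF M]] \<rho>(3) z by linarith
    then have "level s0 s1 y < 1" using s
      by (cases "s0 < s1") (auto simp: level_def divide_less_eq)
    then show ?thesis using pc by (auto simp: Q_def P_def step_0)
  qed
  have Q1: "Q y = 1" if z: "u z = s1" and y: "y \<in> cbx z \<rho>" for z y
  proof -
    have "\<bar>p y - p z\<bar> \<le> 1/4" using y \<rho>(2) cbx_mono[of \<rho> \<rho>1 z] z self by (intro \<rho>1(2)[of z]) auto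
    then have pc: "p y - c \<ge> 1" using hi[OF z] by linarith
    have "\<bar>u y - s1\<bar> < \<bar>s1 - s0\<bar>"
      using u_lip[of y z] mult_left_mono[OF cbx_dist[OF y] less_imp_le[OF M]] \<rho>(3) z by linarith
    then have "level s0 s1 y > 0" using s
      by (cases "s0 < s1") (auto simp: level_def zero_less_divide_iff)
    then show ?thesis using pc by (auto simp: Q_def P_def step_1)
  qed
  (* Half side of a square that contains both small squares and the segments between them.
     *)
  define r where "r = \<bar>s1 - s0\<bar> / m + \<rho>"
  have r: "r > 0" using \<rho> m by (auto simp: r_def intro!: add_nonneg_pos)
  (* The threshold in \<open>side_bound\<close> for a change of \<open>3/7\<close>; two such changes do not add up to
     1. *)
  define c0 where "c0 = 2 * (1/7)\<^sup>2 / (r/2)"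
  have c0: "c0 > 0" using r by (simp add: c0_def)
  have "\<rho> * c0 \<le> bint y r h" if y: "u y = s0" for y
  proof -
    define w where "w = FX (s1 - s0) y"
    have uw: "u w = s1" by (simp add: w_def u_FX y)
    have "cmod (FX (s1 - s0) y - FX 0 y) \<le> (1 / m) * \<bar>(s1 - s0) - 0\<bar>"
      by (rule ode_speed[OF FX_deriv up_bound])
    then have wy: "cmod (w - y) \<le> \<bar>s1 - s0\<bar> / m" by (simp add: w_def)
    have wyc: "\<bar>Re w - Re y\<bar> \<le> \<bar>s1 - s0\<bar> / m" "\<bar>Im w - Im y\<bar> \<le> \<bar>s1 - s0\<bar> / m"
      using wy abs_Re_le_cmod[of "w - y"] abs_Im_le_cmod[of "w - y"] by auto
    have key: "hline h y r (Im y + t2) > c0 \<or> vline h y r (Re w + t1) > c0"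
      if t: "t1 \<in> {0..\<rho>}" "t2 \<in> {0..\<rho>}" for t1 t2
    proof (rule ccontr)
      assume "\<not> ?thesis"
      then have le: "hline h y r (Im y + t2) \<le> 2 * (1/7)\<^sup>2 / (r/2)" "vline h y r (Re w + t1) \<le> 2 * (1/7)\<^sup>2 / (r/2)" by (auto simp: c0_def)
      have H0: "\<bar>Q (Complex b (Im y + t2)) - Q (Complex a (Im y + t2))\<bar> \<le> 3 * (1/7)"
        if "\<bar>a - Re y\<bar> \<le> r" "\<bar>b - Re y\<bar> \<le> r" "a \<le> b" for a b
        by (rule side_bound[of "\<lambda>x. Q (Complex x (Im y + t2))" "\<lambda>x. Re (gQ (Complex x (Im y + t2)))" "\<lambda>x. h (Complex x (Im y + t2))" "Re y - r" a b "Re y + r" "r/2" "1/7"])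
          (use that r hl le in \<open>auto intro!: C1_grad_fst[OF Q] continuous_on_compose2[OF hc] continuous_intros simp: hline_def abs_le_iff\<close>)
      have V0: "\<bar>Q (Complex (Re w + t1) b) - Q (Complex (Re w + t1) a)\<bar> \<le> 3 * (1/7)"
        if "\<bar>a - Im y\<bar> \<le> r" "\<bar>b - Im y\<bar> \<le> r" "a \<le> b" for a b
        by (rule side_bound[of "\<lambda>x. Q (Complex (Re w + t1) x)" "\<lambda>x. Im (gQ (Complex (Re w + t1) x))" "\<lambda>x. h (Complex (Re w + t1) x)" "Im y - r" a b "Im y + r" "r/2" "1/7"])
          (use that r hl le in \<open>auto intro!: C1_grad_snd[OF Q] continuous_on_compose2[OF hc] continuous_intros simp: vline_def abs_le_iff\<close>)
      have H: "\<bar>Q (Complex b (Im y + t2)) - Q (Complex a (Im y + t2))\<bar> \<le> 3/7" if "\<bar>a - Re y\<bar> \<le> r" "\<bar>b - Re y\<bar> \<le> r" for a b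
        using H0[of a b] H0[of b a] that by (cases "a \<le> b") (auto simp: abs_minus_commute)
      have V: "\<bar>Q (Complex (Re w + t1) b) - Q (Complex (Re w + t1) a)\<bar> \<le> 3/7" if "\<bar>a - Im y\<bar> \<le> r" "\<bar>b - Im y\<bar> \<le> r" for a b
        using V0[of a b] V0[of b a] that by (cases "a \<le> b") (auto simp: abs_minus_commute)
      have "\<bar>Q (Complex (Re w + t1) (Im y + t2)) - Q (Complex (Re y + t1) (Im y + t2))\<bar> \<le> 3/7"
        using wyc t m by (intro H) (auto simp: r_def)
      moreover have "\<bar>Q (Complex (Re w + t1) (Im w + t2)) - Q (Complex (Re w + t1) (Im y + t2))\<bar> \<le> 3/7"
        using wyc t m by (intro V) (auto simp: r_def)
      moreover have "Q (Complex (Re y + t1) (Im y + t2)) = 0" using t by (intro Q0[OF y]) (auto simp: cbx_def)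
      moreover have "Q (Complex (Re w + t1) (Im w + t2)) = 1" using t by (intro Q1[OF uw]) (auto simp: cbx_def)
      ultimately show False by linarith
    qed
    have lb: "\<rho> * c0 \<le> integral {A - r..A + r} F"
      if F: "continuous_on UNIV F" "\<And>x. F x \<ge> 0" "\<And>t. t \<in> {0..\<rho>} \<Longrightarrow> F (B + t) > c0" and AB: "\<bar>B - A\<bar> \<le> \<bar>s1 - s0\<bar> / m" for F :: "real \<Rightarrow> real" and A B
    proof -
      have i: "F integrable_on {s..t}" for s t by (intro integrable_continuous_interval continuous_on_subset[OF F(1)]) auto
      have "\<rho> * c0 = integral {B..B+\<rho>} (\<lambda>_. c0)" using \<rho> by simp
      also have "\<dots> \<le> integral {B..B+\<rho>} F"
      proof (intro integral_le i)
        fix x assume "x \<in> {B..B+\<rho>}"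
        then show "c0 \<le> F x" using F(3)[of "x - B"] by simp
      qed auto
      also have "\<dots> \<le> integral {A - r..A + r} F"
        using AB \<rho> F(2) by (intro integral_subset_le i) (auto simp: r_def abs_le_iff)
      finally show ?thesis .
    qed
    have ln: "vline h y r x \<ge> 0" "hline h y r x \<ge> 0" for x
      unfolding vline_def hline_def
      by (auto intro!: integral_nonneg integrable_continuous_interval continuous_on_compose2[OF hc] continuous_intros hn)
    show ?thesis
    proof (cases "\<forall>t2\<in>{0..\<rho>}. hline h y r (Im y + t2) > c0")
      case True
      have "\<rho> * c0 \<le> integral {Im y - r..Im y + r} (hline h y r)"
        using True m by (intro lb[of _ "Im y"] line_cont[OF hc] ln) auto
      then show ?thesis by (simp add: bint_iter2[OF hc] hline_def[abs_def])
    next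
      case False
      then have "\<forall>t1\<in>{0..\<rho>}. vline h y r (Re w + t1) > c0" using key by blast
      then have "\<rho> * c0 \<le> integral {Re y - r..Re y + r} (vline h y r)"
        using wyc by (intro lb[of _ "Re w"] line_cont[OF hc] ln) auto
      then show ?thesis by (simp add: bint_iter1[OF hc] vline_def[abs_def])
    qed
  qed
  then have "\<forall>y. u y = s0 \<longrightarrow> \<rho> * c0 \<le> bint y r h" by blast
  moreover have "\<rho> * c0 > 0" using \<rho>(1) c0 by simp
  ultimately show ?thesis using r unfolding h_def[abs_def] gQ_def by blast
qed

lemma bint_disjoint:
  fixes h :: "complex \<Rightarrow> real"
  assumes h: "continuous_on UNIV h" "\<And>y. 0 \<le> h y" and sub: "cbx y r \<subseteq> cbx z R'" "R \<le> R'" and dis: "cbx y r \<inter> cbx z R = {}"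

  shows "bint z R h + bint y r h \<le> bint z R' h"
proof -
  define B where "B z r = cbox (Re z - r, Im z - r) (Re z + r, Im z + r)" for z r
  have Bc: "q \<in> B z r \<longleftrightarrow> Complex (fst q) (snd q) \<in> cbx z r" for q z r
    by (cases q) (auto simp: B_def cbx_def abs_le_iff)
  let ?f = "\<lambda>q::real\<times>real. h (Complex (fst q) (snd q))"
  have i: "?f integrable_on B z r" for z r unfolding B_def by (rule bint_integrable[OF h(1)])
  have neg: "negligible (B z R \<inter> B y r)"
  proof -
    have "B z R \<inter> B y r = {}" using dis Bc by blast
    then show ?thesis by simp
  qed
  have iu: "?f integrable_on (B z R \<union> B y r)" by (rule integrable_Un[OF neg i i])
  have "bint z R h + bint y r h = integral (B z R \<union> B y r) ?f"
    unfolding bint_def B_def[symmetric] by (rule integral_Un[OF i i neg, symmetric])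
  also have "\<dots> \<le> integral (B z R') ?f"
  proof (intro integral_subset_le iu i)
    show "B z R \<union> B y r \<subseteq> B z R'" using sub(1) cbx_mono[OF sub(2), of z] Bc by blast
  qed (use h in auto)
  finally show ?thesis by (simp add: bint_def B_def)
qed

text \<open>The level set is a connected curve that leaves every square.\<close>

lemma level_point_at_distance:
  assumes "T \<ge> 0"
  shows "\<exists>y. u y = u x \<and> max \<bar>Re y - Re x\<bar> \<bar>Im y - Im x\<bar> = T"
proof -
  define N where "N t = max \<bar>Re (FY t x) - Re x\<bar> \<bar>Im (FY t x) - Im x\<bar>" for t
  have Nc: "continuous_on S N" for S unfolding N_def by (intro continuous_intros FY_cont)
  have "\<exists>t. N t > T"
  proof (rule ccontr)
    assume "\<not> ?thesis"
    then have le: "N t \<le> T" for t by (meson not_le)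
    have "{y. u y = u x} \<subseteq> cbx x T"
    proof
      fix y assume "y \<in> {y. u y = u x}"
      then obtain t where "y = FY t x" using level_orbit by blast
      then show "y \<in> cbx x T" using le[of t] by (simp add: N_def cbx_def)
    qed
    then have "bounded {y. u y = u x}" using compact_imp_bounded[OF compact_cbx] bounded_subset by blast
    then show False using level_not_compact by blast
  qed
  then obtain t where t: "N t > T" by blast
  have N0: "N 0 = 0" by (simp add: N_def)
  have "\<exists>s. N s = T"
  proof (cases "t \<ge> 0")
    case True
    then show ?thesis using IVT'[of N 0 T t] N0 assms t Nc by auto
  next
    case False
    then show ?thesis using IVT2'[of N 0 T t] N0 assms t Nc by auto
  qed
  then show ?thesis using u_FY by (metis N_def)
qed

text \<open>The squares about points of the level set at distances \<open>2 r\<close>, \<open>5 r\<close>, \<open>8 r\<close>, \<open>\<dots>\<close> from \<open>x\<close> are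
disjoint.\<close>

lemma energy_linear:
  assumes h: "continuous_on UNIV h" "\<And>y. 0 \<le> h y" and r: "r > 0"
    and e: "\<And>y. u y = u x \<Longrightarrow> e \<le> bint y r h"
  shows "real j * e \<le> bint x (3 * r * real j) h"
proof (induction j)
  case 0
  show ?case using bint_nonneg[OF h, of x 0] by simp
next
  case (Suc j)
  define R where "R = 3 * r * real j"
  have R: "R \<ge> 0" using r by (simp add: R_def)
  obtain y where y: "u y = u x" "max \<bar>Re y - Re x\<bar> \<bar>Im y - Im x\<bar> = R + 2 * r"
    using level_point_at_distance[of "R + 2 * r" x] R r by auto
  have "bint x R h + bint y r h \<le> bint x (R + 3 * r) h"
  proof (rule bint_disjoint[OF h])
    have "\<bar>Re y - Re x\<bar> \<le> R + 2*r" "\<bar>Im y - Im x\<bar> \<le> R + 2*r" using y(2) by linarith+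
    then show "cbx y r \<subseteq> cbx x (R + 3 * r)" unfolding cbx_def by auto
    show "cbx y r \<inter> cbx x R = {}"
    proof -
      have "\<bar>Re y - Re x\<bar> = R + 2*r \<or> \<bar>Im y - Im x\<bar> = R + 2*r" using y(2) by linarith
      then show ?thesis using r by (auto simp: cbx_def)
    qed
  qed (use r in auto)
  then show ?case using Suc e[OF y(1)] by (simp add: R_def algebra_simps)
qed

text \<open>Multiply by \<open>x^(2 n)\<close>, where \<open>x\<close> is the inverse square root of \<open>lam\<close>.\<close>

lemma exp_beats_square:
  fixes lam A B C D :: real
  assumes lam: "lam > 1" and A: "A > 0"
  shows "\<exists>n. A * lam ^ n > B * (C + D * real n)\<^sup>2 + E"
proof -
  define x where "x = 1 / sqrt lam"
  have x: "norm x < 1" "x > 0" using lam by (auto simp: x_def)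
  have xx: "(x ^ n)\<^sup>2 * lam ^ n = 1" for n
    using lam by (simp add: x_def power_mult_distrib[symmetric] power_divide power_mult[symmetric] mult.commute[of n 2] power_mult)
  have l: "(\<lambda>n. B * (C * x ^ n + D * (real n * x ^ n))\<^sup>2 + E * (x ^ n)\<^sup>2) \<longlonglongrightarrow> B * (C * 0 + D * 0)\<^sup>2 + E * 0\<^sup>2"
    by (intro tendsto_intros LIMSEQ_power_zero x powser_times_n_limit_0)
  then have "eventually (\<lambda>n. B * (C * x ^ n + D * (real n * x ^ n))\<^sup>2 + E * (x ^ n)\<^sup>2 < A) sequentially"
    using A by (intro order_tendstoD) auto
  then obtain n where n: "B * (C * x ^ n + D * (real n * x ^ n))\<^sup>2 + E * (x ^ n)\<^sup>2 < A"
    using eventually_happens'[OF sequentially_bot] by blast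
  have "B * (C * x ^ n + D * (real n * x ^ n))\<^sup>2 + E * (x ^ n)\<^sup>2 = (B * (C + D * real n)\<^sup>2 + E) * (x ^ n)\<^sup>2"
    by (simp add: power2_eq_square algebra_simps)
  then have "(B * (C + D * real n)\<^sup>2 + E) * (x ^ n)\<^sup>2 * lam ^ n < A * lam ^ n"
    using n lam by (intro mult_strict_right_mono) auto
  then show ?thesis using xx[of n] by (auto simp: mult.assoc)
qed

text \<open>If \<open>j\<close> is chosen of the order of \<open>lam ^ n\<close>, the energy of the truncated pressure on a square
of size proportional to \<open>j\<close> is at least proportional to \<open>lam ^ n\<close> and at most of the order
of \<open>n^2\<close>.\<close>

theorem pressure_bounded: "\<exists>K. \<forall>z. \<bar>p z\<bar> \<le> K"
proof (rule ccontr)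
  assume unb: "\<not> ?thesis"
  define C0 where "C0 = M\<^sup>2"
  have C0: "C0 \<ge> 0" by (simp add: C0_def)
  have "\<exists>x0 x1. p x1 - p x0 > 2 * C0 + 2"
  proof -
    obtain z where "\<bar>p z\<bar> > \<bar>p 0\<bar> + 2 * C0 + 2" using unb by (meson not_le)
    then have "p z - p 0 > 2 * C0 + 2 \<or> p 0 - p z > 2 * C0 + 2" by linarith
    then show ?thesis by blast
  qed
  then obtain x0 x1 where x: "p x1 - p x0 > 2 * C0 + 2" by blast
  define s0 where "s0 = u x0"
  define s1 where "s1 = u x1"
  (* The truncation level leaves a margin on both curves: \<open>p\<close> is at most \<open>c - 1/2\<close> on the
     first and at least \<open>c + 3/2\<close> on the second. *)
  define c where "c = p x0 + C0 + 1/2"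
  have s: "s0 \<noteq> s1"
  proof
    assume "s0 = s1"
    then have "\<bar>p x1 - p x0\<bar> \<le> C0" unfolding C0_def s0_def s1_def by (intro bernoulli) simp
    then show False using x C0 by linarith
  qed
  have lo: "p z < c - 1/4" if "u z = s0" for z using bernoulli[of z x0] that by (simp add: s0_def c_def C0_def)
  have hi: "p z > c + 5/4" if "u z = s1" for z using bernoulli[of z x1] that x by (simp add: s1_def c_def C0_def)
  have lo': "p z < c" if "u z = s0" for z using lo[OF that] by simp
  have hi': "p z > c + 1" if "u z = s1" for z using hi[OF that] by simp
  define h where "h y = (cmod (gP s0 s1 c y))\<^sup>2" for y
  have hc: "continuous_on UNIV h" unfolding h_def by (intro sq_norm_cont C1_gradD(1)[OF P_C1[OF s lo' hi']])
  obtain r e where r: "r > 0" and e: "e > 0" and re: "\<And>y. u y = s0 \<Longrightarrow> e \<le> bint y r h"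
    using strip_energy_lower[OF s lo hi] unfolding h_def by blast
  have lower: "real j * e \<le> bint x0 (3 * r * real j) h" for j
    by (rule energy_linear[OF hc _ r]) (use re in \<open>auto simp: h_def s0_def\<close>)
  obtain C K where K: "K > 0" and CK: "\<And>x y n d. min s0 s1 \<le> u x \<and> u x \<le> max s0 s1 \<and> min s0 s1 \<le> u y \<and> u y \<le> max s0 s1 \<and> cmod (x - y) \<le> d \<and> K * (d + 1) \<le> (1 + m / (2 * M)) ^ n
     \<Longrightarrow> \<bar>\<phi> x - \<phi> y\<bar> \<le> C + 2 * pi * real n"
    using strip_angle_growth[of "min s0 s1" "max s0 s1"] by blast
  define lam where "lam = 1 + m / (2 * M)"
  have lam: "lam > 1" using m M by (simp add: lam_def)
  have upper: "real j * e \<le> 10^6 * M\<^sup>2 * M\<^sup>2 * (C + 2 * pi * real n)\<^sup>2"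
    if j: "K * (12 * r * real j + 1) \<le> lam ^ n" "j > 0" for j n
  proof -
    define R where "R = 6 * r * real j"
    have R: "R > 0" using r j by (simp add: R_def)
    have R2: "R / 2 = 3 * r * real j" by (simp add: R_def)
    have "energy (gP s0 s1 c) x0 (R/2) \<le> 10^6 * M\<^sup>2 * M\<^sup>2 * (C + 2 * pi * real n)\<^sup>2"
    proof (rule strip_energy_bound[OF s lo' hi' R])
      fix y assume y: "y \<in> cbx x0 R" and l: "0 < level s0 s1 y" "level s0 s1 y < 1"
      have "min s0 s1 \<le> u y \<and> u y \<le> max s0 s1"
        using l s by (cases "s0 < s1") (auto simp: level_def zero_less_divide_iff divide_less_eq)
      moreover have "cmod (y - x0) \<le> 12 * r * real j" using cbx_dist[OF y] by (simp add: R_def)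
      ultimately show "\<bar>\<phi> y - \<phi> x0\<bar> \<le> C + 2 * pi * real n"
        using j(1) by (intro CK[of _ _ "12 * r * real j"]) (auto simp: s0_def lam_def)
    qed
    then have "energy (gP s0 s1 c) x0 (3 * r * real j) \<le> 10^6 * M\<^sup>2 * M\<^sup>2 * (C + 2 * pi * real n)\<^sup>2"
      by (simp only: R2)
    then show ?thesis using lower[of j] unfolding h_def[abs_def] by linarith
  qed
  define A where "A = e / (K * (12 * r))"
  have A: "A > 0" using e K r by (simp add: A_def)
  obtain n where n: "A * lam ^ n > 10^6 * M\<^sup>2 * M\<^sup>2 * (C + 2 * pi * real n)\<^sup>2 + (A * K + 2 * e)"
    using exp_beats_square[OF lam A] by blast
  (* The largest \<open>j\<close> for which \<open>upper\<close> applies is the integer part of \<open>t\<close>. *)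
  define t where "t = (lam ^ n / K - 1) / (12 * r)"
  have te: "t * e = A * lam ^ n - A * K" using K r by (simp add: t_def A_def field_simps)
  have t: "t * e > 10^6 * M\<^sup>2 * M\<^sup>2 * (C + 2 * pi * real n)\<^sup>2 + 2 * e" using n te by linarith
  moreover have "0 \<le> 10^6 * M\<^sup>2 * M\<^sup>2 * (C + 2 * pi * real n)\<^sup>2" by simp
  ultimately have "t * e > 2 * e" by linarith
  then have t2: "t > 2" using e by simp
  define j where "j = nat \<lfloor>t\<rfloor>"
  have j: "real j \<le> t" "t < real j + 1" "j > 0" using t2 by (auto simp: j_def)
  have "K * (12 * r * real j + 1) \<le> K * (12 * r * t + 1)" using K r j(1) by simp
  also have "\<dots> = lam ^ n" using K r by (simp add: t_def)
  finally have "real j * e \<le> 10^6 * M\<^sup>2 * M\<^sup>2 * (C + 2 * pi * real n)\<^sup>2" using upper j(3) by blast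
  moreover have "t * e \<le> (real j + 1) * e" using j e by (intro mult_right_mono) auto
  then have "t * e \<le> real j * e + e" by (simp add: distrib_right)
  ultimately show False using t e by linarith
qed

corollary angle_const: "\<phi> z = \<phi> w"
  using pressure_bounded bounded_p_imp_const by blast

end

section \<open>From the plane flow to the shear flow\<close>

lemma C1_grad_unique:
  assumes "C1_grad f g" "C1_grad f' g'" "\<And>z. f z = f' z" shows "g z = g' z"
proof -
  have "f = f'" using assms(3) by (rule ext)
  then have "(\<lambda>h. g z \<bullet> h) = (\<lambda>h. g' z \<bullet> h)"
    using has_derivative_unique[OF C1_gradD(2)[OF assms(1), of z]] C1_gradD(2)[OF assms(2), of z] by blast
  then have "(g z - g' z) \<bullet> (g z - g' z) = 0" by (metis inner_diff_left right_minus_eq)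
  then show ?thesis by simp
qed

lemma C1_grad_diff:
  assumes "C1_grad f g" "C1_grad f' g'" shows "C1_grad (\<lambda>z. f z - f' z) (\<lambda>z. g z - g' z)"
  by (rule C1_grad_cong[OF C1_grad_add[OF assms(1) C1_grad_cmult[OF assms(2), of "-1"]]]) simp_all

lemma C1_grad_inverse:
  assumes f: "C1_grad f g" and nz: "\<And>z. f z \<noteq> 0"
  shows "\<exists>G. C1_grad (\<lambda>z. 1 / f z) G"
proof -
  have "C1_grad (\<lambda>z. 1 / f z) (\<lambda>z. (- (1 / (f z)\<^sup>2)) *\<^sub>R g z)"
    unfolding C1_grad_def
  proof (intro conjI allI)
    show "continuous_on UNIV (\<lambda>z. (- (1 / (f z)\<^sup>2)) *\<^sub>R g z)"
      using nz by (intro continuous_intros C1_gradD(1)[OF f] C1_gradD(3)[OF f]) auto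
    fix z
    have "((\<lambda>x. 1 / x) has_real_derivative - (1 / (f z)\<^sup>2)) (at (f z))"
      using nz[of z] by (auto intro!: derivative_eq_intros simp: power2_eq_square)
    from has_derivative_compose[OF C1_gradD(2)[OF f, of z] this[unfolded has_field_derivative_def]]
    show "((\<lambda>z. 1 / f z) has_derivative (\<lambda>h. (- (1 / (f z)\<^sup>2)) *\<^sub>R g z \<bullet> h)) (at z)" by simp
  qed
  then show ?thesis by blast
qed

text \<open>Near a given point the continuous lift is a branch of the imaginary part of the logarithm of
\<open>w\<close>, up to a constant.\<close>

lemma angle_gradient:
  fixes w :: "complex \<Rightarrow> complex"
  assumes a: "C1_grad (\<lambda>z. Re (w z)) ga" and b: "C1_grad (\<lambda>z. Im (w z)) gb" and nz: "\<And>z. w z \<noteq> 0"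
  shows "\<exists>\<phi>. C1_grad \<phi> (\<lambda>z. (1 / (cmod (w z))\<^sup>2) *\<^sub>R (Re (w z) *\<^sub>R gb z - Im (w z) *\<^sub>R ga z))
     \<and> (\<forall>z. w z = of_real (cmod (w z)) * cis (\<phi> z))"
proof -
  have wc: "continuous_on UNIV w"
    using Complex_cont[OF C1_gradD(3)[OF a] C1_gradD(3)[OF b]] by simp
  have "\<exists>\<phi>. angle_lift UNIV w \<phi>"
    by (rule angle_lift_exists[OF wc]) (use nz in \<open>auto simp: convex_imp_contractible\<close>)
  then obtain \<phi> where \<phi>: "angle_lift UNIV w \<phi>" ..
  have pol: "w z = of_real (cmod (w z)) * cis (\<phi> z)" for z using \<phi> by (auto simp: angle_lift_def)
  have \<phi>c: "continuous_on UNIV \<phi>" using \<phi> by (simp add: angle_lift_def)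
  define g where "g z = (1 / (cmod (w z))\<^sup>2) *\<^sub>R (Re (w z) *\<^sub>R gb z - Im (w z) *\<^sub>R ga z)" for z
  have gc: "continuous_on UNIV g"
    unfolding g_def using nz by (intro continuous_intros wc C1_gradD(1)[OF a] C1_gradD(1)[OF b]) auto
  have "(\<phi> has_derivative (\<lambda>h. g z \<bullet> h)) (at z)" for z
  proof -
    define q where "q y = w y / w z" for y
    have wd: "(w has_derivative (\<lambda>h. Complex (ga z \<bullet> h) (gb z \<bullet> h))) (at z)"
    proof -
      have "((\<lambda>y. of_real (Re (w y)) + \<i> * of_real (Im (w y))) has_derivative (\<lambda>h. of_real (ga z \<bullet> h) + \<i> * of_real (gb z \<bullet> h))) (at z)"
        by (intro has_derivative_add has_derivative_mult_right has_derivative_of_real C1_gradD(2)[OF a] C1_gradD(2)[OF b])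
      then show ?thesis by (simp add: Complex_eq flip: complex_eq)
    qed
    have qd: "(q has_derivative (\<lambda>h. Complex (ga z \<bullet> h) (gb z \<bullet> h) / w z)) (at z)"
      unfolding q_def divide_inverse by (rule has_derivative_mult_left[OF wd])
    have q1: "q z = 1" using nz by (simp add: q_def)
    have "(Ln has_field_derivative 1) (at (q z))"
      unfolding q1 by (rule DERIV_cong[OF has_field_derivative_Ln]) auto
    then have "(Ln has_derivative (\<lambda>h. 1 * h)) (at (q z))" by (simp only: has_field_derivative_def)
    from has_derivative_compose[OF qd this]
    have "((\<lambda>y. Im (Ln (q y))) has_derivative (\<lambda>h. Im (1 * (Complex (ga z \<bullet> h) (gb z \<bullet> h) / w z)))) (at z)"
      by (rule bounded_linear.has_derivative[OF bounded_linear_Im])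
    moreover have "Im (1 * (Complex (ga z \<bullet> h) (gb z \<bullet> h) / w z)) = g z \<bullet> h" for h
      by (simp add: g_def Im_divide inner_diff_left cmod_power2 algebra_simps diff_divide_distrib)
    ultimately have "((\<lambda>y. Im (Ln (q y))) has_derivative (\<lambda>h. g z \<bullet> h)) (at z)" by simp
    then have d1: "((\<lambda>y. Im (Ln (q y)) + \<phi> z) has_derivative (\<lambda>h. g z \<bullet> h)) (at z)"
      by (rule has_derivative_add_const)
    have "isCont \<phi> z" using \<phi>c by (simp add: continuous_on_eq_continuous_at)
    then have "(\<phi> \<longlongrightarrow> \<phi> z) (nhds z)" by (simp add: isCont_def tendsto_at_iff_tendsto_nhds)
    then have "eventually (\<lambda>y. dist (\<phi> y) (\<phi> z) < 1) (nhds z)" by (rule tendstoD) simp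
    then obtain U where U: "open U" "z \<in> U" "\<And>y. y \<in> U \<Longrightarrow> dist (\<phi> y) (\<phi> z) < 1"
      unfolding eventually_nhds by blast
    have eq: "Im (Ln (q y)) + \<phi> z = \<phi> y" if "y \<in> U" for y
    proof -
      have "q y = (of_real (cmod (w y)) * cis (\<phi> y)) / (of_real (cmod (w z)) * cis (\<phi> z))"
        unfolding q_def using pol[of y] pol[of z] by (rule arg_cong2)
      then have "q y = of_real (cmod (w y) / cmod (w z)) * cis (\<phi> y - \<phi> z)"
        by (simp add: cis_divide[symmetric])
      moreover have "cmod (w y) / cmod (w z) > 0" using nz by simp
      moreover have "- pi < \<phi> y - \<phi> z" "\<phi> y - \<phi> z \<le> pi"
        using U(3)[OF that] pi_gt3 by (auto simp: dist_real_def abs_less_iff)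
      ultimately have "Arg (q y) = \<phi> y - \<phi> z"
        by (intro Arg_unique[where r="cmod (w y) / cmod (w z)"]) (auto simp: cis_conv_exp)
      moreover have "q y \<noteq> 0" using nz by (simp add: q_def)
      ultimately show ?thesis by (simp add: Arg_eq_Im_Ln)
    qed
    show ?thesis by (rule has_derivative_transform_within_open[OF d1 U(1,2) eq])
  qed
  then have "C1_grad \<phi> g" using gc by (simp add: C1_grad_def)
  then show ?thesis using pol unfolding g_def by blast
qed

lemma (in stream) const_on_levels:
  assumes b: "C1_grad b gb" and z: "\<And>z. gb z \<bullet> along z = 0" and eq: "u x = u y"
  shows "b x = b y"
proof -
  obtain t where t: "x = FY t y" using level_orbit[OF eq] by blast
  have "((\<lambda>s. b (FY s y)) has_real_derivative 0) (at s)" for s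
    using C1_grad_along[OF b FY_deriv[of y s]] z by simp
  then have "b (FY t y) = b (FY 0 y)" by (intro DERIV_isconst_all) auto
  then show ?thesis using t by simp
qed

text \<open>The Euler system in complex notation. The divergence condition gives the stream function;
the momentum equation, rewritten with the gradient of the angle, is the conjugacy of \<open>p\<close> and
\<open>\<phi>\<close>, and dotted with the velocity it is Bernoulli's law.\<close>

theorem euler_plane_direction:
  fixes v1 v2 p :: "complex \<Rightarrow> real"
  assumes v1: "C1_grad v1 g1" and v2: "C1_grad v2 g2" and p: "C1_grad p gp"
    and d11: "C1_grad (\<lambda>z. Re (g1 z)) h11" and d12: "C1_grad (\<lambda>z. Im (g1 z)) h12"
    and d21: "C1_grad (\<lambda>z. Re (g2 z)) h21" and d22: "C1_grad (\<lambda>z. Im (g2 z)) h22"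
    and eul1: "\<And>z. v1 z * Re (g1 z) + v2 z * Im (g1 z) + Re (gp z) = 0"
    and eul2: "\<And>z. v1 z * Re (g2 z) + v2 z * Im (g2 z) + Im (gp z) = 0"
    and dvg: "\<And>z. Re (g1 z) + Im (g2 z) = 0"
    and m: "m > 0" and lower: "\<And>z. m \<le> cmod (Complex (v1 z) (v2 z))" and upper: "\<And>z. cmod (Complex (v1 z) (v2 z)) \<le> M"
  shows "\<exists>\<theta>. \<forall>z. Complex (v1 z) (v2 z) = of_real (cmod (Complex (v1 z) (v2 z))) * cis \<theta>"
proof -
  define gu where "gu z = Complex (v2 z) (- v1 z)" for z
  have gun: "cmod (gu z) = cmod (Complex (v1 z) (v2 z))" for z by (simp add: gu_def cmod_def add.commute)
  have gunz: "gu z \<noteq> 0" for z using lower[of z] m gun[of z] by auto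
  have gu_Re: "C1_grad (\<lambda>z. Re (gu z)) g2" using v2 by (simp add: gu_def)
  have gu_Im: "C1_grad (\<lambda>z. Im (gu z)) (\<lambda>z. - g1 z)"
    using C1_grad_cmult[OF v1, of "-1"] by (simp add: gu_def)
  have "closed_form gu"
    unfolding closed_form_def using gu_Re gu_Im dvg by (intro exI[of _ g2] exI[of _ "\<lambda>z. - g1 z"]) (auto simp: eq_neg_iff_add_eq_0 add.commute)
  then obtain u where u: "C1_grad u gu" using potential_exists by blast
  interpret stream u gu M m
    by standard (use u C1_loc_lip[OF gu_Re gu_Im] m lower upper gun in auto)
  define a where "a z = v1 z * v1 z + v2 z * v2 z" for z
  have a_eq: "(cmod (gu z))\<^sup>2 = a z" for z
    unfolding cmod_power2 by (simp add: gu_def a_def power2_eq_square add.commute)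
  have anz: "a z \<noteq> 0" for z using gunz[of z] by (simp flip: a_eq)
  have ga: "C1_grad a (\<lambda>z. (v1 z *\<^sub>R g1 z + v1 z *\<^sub>R g1 z) + (v2 z *\<^sub>R g2 z + v2 z *\<^sub>R g2 z))"
    unfolding a_def by (intro C1_grad_add C1_grad_mult v1 v2)
  obtain gi where gi: "C1_grad (\<lambda>z. 1 / a z) gi" using C1_grad_inverse[OF ga anz] by blast
  obtain \<phi> where \<phi>: "C1_grad \<phi> (\<lambda>z. (1 / (cmod (gu z))\<^sup>2) *\<^sub>R (Re (gu z) *\<^sub>R - g1 z - Im (gu z) *\<^sub>R g2 z))"
    and ang: "\<And>z. gu z = of_real (cmod (gu z)) * cis (\<phi> z)"
    using angle_gradient[OF gu_Re gu_Im gunz] by blast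
  define g\<phi> where "g\<phi> z = (1 / (cmod (gu z))\<^sup>2) *\<^sub>R (Re (gu z) *\<^sub>R - g1 z - Im (gu z) *\<^sub>R g2 z)" for z
  have R\<phi>: "Re (g\<phi> z) = 1 / a z * (v1 z * Re (g2 z) - v2 z * Re (g1 z))" and I\<phi>: "Im (g\<phi> z) = 1 / a z * (v1 z * Im (g2 z) - v2 z * Im (g1 z))" for z
    unfolding g\<phi>_def a_eq by (simp_all add: gu_def)
  have gpR: "Re (gp z) = (-1) * (v1 z * Re (g1 z) + v2 z * Im (g1 z))" and gpI: "Im (gp z) = (-1) * (v1 z * Re (g2 z) + v2 z * Im (g2 z))" for z
    using eul1[of z] eul2[of z] unfolding mult_minus1 by (simp_all only: eq_neg_iff_add_eq_0 add.commute)
  have conj: "gp z = - \<i> * of_real ((cmod (gu z))\<^sup>2) * g\<phi> z" for z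
  proof -
    have "Im (g2 z) = - Re (g1 z)" using dvg[of z] by linarith
    then show ?thesis unfolding a_eq using anz[of z]
      by (simp add: complex_eq_iff R\<phi> I\<phi> gpR gpI algebra_simps)
  qed
  obtain A1 B1 where "C1_grad (\<lambda>z. Re (g\<phi> z)) A1" "C1_grad (\<lambda>z. Im (g\<phi> z)) B1"
    unfolding R\<phi> I\<phi>
    using C1_grad_mult[OF gi C1_grad_diff[OF C1_grad_mult[OF v1 d21] C1_grad_mult[OF v2 d11]]]
      C1_grad_mult[OF gi C1_grad_diff[OF C1_grad_mult[OF v1 d22] C1_grad_mult[OF v2 d12]]] by blast
  then have g\<phi>_closed: "closed_form g\<phi>"
    using closed_form_gradient[OF \<phi>[folded g\<phi>_def]] unfolding closed_form_def by blast
  obtain A2 B2 where "C1_grad (\<lambda>z. Re (gp z)) A2" "C1_grad (\<lambda>z. Im (gp z)) B2"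
    unfolding gpR gpI
    using C1_grad_cmult[OF C1_grad_add[OF C1_grad_mult[OF v1 d11] C1_grad_mult[OF v2 d12]], of "-1"]
      C1_grad_cmult[OF C1_grad_add[OF C1_grad_mult[OF v1 d21] C1_grad_mult[OF v2 d22]], of "-1"] by blast
  then have gp_closed: "closed_form gp"
    using closed_form_gradient[OF p] unfolding closed_form_def by blast
  have bern: "\<bar>p x - p y\<bar> \<le> M\<^sup>2" if xy: "u x = u y" for x y
  proof -
    define b where "b z = p z + (1/2) * a z" for z
    define gb where "gb z = gp z + (1/2) *\<^sub>R ((v1 z *\<^sub>R g1 z + v1 z *\<^sub>R g1 z) + (v2 z *\<^sub>R g2 z + v2 z *\<^sub>R g2 z))" for z
    have b: "C1_grad b gb" unfolding b_def gb_def by (intro C1_grad_add C1_grad_cmult p ga)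
    have "gb z \<bullet> along z = 0" for z
      by (simp add: gb_def along_def gu_def inner_complex_def gpR gpI algebra_simps)
    then have "b x = b y" using const_on_levels[OF b _ xy] by blast
    moreover have "0 \<le> a z" "a z \<le> M\<^sup>2" for z
      using upper[of z] gun[of z] by (auto simp flip: a_eq intro!: power_mono)
    ultimately show ?thesis using \<open>\<And>z. a z \<le> M\<^sup>2\<close>[of x] \<open>\<And>z. a z \<le> M\<^sup>2\<close>[of y] \<open>\<And>z. 0 \<le> a z\<close>[of x] \<open>\<And>z. 0 \<le> a z\<close>[of y]
      unfolding b_def abs_le_iff by linarith
  qed
  interpret euler u gu M m p gp \<phi> g\<phi>
    by standard (use p \<phi> gp_closed g\<phi>_closed conj ang bern in \<open>auto simp: g\<phi>_def[abs_def]\<close>)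
  have "Complex (v1 z) (v2 z) = of_real (cmod (Complex (v1 z) (v2 z))) * cis (\<phi> 0 + pi / 2)" for z
  proof -
    have "Complex (v1 z) (v2 z) = \<i> * gu z" by (simp add: gu_def complex_eq_iff)
    also have "\<dots> = of_real (cmod (gu z)) * (cis (\<phi> 0) * \<i>)"
      by (subst ang) (simp add: angle_const[of z 0])
    also have "cis (\<phi> 0) * \<i> = cis (\<phi> 0 + pi / 2)" by (simp flip: cis_mult)
    finally show ?thesis by (simp add: gun)
  qed
  then show ?thesis by blast
qed

text \<open>If both components are constant multiples of the speed \<open>w\<close>, the divergence is the derivative
of \<open>w\<close> in the direction of the flow.\<close>

lemma parallel_divfree_const:
  fixes v1 v2 :: "complex \<Rightarrow> real"
  assumes v1: "C1_grad v1 g1" and v2: "C1_grad v2 g2" and dvg: "\<And>z. Re (g1 z) + Im (g2 z) = 0"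
    and dir: "\<And>z. Complex (v1 z) (v2 z) = of_real (cmod (Complex (v1 z) (v2 z))) * cis \<theta>"
  shows "cmod (Complex (v1 (z + of_real t * cis \<theta>)) (v2 (z + of_real t * cis \<theta>))) = cmod (Complex (v1 z) (v2 z))"
proof -
  define w where "w z = cmod (Complex (v1 z) (v2 z))" for z
  have e: "v1 z = cos \<theta> * w z" "v2 z = sin \<theta> * w z" for z
    using arg_cong[OF dir[of z], of Re] arg_cong[OF dir[of z], of Im] by (simp_all add: w_def mult.commute)
  have "w z = cos \<theta> * v1 z + sin \<theta> * v2 z" for z
  proof -
    have "cos \<theta> * v1 z + sin \<theta> * v2 z = ((cos \<theta>)\<^sup>2 + (sin \<theta>)\<^sup>2) * w z"
      by (simp only: e power2_eq_square distrib_right mult.assoc)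
    then show ?thesis by simp
  qed
  then have w: "C1_grad w (\<lambda>z. cos \<theta> *\<^sub>R g1 z + sin \<theta> *\<^sub>R g2 z)"
    by (intro C1_grad_cong[OF C1_grad_add[OF C1_grad_cmult[OF v1, of "cos \<theta>"] C1_grad_cmult[OF v2, of "sin \<theta>"]]]) auto
  define gw where "gw z = cos \<theta> *\<^sub>R g1 z + sin \<theta> *\<^sub>R g2 z" for z
  have g1: "g1 z = cos \<theta> *\<^sub>R gw z" for z
    using C1_grad_unique[OF v1 C1_grad_cmult[OF w, of "cos \<theta>"]] e by (simp add: gw_def)
  have g2: "g2 z = sin \<theta> *\<^sub>R gw z" for z
    using C1_grad_unique[OF v2 C1_grad_cmult[OF w, of "sin \<theta>"]] e by (simp add: gw_def)
  have "gw z \<bullet> cis \<theta> = 0" for z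
    using dvg[of z] g1[of z] g2[of z] by (simp add: inner_complex_def mult.commute)
  moreover have "((\<lambda>t. z + of_real t * cis \<theta>) has_vector_derivative cis \<theta>) (at t)" for t
    by (auto intro!: derivative_eq_intros simp: has_vector_derivative_def scaleR_conv_of_real)
  ultimately have "((\<lambda>t. w (z + of_real t * cis \<theta>)) has_real_derivative 0) (at t)" for t
    using C1_grad_along[OF w, of "\<lambda>t. z + of_real t * cis \<theta>" "cis \<theta>" t UNIV] by (simp add: gw_def)
  then have "w (z + of_real t * cis \<theta>) = w (z + of_real 0 * cis \<theta>)"
    by (intro DERIV_isconst_all[where f="\<lambda>t. w (z + of_real t * cis \<theta>)"]) auto
  then show ?thesis by (simp add: w_def)
qed

definition vec2 :: "complex \<Rightarrow> real ^ 2" where "vec2 z = vector [Re z, Im z]"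

lemma vec2_nth [simp]: "vec2 z $ 1 = Re z" "vec2 z $ 2 = Im z" by (simp_all add: vec2_def)

lemma vec2_eq: "vec2 z = Re z *\<^sub>R axis 1 1 + Im z *\<^sub>R axis 2 1"
  by (simp add: vec_eq_iff forall_2 axis_def)

lemma vec2_surj: "vec2 (Complex (x $ 1) (x $ 2)) = x" by (simp add: vec_eq_iff forall_2)

lemma bounded_linear_vec2: "bounded_linear vec2"
  unfolding vec2_eq[abs_def]
  by (intro bounded_linear_add bounded_linear_scaleR_const bounded_linear_Re bounded_linear_Im)

lemma class_C1_linear:
  assumes f: "class_C1 f" and L: "bounded_linear L"
  shows "class_C1 (\<lambda>x. L (f x))"
proof -
  obtain f' where f': "\<And>x. (f has_derivative blinfun_apply (f' x)) (at x)" "continuous_on UNIV f'"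
    using f unfolding class_C1_def by blast
  have "blinfun_apply (Blinfun L o\<^sub>L f' x) = (\<lambda>h. L (blinfun_apply (f' x) h))" for x
    by (rule ext) (simp add: bounded_linear_Blinfun_apply[OF L])
  then have "((\<lambda>x. L (f x)) has_derivative blinfun_apply (Blinfun L o\<^sub>L f' x)) (at x)" for x
    using bounded_linear.has_derivative[OF L f'(1)[of x]] by simp
  moreover have "continuous_on UNIV (\<lambda>x. Blinfun L o\<^sub>L f' x)" by (intro continuous_intros f'(2))
  ultimately show ?thesis unfolding class_C1_def by (intro exI[of _ "\<lambda>x. Blinfun L o\<^sub>L f' x"]) auto
qed

lemma partial_deriv_eq:
  assumes "(f has_derivative D) (at x)" shows "partial_deriv j f x = D (axis j 1)"
proof -
  have l: "((\<lambda>t. x + t *\<^sub>R axis j 1) has_derivative (\<lambda>t. t *\<^sub>R axis j 1)) (at 0)"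
    by (auto intro!: derivative_eq_intros)
  have "((\<lambda>t. f (x + t *\<^sub>R axis j 1)) has_derivative (\<lambda>t. D (t *\<^sub>R axis j 1))) (at (0::real))"
    by (rule has_derivative_compose[OF l]) (use assms in simp)
  moreover have "D (t *\<^sub>R axis j 1) = D (axis j 1) * t" for t
    using linear_scale[OF has_derivative_linear[OF assms]] by simp
  ultimately have "((\<lambda>t. f (x + t *\<^sub>R axis j 1)) has_real_derivative D (axis j 1)) (at 0)"
    by (simp add: has_field_derivative_def)
  then show ?thesis unfolding partial_deriv_def by (rule DERIV_imp_deriv)
qed

lemma class_C1_grad:
  fixes f :: "real ^ 2 \<Rightarrow> real"
  assumes "class_C1 f"
  shows "C1_grad (\<lambda>z. f (vec2 z)) (\<lambda>z. Complex (partial_deriv 1 f (vec2 z)) (partial_deriv 2 f (vec2 z)))"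
proof -
  obtain f' where f': "\<And>x. (f has_derivative blinfun_apply (f' x)) (at x)" "continuous_on UNIV f'"
    using assms unfolding class_C1_def by blast
  have pd: "partial_deriv j f x = blinfun_apply (f' x) (axis j 1)" for j x by (rule partial_deriv_eq[OF f'(1)])
  have vc: "continuous_on UNIV vec2" using bounded_linear_vec2 by (rule linear_continuous_on)
  show ?thesis unfolding C1_grad_def pd
  proof (intro conjI allI)
    show "continuous_on UNIV (\<lambda>z. Complex (blinfun_apply (f' (vec2 z)) (axis 1 1)) (blinfun_apply (f' (vec2 z)) (axis 2 1)))"
      by (intro continuous_intros continuous_on_compose2[OF f'(2) vc]) auto
    fix z
    have "((\<lambda>z. f (vec2 z)) has_derivative (\<lambda>h. blinfun_apply (f' (vec2 z)) (vec2 h))) (at z)"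
      by (rule has_derivative_compose[OF bounded_linear_imp_has_derivative[OF bounded_linear_vec2] f'(1)])
    moreover have "blinfun_apply (f' (vec2 z)) (vec2 h) = Complex (blinfun_apply (f' (vec2 z)) (axis 1 1)) (blinfun_apply (f' (vec2 z)) (axis 2 1)) \<bullet> h" for h
      unfolding vec2_eq by (simp add: blinfun.add_right blinfun.scaleR_right inner_complex_def)
    ultimately show "((\<lambda>z. f (vec2 z)) has_derivative (\<lambda>h. Complex (blinfun_apply (f' (vec2 z)) (axis 1 1)) (blinfun_apply (f' (vec2 z)) (axis 2 1)) \<bullet> h)) (at z)"
      by simp
  qed
qed

text \<open>The partial derivatives are bounded linear functions of the total derivative, which is of
class \<open>C^1\<close>.\<close>

lemma class_C2_components:
  fixes v :: "real ^ 2 \<Rightarrow> real ^ 2"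
  assumes "class_C2 v"
  shows "class_C1 (\<lambda>x. v x $ i)" "class_C1 (partial_deriv j (\<lambda>x. v x $ i))"
proof -
  obtain v' where v': "\<And>x. (v has_derivative blinfun_apply (v' x)) (at x)" "class_C1 v'"
    using assms unfolding class_C2_def by blast
  have "continuous_on UNIV v'"
    using v'(2) unfolding class_C1_def by (meson continuous_at_imp_continuous_on has_derivative_continuous)
  then have "class_C1 v" using v'(1) unfolding class_C1_def by blast
  then show "class_C1 (\<lambda>x. v x $ i)" by (rule class_C1_linear) (rule bounded_linear_vec_nth)
  have eq: "partial_deriv j (\<lambda>x. v x $ i) = (\<lambda>x. blinfun_apply (v' x) (axis j 1) $ i)"
    by (rule ext, rule partial_deriv_eq[OF bounded_linear.has_derivative[OF bounded_linear_vec_nth v'(1)]])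
  show "class_C1 (partial_deriv j (\<lambda>x. v x $ i))" unfolding eq
    by (rule class_C1_linear[OF v'(2)])
      (intro bounded_linear_compose[OF bounded_linear_vec_nth] blinfun.bounded_linear_left)
qed

text \<open>The set where a continuous function exceeds its essential bound is open and negligible.\<close>

lemma Linfty_continuous_bounded:
  fixes v :: "'a::euclidean_space \<Rightarrow> 'b::euclidean_space"
  assumes L: "in_Linfty v" and c: "continuous_on UNIV v"
  shows "\<exists>B. \<forall>x. norm (v x) \<le> B"
proof -
  obtain B where B: "AE x in lebesgue. norm (v x) \<le> B" using L unfolding in_Linfty_def by blast
  define S where "S = {x. B < norm (v x)}"
  have S: "open S" unfolding S_def by (intro open_Collect_less continuous_intros c)
  then have "S \<in> sets lebesgue" by (intro sets_completionI_sets) simp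
  then have "S \<in> null_sets lebesgue \<longleftrightarrow> (AE x in lebesgue. x \<notin> S)" by (rule AE_iff_null_sets)
  moreover have "AE x in lebesgue. x \<notin> S" using B by (simp add: S_def not_less)
  ultimately have "negligible S" by (simp add: negligible_iff_null_sets)
  with S have "S = {}" using open_not_negligible by blast
  then show ?thesis unfolding S_def by (auto simp: not_less)
qed

theorem theorem1p1:
  fixes v :: "real ^ 2 \<Rightarrow> real ^ 2" and p :: "real ^ 2 \<Rightarrow> real"
  assumes "class_C2 v"
    and "class_C1 p"
    and "stationary_euler v p"
    and "in_Linfty v"
    and "(INF x. norm (v x)) > 0"
  shows "shear_flow v \<and>
    (\<exists>(e :: real ^ 2) (V :: real \<Rightarrow> real).
       norm e = 1 \<and>
       (\<forall>x. v x = V (x \<bullet> perp e) *\<^sub>R e) \<and>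
       ((\<forall>s. V s > 0) \<or> (\<forall>s. V s < 0)))"
proof -
  note C = class_C2_components[OF assms(1)]
  have comp_cont: "continuous_on UNIV (\<lambda>x. v x $ i)" for i
    using C(1)[of i] unfolding class_C1_def by (meson continuous_at_imp_continuous_on has_derivative_continuous)
  have "continuous_on UNIV (\<lambda>x. \<chi> i. v x $ i)" by (intro continuous_on_vec_lambda comp_cont)
  then have vcont: "continuous_on UNIV v" by simp
  obtain M where M: "\<And>x. norm (v x) \<le> M" using Linfty_continuous_bounded[OF assms(4) vcont] by blast
  define m where "m = (INF x. norm (v x))"
  have m: "m > 0" using assms(5) by (simp add: m_def)
  have ml: "m \<le> norm (v x)" for x
    unfolding m_def by (rule cINF_lower) (auto intro!: bdd_belowI[of _ 0])
  have nrm: "cmod (Complex (v x $ 1) (v x $ 2)) = norm (v x)" for x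
    by (simp add: cmod_def norm_vec_def L2_set_def sum_2)
  define D where "D j i z = partial_deriv j (\<lambda>x. v x $ i) (vec2 z)" for j i z
  have v1: "C1_grad (\<lambda>z. v (vec2 z) $ 1) (\<lambda>z. Complex (D 1 1 z) (D 2 1 z))"
    unfolding D_def by (rule class_C1_grad[OF C(1)])
  have v2: "C1_grad (\<lambda>z. v (vec2 z) $ 2) (\<lambda>z. Complex (D 1 2 z) (D 2 2 z))"
    unfolding D_def by (rule class_C1_grad[OF C(1)])
  have DD: "\<exists>h. C1_grad (D j i) h" for i j
    unfolding D_def using class_C1_grad[OF C(2)[of j i]] by blast
  obtain h11 h12 h21 h22 where h: "C1_grad (D 1 1) h11" "C1_grad (D 2 1) h12" "C1_grad (D 1 2) h21" "C1_grad (D 2 2) h22"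
    using DD by metis
  have p: "C1_grad (\<lambda>z. p (vec2 z)) (\<lambda>z. Complex (partial_deriv 1 p (vec2 z)) (partial_deriv 2 p (vec2 z)))"
    by (rule class_C1_grad[OF assms(2)])
  have eq: "convective v x $ i + gradient p x $ i = 0" and dv: "divergence v x = 0" for x i
    using assms(3) unfolding stationary_euler_def by (auto simp flip: vector_add_component)
  have dvg: "D 1 1 z + D 2 2 z = 0" for z
    using dv[of "vec2 z"] by (simp add: divergence_def sum_2 D_def)
  have "\<exists>\<theta>. \<forall>z. Complex (v (vec2 z) $ 1) (v (vec2 z) $ 2) = of_real (cmod (Complex (v (vec2 z) $ 1) (v (vec2 z) $ 2))) * cis \<theta>"
  proof (rule euler_plane_direction[OF v1 v2 p, where m=m and M=M])
    fix z
    show "v (vec2 z) $ 1 * Re (Complex (D 1 1 z) (D 2 1 z)) + v (vec2 z) $ 2 * Im (Complex (D 1 1 z) (D 2 1 z)) +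
         Re (Complex (partial_deriv 1 p (vec2 z)) (partial_deriv 2 p (vec2 z))) = 0"
      using eq[of "vec2 z" 1] by (simp add: convective_def gradient_def sum_2 D_def)
    show "v (vec2 z) $ 1 * Re (Complex (D 1 2 z) (D 2 2 z)) + v (vec2 z) $ 2 * Im (Complex (D 1 2 z) (D 2 2 z)) +
         Im (Complex (partial_deriv 1 p (vec2 z)) (partial_deriv 2 p (vec2 z))) = 0"
      using eq[of "vec2 z" 2] by (simp add: convective_def gradient_def sum_2 D_def)
  qed (use h dvg m ml M nrm in auto)
  then obtain \<theta> where \<theta>: "\<And>z. Complex (v (vec2 z) $ 1) (v (vec2 z) $ 2) = of_real (cmod (Complex (v (vec2 z) $ 1) (v (vec2 z) $ 2))) * cis \<theta>"
    by blast
  define e where "e = vec2 (cis \<theta>)"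
  have ne: "norm e = 1" by (simp add: e_def norm_vec_def L2_set_def sum_2)
  have ve: "v x = norm (v x) *\<^sub>R e" for x
  proof -
    have "Complex (v x $ 1) (v x $ 2) = of_real (norm (v x)) * cis \<theta>"
      using \<theta>[of "Complex (x $ 1) (x $ 2)"] by (simp only: vec2_surj nrm)
    then show ?thesis by (simp add: vec_eq_iff forall_2 e_def complex_eq_iff)
  qed
  have along: "norm (v (x + t *\<^sub>R e)) = norm (v x)" for x t
  proof -
    define z where "z = Complex (x $ 1) (x $ 2)"
    have "vec2 (z + of_real t * cis \<theta>) = x + t *\<^sub>R e" by (simp add: z_def e_def vec_eq_iff forall_2)
    moreover have "vec2 z = x" by (simp add: z_def vec2_surj)
    ultimately show ?thesis
      using parallel_divfree_const[OF v1 v2 _ \<theta>, of z t] dvg nrm by simp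
  qed
  (* Every point is a point of the line spanned by \<open>perp e\<close> shifted in the direction \<open>e\<close>,
     and such shifts preserve the speed. *)
  define V where "V s = norm (v (s *\<^sub>R perp e))" for s
  have dec: "x = (x \<bullet> perp e) *\<^sub>R perp e + (x \<bullet> e) *\<^sub>R e" for x
  proof -
    have cs: "cos \<theta> * cos \<theta> + sin \<theta> * sin \<theta> = 1" using sin_cos_squared_add3[of \<theta>] by simp
    have 1: "cos \<theta> * (cos \<theta> * r) + sin \<theta> * (sin \<theta> * r) = r" for r
    proof -
      have "cos \<theta> * (cos \<theta> * r) + sin \<theta> * (sin \<theta> * r) = (cos \<theta> * cos \<theta> + sin \<theta> * sin \<theta>) * r"
        by (simp only: distrib_right mult.assoc)
      then show ?thesis by (simp only: cs mult_1_left)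
    qed
    show ?thesis unfolding vec_eq_iff forall_2
      by (simp add: perp_def inner_vec_def sum_2 e_def) (use 1[of "x $ 1"] 1[of "x $ 2"] in \<open>simp add: algebra_simps\<close>)
  qed
  have "v x = V (x \<bullet> perp e) *\<^sub>R e" for x
    using ve[of x] along[of "(x \<bullet> perp e) *\<^sub>R perp e" "x \<bullet> e"] dec[of x] by (simp add: V_def)
  moreover have "V s > 0" for s unfolding V_def using ml[of "s *\<^sub>R perp e"] m by linarith
  moreover have "shear_flow v" unfolding shear_flow_def using ne ve by blast
  ultimately show ?thesis using ne by blast
qed

end
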